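(* Let $m\ge 2$ and $N\ge 1$ be integers. For each $i\in\{1,\dots,m\}$ let $X_i\subseteq\mathbb{R}^N$ be a $C^2$ sub-manifold of dimension $d_i$, and let $\mu_i$ be a probability measure compactly supported in $X_i$ such that $\mu_i\in L^\infty(\mathcal{H}^{d_i}_{X_i})$, i.e. $\mu_i$ is absolutely continuous with respect to the $d_i$-dimensional Hausdorff measure on $X_i$ with essentially bounded density. Let $\mathbf{X}=X_1\times\cdots\times X_m$ and let $c:\mathbf{X}\to\mathbb{R}_+$ be of class $C^2$. Let $\kappa$ be a nonnegative integer such that $$d_c^+(\mathbf{x})\ge\kappa\quad\text{for every }\mathbf{x}\in\mathbf{X},\qquad\text{where } d_c^+(\mathbf{x})=\max\{d^+(g)(\mathbf{x}) : g\in G_c\}.$$ Then there exists a constant $C_*\in[0,\infty)$ such that for every $\varepsilon>0$, $$\mathsf{MOT}_\varepsilon\ge\mathsf{MOT}_0+\frac{\kappa}{2}\,\varepsilon\log(1/\varepsilon)-C_*\varepsilon.$$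
   Context: $\Pi(\mu_1,\dots,\mu_m)$ denotes the set of Borel probability measures $\gamma$ on $\mathbf{X}=X_1\times\cdots\times X_m$ whose $i$-th marginal is $\mu_i$ for every $i\in\{1,\dots,m\}$. For probability measures $p,q$, the Boltzmann–Shannon relative entropy is $\mathrm{Ent}(p\,|\,q)=\int\rho\log\rho\,\mathrm{d}q$ if $p=\rho q$ (i.e. $p$ is absolutely continuous with respect to $q$ with density $\rho$), and $\mathrm{Ent}(p\,|\,q)=+\infty$ otherwise. For $\varepsilon>0$, $$\mathsf{MOT}_\varepsilon=\inf\Bigl\{\int_{\mathbf{X}}c\,\mathrm{d}\gamma+\varepsilon\,\mathrm{Ent}\bigl(\gamma\,|\,\otimes_{i=1}^m\mu_i\bigr)\;:\;\gamma\in\Pi(\mu_1,\dots,\mu_m)\Bigr\},$$ and $$\mathsf{MOT}_0=\inf\Bigl\{\int_{\mathbf{X}}c\,\mathrm{d}\gamma\;:\;\gamma\in\Pi(\mu_1,\dots,\mu_m)\Bigr\}.$$ Definition of $G_c$. Let $P$ be the set of partitions $p=\{p_-,p_+\}$ of $\{1,\dots,m\}$ into two non-empty disjoint subsets. For $i\ne j$, $D^2_{x_ix_j}c=\sum_{\alpha,\beta}\frac{\partial^2c}{\partial x_i^{\alpha}\partial x_j^{\beta}}\,\mathrm{d}x_i^{\alpha}\otimes\mathrm{d}x_j^{\beta}$, where $(x_i^\alpha)_\alpha$ and $(x_j^\beta)_\beta$ are local coordinates on $X_i$ and $X_j$ (the expression does not depend on the choice of these coordinates); it is regarded as a bilinear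 form on each tangent space $T_{\mathbf{x}}\mathbf{X}=\prod_kT_{x_k}X_k$. For disjoint $q,q'\subseteq\{1,\dots,m\}$ put $D^2_{qq'}c=\sum_{i\in q,\,j\in q'}D^2_{x_ix_j}c$, and for $p\in P$ put $g_p=D^2_{p_-p_+}c+D^2_{p_+p_-}c$, a field of symmetric bilinear forms on the tangent bundle $T\mathbf{X}$. Let $$G_c=\Bigl\{\sum_{p\in P}t_pg_p\;:\;t_p\ge0\ \forall p\in P,\ \sum_{p\in P}t_p=1\Bigr\}.$$ For $g\in G_c$ and $\mathbf{x}\in\mathbf{X}$, $d^+(g)(\mathbf{x})$ is the number of positive eigenvalues (positive index of inertia) of the symmetric bilinear form $g(\mathbf{x})$ on $T_{\mathbf{x}}\mathbf{X}$. *)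

theory Defs
  imports "HOL-Probability.Probability"
begin

section \<open>Submanifolds of class \<open>C\<^sup>2\<close>\<close>

definition C2_on :: "'a::real_normed_vector set \<Rightarrow> ('a \<Rightarrow> 'b::real_normed_vector) \<Rightarrow> bool" where
  "C2_on U f \<longleftrightarrow> (\<exists>(f' :: 'a \<Rightarrow> 'a \<Rightarrow>\<^sub>L 'b) (f'' :: 'a \<Rightarrow> 'a \<Rightarrow>\<^sub>L ('a \<Rightarrow>\<^sub>L 'b)).
     (\<forall>x\<in>U. (f has_derivative blinfun_apply (f' x)) (at x) \<and>
            (f' has_derivative blinfun_apply (f'' x)) (at x)) \<and>
     continuous_on U f'')"

text \<open>A straightening chart at \<open>p\<close>: a \<open>C\<^sup>2\<close> diffeomorphism \<open>\<phi>\<close> (with inverse \<open>\<psi>\<close>) of an open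
  neighbourhood of \<open>p\<close> in the ambient space onto an open set, taking \<open>X\<close> to the \<open>d\<close>-dimensional
  coordinate subspace spanned by \<open>B \<subseteq> Basis\<close>. The local coordinates on \<open>X\<close> are the functions
  \<open>y \<mapsto> \<phi> y \<bullet> \<alpha>\<close> with \<open>\<alpha> \<in> B\<close>.\<close>

definition slice_chart ::
    "'a::euclidean_space set \<Rightarrow> nat \<Rightarrow> 'a \<Rightarrow> 'a set \<Rightarrow> ('a \<Rightarrow> 'a) \<Rightarrow> ('a \<Rightarrow> 'a) \<Rightarrow> bool" where
  "slice_chart X d p B \<phi> \<psi> \<longleftrightarrow> B \<subseteq> Basis \<and> card B = d \<and>
     (\<exists>U V. open U \<and> p \<in> U \<and> open V \<and> homeomorphism U V \<phi> \<psi> \<and>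
            C2_on U \<phi> \<and> C2_on V \<psi> \<and> \<phi> ` (U \<inter> X) = V \<inter> span B)"

definition C2_submanifold :: "nat \<Rightarrow> 'a::euclidean_space set \<Rightarrow> bool" where
  "C2_submanifold d X \<longleftrightarrow> (\<forall>p\<in>X. \<exists>B \<phi> \<psi>. slice_chart X d p B \<phi> \<psi>)"

definition tangent_space :: "'a::euclidean_space set \<Rightarrow> 'a \<Rightarrow> 'a set" where
  "tangent_space X p = {v. \<exists>\<gamma> :: real \<Rightarrow> 'a. \<exists>e>0. \<gamma> C1_differentiable_on {-e<..<e} \<and>
     \<gamma> ` {-e<..<e} \<subseteq> X \<and> \<gamma> 0 = p \<and> (\<gamma> has_vector_derivative v) (at 0)}"

text \<open>A function on a submanifold is of class \<open>C\<^sup>2\<close> iff it is locally the restriction of a \<open>C\<^sup>2\<close>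
  function on an open subset of the ambient space.\<close>

definition C2_on_submanifold :: "'a::euclidean_space set \<Rightarrow> ('a \<Rightarrow> real) \<Rightarrow> bool" where
  "C2_on_submanifold X f \<longleftrightarrow>
     (\<forall>p\<in>X. \<exists>U F. open U \<and> p \<in> U \<and> C2_on U F \<and> (\<forall>y\<in>U \<inter> X. F y = f y))"

definition prod_set :: "('m::finite \<Rightarrow> 'a set) \<Rightarrow> ('a ^ 'm) set" where
  "prod_set X = {x. \<forall>i. x $ i \<in> X i}"

definition prod_tangent :: "('m::finite \<Rightarrow> 'a::euclidean_space set) \<Rightarrow> 'a ^ 'm \<Rightarrow> ('a ^ 'm) set" where
  "prod_tangent X x = {u. \<forall>i. u $ i \<in> tangent_space (X i) (x $ i)}"


section \<open>Hausdorff measure\<close>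

text \<open>Normalised so that the \<open>n\<close>-dimensional measure on an \<open>n\<close>-dimensional Euclidean space is
  Lebesgue measure. The convention \<open>0 ^ 0 = 1\<close> makes the \<open>0\<close>-dimensional gauge of a nonempty set
  equal to 1, so that the \<open>0\<close>-dimensional measure is the counting measure.\<close>

definition hausdorff_gauge :: "nat \<Rightarrow> 'a::metric_space set \<Rightarrow> ennreal" where
  "hausdorff_gauge d S =
     (if S = {} then 0 else ennreal (unit_ball_vol (real d) * (diameter S / 2) ^ d))"

definition hausdorff_content :: "nat \<Rightarrow> real \<Rightarrow> 'a::metric_space set \<Rightarrow> ennreal" where
  "hausdorff_content d \<delta> A =
     (INF C \<in> {C :: nat \<Rightarrow> 'a set. A \<subseteq> (\<Union>n. C n) \<and> (\<forall>n. bounded (C n) \<and> diameter (C n) \<le> \<delta>)}.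
        \<Sum>n. hausdorff_gauge d (C n))"

definition hausdorff_measure :: "nat \<Rightarrow> 'a::metric_space measure" where
  "hausdorff_measure d =
     measure_of UNIV (sets borel) (\<lambda>A. SUP \<delta>\<in>{0<..}. hausdorff_content d \<delta> A)"

text \<open>\<open>\<mu> \<in> L\<^sup>\<infinity>(\<H>\<^sup>d restricted to X)\<close>; in particular \<open>\<mu>\<close> is a measure on the Borel sets of \<open>X\<close>.\<close>

definition bounded_density_wrt_hausdorff ::
    "nat \<Rightarrow> 'a::metric_space set \<Rightarrow> 'a measure \<Rightarrow> bool" where
  "bounded_density_wrt_hausdorff d X \<mu> \<longleftrightarrow>
     (let H = restrict_space (hausdorff_measure d) X in
        \<exists>\<rho> \<in> borel_measurable H. \<mu> = density H \<rho> \<and> (\<exists>M::real. AE x in H. \<rho> x \<le> ennreal M))"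


section \<open>Multi-marginal optimal transport\<close>

definition couplings ::
    "('m::finite \<Rightarrow> 'a::euclidean_space set) \<Rightarrow> ('m \<Rightarrow> 'a measure) \<Rightarrow> ('a ^ 'm) measure set" where
  "couplings X \<mu> = {\<gamma>. prob_space \<gamma> \<and> sets \<gamma> = sets (restrict_space borel (prod_set X)) \<and>
     (\<forall>i. distr \<gamma> (restrict_space borel (X i)) (\<lambda>x. x $ i) = \<mu> i)}"

definition prod_measure ::
    "('m::finite \<Rightarrow> 'a::euclidean_space set) \<Rightarrow> ('m \<Rightarrow> 'a measure) \<Rightarrow> ('a ^ 'm) measure" where
  "prod_measure X \<mu> =
     distr (PiM UNIV \<mu>) (restrict_space borel (prod_set X)) (\<lambda>f. \<chi> i. f i)"

text \<open>For probability measures \<open>p, q\<close> on the same \<open>\<sigma>\<close>-algebra. As \<open>\<rho> * ln \<rho>\<close> is bounded from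
  below, it fails to be \<open>q\<close>-integrable iff its integral is \<open>\<infinity>\<close>.\<close>

definition Ent :: "'a measure \<Rightarrow> 'a measure \<Rightarrow> ereal" where
  "Ent p q =
     (let \<rho> = (\<lambda>x. enn2real (RN_deriv q p x)) in
      if absolutely_continuous q p \<and> integrable q (\<lambda>x. \<rho> x * ln (\<rho> x))
      then ereal (\<integral>x. \<rho> x * ln (\<rho> x) \<partial>q) else \<infinity>)"

definition MOT ::
    "('m::finite \<Rightarrow> 'a::euclidean_space set) \<Rightarrow> ('m \<Rightarrow> 'a measure) \<Rightarrow> ('a ^ 'm \<Rightarrow> real) \<Rightarrow> real \<Rightarrow> ereal"
  where
  "MOT X \<mu> c \<epsilon> =
     (INF \<gamma>\<in>couplings X \<mu>.
        enn2ereal (\<integral>\<^sup>+x. ennreal (c x) \<partial>\<gamma>) + ereal \<epsilon> * Ent \<gamma> (prod_measure X \<mu>))"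

definition MOT0 ::
    "('m::finite \<Rightarrow> 'a::euclidean_space set) \<Rightarrow> ('m \<Rightarrow> 'a measure) \<Rightarrow> ('a ^ 'm \<Rightarrow> real) \<Rightarrow> ereal"
  where
  "MOT0 X \<mu> c = (INF \<gamma>\<in>couplings X \<mu>. enn2ereal (\<integral>\<^sup>+x. ennreal (c x) \<partial>\<gamma>))"


section \<open>The forms \<open>g\<^sub>p\<close>, the set \<open>G\<^sub>c\<close> and the positive index\<close>

definition some_chart ::
    "'a::euclidean_space set \<Rightarrow> nat \<Rightarrow> 'a \<Rightarrow> 'a set \<times> ('a \<Rightarrow> 'a) \<times> ('a \<Rightarrow> 'a)" where
  "some_chart X d p = (SOME (B, \<phi>, \<psi>). slice_chart X d p B \<phi> \<psi>)"

text \<open>Second partial derivative at \<open>x\<close>, for \<open>i \<noteq> j\<close>, along the coordinate \<open>\<alpha>\<close> of the chart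
  \<open>(\<phi>\<^sub>i, \<psi>\<^sub>i)\<close> in slot \<open>i\<close> and the coordinate \<open>\<beta>\<close> of the chart \<open>(\<phi>\<^sub>j, \<psi>\<^sub>j)\<close> in slot \<open>j\<close>.\<close>

definition mixed_partial ::
    "('a::euclidean_space ^ 'm::finite \<Rightarrow> real) \<Rightarrow> 'a ^ 'm \<Rightarrow>
     'm \<Rightarrow> ('a \<Rightarrow> 'a) \<Rightarrow> ('a \<Rightarrow> 'a) \<Rightarrow> 'a \<Rightarrow> 'm \<Rightarrow> ('a \<Rightarrow> 'a) \<Rightarrow> ('a \<Rightarrow> 'a) \<Rightarrow> 'a \<Rightarrow> real" where
  "mixed_partial c x i \<phi>\<^sub>i \<psi>\<^sub>i \<alpha> j \<phi>\<^sub>j \<psi>\<^sub>j \<beta> =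
     deriv (\<lambda>s. deriv (\<lambda>t. c (\<chi> k. if k = i then \<psi>\<^sub>i (\<phi>\<^sub>i (x $ i) + s *\<^sub>R \<alpha>)
                                    else if k = j then \<psi>\<^sub>j (\<phi>\<^sub>j (x $ j) + t *\<^sub>R \<beta>)
                                    else x $ k)) 0) 0"

text \<open>For \<open>i \<noteq> j\<close>, as a bilinear form on the tangent space of the product at \<open>x\<close>. The one-form
  \<open>dx\<^sub>i\<^sup>\<alpha>\<close> is \<open>v \<mapsto> D\<phi>(x\<^sub>i) v \<bullet> \<alpha>\<close>. By the chain rule the value on tangent vectors does not depend
  on the chosen charts.\<close>

definition D2_mixed ::
    "('m::finite \<Rightarrow> 'a::euclidean_space set) \<Rightarrow> ('m \<Rightarrow> nat) \<Rightarrow> ('a ^ 'm \<Rightarrow> real) \<Rightarrow>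
     'm \<Rightarrow> 'm \<Rightarrow> 'a ^ 'm \<Rightarrow> 'a ^ 'm \<Rightarrow> 'a ^ 'm \<Rightarrow> real" where
  "D2_mixed X d c i j x u v =
     (case some_chart (X i) (d i) (x $ i) of (B\<^sub>i, \<phi>\<^sub>i, \<psi>\<^sub>i) \<Rightarrow>
      case some_chart (X j) (d j) (x $ j) of (B\<^sub>j, \<phi>\<^sub>j, \<psi>\<^sub>j) \<Rightarrow>
        \<Sum>\<alpha>\<in>B\<^sub>i. \<Sum>\<beta>\<in>B\<^sub>j. mixed_partial c x i \<phi>\<^sub>i \<psi>\<^sub>i \<alpha> j \<phi>\<^sub>j \<psi>\<^sub>j \<beta> *
          (frechet_derivative \<phi>\<^sub>i (at (x $ i)) (u $ i) \<bullet> \<alpha>) *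
          (frechet_derivative \<phi>\<^sub>j (at (x $ j)) (v $ j) \<bullet> \<beta>))"

definition D2_block ::
    "('m::finite \<Rightarrow> 'a::euclidean_space set) \<Rightarrow> ('m \<Rightarrow> nat) \<Rightarrow> ('a ^ 'm \<Rightarrow> real) \<Rightarrow>
     'm set \<Rightarrow> 'm set \<Rightarrow> 'a ^ 'm \<Rightarrow> 'a ^ 'm \<Rightarrow> 'a ^ 'm \<Rightarrow> real" where
  "D2_block X d c q q' x u v = (\<Sum>i\<in>q. \<Sum>j\<in>q'. D2_mixed X d c i j x u v)"

definition two_partitions :: "'m::finite set set set" where
  "two_partitions = {p. partition_on UNIV p \<and> card p = 2}"

text \<open>For \<open>p = {p\<^sub>-, p\<^sub>+}\<close> the double sum has exactly the two terms
  \<open>(q, q') = (p\<^sub>-, p\<^sub>+)\<close> and \<open>(q, q') = (p\<^sub>+, p\<^sub>-)\<close>.\<close>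

definition g_form ::
    "('m::finite \<Rightarrow> 'a::euclidean_space set) \<Rightarrow> ('m \<Rightarrow> nat) \<Rightarrow> ('a ^ 'm \<Rightarrow> real) \<Rightarrow>
     'm set set \<Rightarrow> 'a ^ 'm \<Rightarrow> 'a ^ 'm \<Rightarrow> 'a ^ 'm \<Rightarrow> real" where
  "g_form X d c p x u v = (\<Sum>q\<in>p. \<Sum>q'\<in>p - {q}. D2_block X d c q q' x u v)"

definition G_set ::
    "('m::finite \<Rightarrow> 'a::euclidean_space set) \<Rightarrow> ('m \<Rightarrow> nat) \<Rightarrow> ('a ^ 'm \<Rightarrow> real) \<Rightarrow>
     ('a ^ 'm \<Rightarrow> 'a ^ 'm \<Rightarrow> 'a ^ 'm \<Rightarrow> real) set" where
  "G_set X d c = {(\<lambda>x u v. \<Sum>p\<in>two_partitions. t p * g_form X d c p x u v) | t.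
     (\<forall>p\<in>two_partitions. 0 \<le> t p) \<and> (\<Sum>p\<in>two_partitions. t p) = 1}"

text \<open>Eigenvalues, counted with multiplicity, of a symmetric bilinear form \<open>b\<close> on a subspace \<open>T\<close> are
  taken with respect to the ambient inner product; by Sylvester's law of inertia the number of
  positive ones does not depend on the inner product.\<close>

definition form_eigenspace ::
    "'b::euclidean_space set \<Rightarrow> ('b \<Rightarrow> 'b \<Rightarrow> real) \<Rightarrow> real \<Rightarrow> 'b set" where
  "form_eigenspace T b l = {v\<in>T. \<forall>w\<in>T. b v w = l * (v \<bullet> w)}"

definition positive_index :: "'b::euclidean_space set \<Rightarrow> ('b \<Rightarrow> 'b \<Rightarrow> real) \<Rightarrow> nat" where
  "positive_index T b =
     (\<Sum>l | 0 < l \<and> (\<exists>v\<in>form_eigenspace T b l. v \<noteq> 0). dim (form_eigenspace T b l))"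

definition d_plus ::
    "('m::finite \<Rightarrow> 'a::euclidean_space set) \<Rightarrow> ('m \<Rightarrow> nat) \<Rightarrow> ('a ^ 'm \<Rightarrow> real) \<Rightarrow> 'a ^ 'm \<Rightarrow> nat" where
  "d_plus X d c x = Max {positive_index (prod_tangent X x) (g x) | g. g \<in> G_set X d c}"

end

theory Submission
  imports Defs
begin

text \<open>
  The lower bound comes from duality. Suppose that \<open>\<phi>\<^sub>1, \<dots>, \<phi>\<^sub>m\<close> are bounded measurable potentials
  with \<open>\<Sum>\<^sub>i \<phi>\<^sub>i (x\<^sub>i) \<le> c x\<close> on the product \<open>K\<close> of compact sets carrying the marginals, and put
  \<open>E x = c x - \<Sum>\<^sub>i \<phi>\<^sub>i (x\<^sub>i)\<close>, so that \<open>E \<ge> 0\<close> on \<open>K\<close>. The Gibbs inequality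
  \<open>r ln r \<ge> r ln b + r - b\<close>, integrated against the product \<open>Q\<close> of the marginals, gives for every
  coupling \<open>\<gamma>\<close>
  \<open>\<integral>c d\<gamma> + \<epsilon> Ent(\<gamma>|Q) \<ge> \<Sum>\<^sub>i \<integral>\<phi>\<^sub>i d\<mu>\<^sub>i - \<epsilon> ln \<integral>exp(-E/\<epsilon>) dQ\<close>
  (lemma \<open>entropic_lower_bound\<close>). Two facts remain: the potentials can be chosen with
  \<open>\<Sum>\<^sub>i \<integral>\<phi>\<^sub>i d\<mu>\<^sub>i\<close> arbitrarily close to the unregularised optimal cost, and
  \<open>\<integral>exp(-E/\<epsilon>) dQ \<le> A \<epsilon>\<^bsup>\<kappa>/2\<^esup>\<close> with a constant \<open>A\<close> that does not depend on the potentials.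

  Near-optimal potentials (lemma \<open>approximate_duality\<close>) are step functions. The sets \<open>K\<^sub>i\<close> are cut
  into finitely many small cells, the resulting finite transport problem is dualised by Farkas'
  lemma, and a discrete plan is turned into a coupling with the exact marginals by spreading each
  atom along the product of the normalised restrictions of the marginals to its cells. Uniform
  continuity of \<open>c\<close> on \<open>K\<close> controls the error.

  For the integral it suffices that \<open>Q {E \<le> s\<^sup>2} \<le> C s\<^sup>\<kappa>\<close> for \<open>0 < s \<le> 1\<close>. If \<open>y\<close> and \<open>z\<close> arise from
  \<open>x\<close> and \<open>x'\<close> by exchanging the coordinates in one block of a two-block partition, then the
  potentials cancel and \<open>c x + c x' - c y - c z \<le> E x + E x'\<close>. In charts around a point the left
  side is, to second order, the mixed Hessian form of that partition, evaluated at the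
  coordinate difference \<open>h\<close> of the two points, divided by two. A convex
  combination of these forms is positive definite on a subspace \<open>Z\<close> of dimension at least \<open>\<kappa>\<close>. Hence,
  within a sublevel set, \<open>h\<close> is controlled by \<open>s\<close> and by its component orthogonal to \<open>Z\<close>:
  cutting the orthogonal directions into \<open>O(s\<^bsup>-(D - dim Z)\<^esup>)\<close> cells, where \<open>D\<close> is the total
  dimension, leaves pieces of diameter \<open>O(s)\<close>
  (lemma \<open>coercive_covering\<close>). Each piece has \<open>Q\<close>-measure \<open>O(s\<^sup>D)\<close>, since a measure with bounded density
  with respect to the \<open>d\<close>-dimensional Hausdorff measure on a submanifold gives mass \<open>O(s\<^sup>d)\<close> to sets of
  diameter \<open>s\<close> in a chart (lemma \<open>slice_chart_upper_regular\<close>). The product is \<open>O(s\<^bsup>dim Z\<^esup>)\<close>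
  (lemma \<open>local_sublevel_estimate\<close>), and compactness of \<open>K\<close> makes the constant global.
\<close>

section \<open>Finite transport duality and grids\<close>

text \<open>Induction on the number of generators \<open>a j\<close>, after Bartl. If some \<open>x\<^sub>0\<close> violates the implication with
  the generator \<open>l\<close> left out, then everything is projected along \<open>x\<^sub>0\<close> onto the kernel of \<open>a l\<close>.\<close>

lemma farkas:
  fixes a :: "'j \<Rightarrow> 'i \<Rightarrow> real" and b :: "'i \<Rightarrow> real"
  assumes "finite J" "finite I"
    and "\<And>x. (\<And>j. j \<in> J \<Longrightarrow> (\<Sum>i\<in>I. a j i * x i) \<le> 0) \<Longrightarrow> (\<Sum>i\<in>I. b i * x i) \<le> 0"
  shows "\<exists>u. (\<forall>j\<in>J. 0 \<le> u j) \<and> (\<forall>i\<in>I. b i = (\<Sum>j\<in>J. u j * a j i))"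
  using assms(1,3)
proof (induction J arbitrary: a b rule: finite_induct)
  case empty
  have "(\<Sum>i\<in>I. b i * b i) \<le> 0" by (rule empty) simp
  then have "(\<Sum>i\<in>I. b i * b i) = 0" by (simp add: order_antisym sum_nonneg)
  then have "\<forall>i\<in>I. b i = 0" using assms(2) by (simp add: sum_nonneg_eq_0_iff)
  then show ?case by auto
next
  case (insert l J)
  show ?case
  proof (cases "\<forall>x. (\<forall>j\<in>J. (\<Sum>i\<in>I. a j i * x i) \<le> 0) \<longrightarrow> (\<Sum>i\<in>I. b i * x i) \<le> 0")
    case True
    then obtain u where u: "\<forall>j\<in>J. 0 \<le> u j" "\<forall>i\<in>I. b i = (\<Sum>j\<in>J. u j * a j i)"
      using insert.IH[of a b] by blast
    have "(\<Sum>j\<in>insert l J. (u(l := 0)) j * a j i) = (\<Sum>j\<in>J. u j * a j i)" for i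
      using insert.hyps by (auto intro!: sum.cong)
    then show ?thesis using u by (intro exI[of _ "u(l := 0)"]) auto
  next
    case False
    then obtain x0 where x0: "\<And>j. j \<in> J \<Longrightarrow> (\<Sum>i\<in>I. a j i * x0 i) \<le> 0" "(\<Sum>i\<in>I. b i * x0 i) > 0"
      by (auto simp: not_le)
    define t where "t = (\<Sum>i\<in>I. a l i * x0 i)"
    have t: "t > 0"
    proof (rule ccontr)
      assume "\<not> t > 0"
      then have "(\<Sum>i\<in>I. b i * x0 i) \<le> 0"
        using x0(1) by (intro insert.prems) (auto simp: t_def)
      with x0(2) show False by simp
    qed
    \<comment> \<open>Normalised so that the functional \<open>a l\<close> takes the value 1 at \<open>x1\<close>.\<close>
    define x1 where "x1 i = x0 i / t" for i
    have l1: "(\<Sum>i\<in>I. a l i * x1 i) = 1"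
      using t by (simp add: x1_def t_def sum_divide_distrib[symmetric])
    have j1: "(\<Sum>i\<in>I. a j i * x1 i) \<le> 0" if "j \<in> J" for j
      using t x0(1)[OF that] by (simp add: x1_def sum_divide_distrib[symmetric] divide_le_0_iff)
    have b1: "(\<Sum>i\<in>I. b i * x1 i) \<ge> 0"
      using t x0(2) by (simp add: x1_def sum_divide_distrib[symmetric])
    define S where "S f = (\<Sum>i\<in>I. f i * x1 i)" for f :: "'i \<Rightarrow> real"
    have lin: "(\<Sum>i\<in>I. f i * (x i - q * x1 i)) = (\<Sum>i\<in>I. f i * x i) - S f * q" for f x q
      by (simp add: S_def algebra_simps sum_subtractf sum_distrib_left)
    have proj: "(\<Sum>i\<in>I. (f i - a l i * S f) * x i) = (\<Sum>i\<in>I. f i * (x i - (\<Sum>i\<in>I. a l i * x i) * x1 i))" for f x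
    proof -
      have "(\<Sum>i\<in>I. (f i - a l i * S f) * x i) = (\<Sum>i\<in>I. f i * x i) - S f * (\<Sum>i\<in>I. a l i * x i)"
        by (simp add: algebra_simps sum_subtractf sum_distrib_left)
      then show ?thesis unfolding lin .
    qed
    have "\<exists>u. (\<forall>j\<in>J. 0 \<le> u j) \<and> (\<forall>i\<in>I. b i - a l i * S b = (\<Sum>j\<in>J. u j * (a j i - a l i * S (a j))))"
    proof (rule insert.IH)
      fix x assume H: "\<And>j. j \<in> J \<Longrightarrow> (\<Sum>i\<in>I. (a j i - a l i * S (a j)) * x i) \<le> 0"
      let ?y = "\<lambda>i. x i - (\<Sum>i\<in>I. a l i * x i) * x1 i"
      have "S (a l) = 1" by (simp add: S_def l1)
      then have "(\<Sum>i\<in>I. a l i * ?y i) = 0" unfolding lin by simp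
      then have "(\<Sum>i\<in>I. b i * ?y i) \<le> 0"
        using H by (intro insert.prems) (auto simp: proj)
      then show "(\<Sum>i\<in>I. (b i - a l i * S b) * x i) \<le> 0" by (simp only: proj)
    qed
    then obtain u where u: "\<And>j. j \<in> J \<Longrightarrow> 0 \<le> u j"
      "\<And>i. i \<in> I \<Longrightarrow> b i - a l i * S b = (\<Sum>j\<in>J. u j * (a j i - a l i * S (a j)))" by blast
    define w where "w = S b - (\<Sum>j\<in>J. u j * S (a j))"
    have "(\<Sum>j\<in>J. u j * S (a j)) \<le> 0"
      using u(1) j1 by (intro sum_nonpos mult_nonneg_nonpos) (auto simp: S_def)
    then have w: "w \<ge> 0" using b1 by (simp add: w_def S_def)
    have "b i = (\<Sum>j\<in>insert l J. (u(l := w)) j * a j i)" if "i \<in> I" for i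
    proof -
      have "(\<Sum>j\<in>J. (u(l := w)) j * a j i) = (\<Sum>j\<in>J. u j * a j i)"
        using insert.hyps by (auto intro!: sum.cong)
      moreover have "b i = a l i * S b + (\<Sum>j\<in>J. u j * a j i) - a l i * (\<Sum>j\<in>J. u j * S (a j))"
        using u(2)[OF that] by (simp add: algebra_simps sum_subtractf sum_distrib_left)
      ultimately show ?thesis using insert.hyps by (simp add: w_def algebra_simps)
    qed
    then show ?thesis using u(1) w by (intro exI[of _ "u(l := w)"]) auto
  qed
qed

text \<open>A multi-marginal transport problem on finite sets \<open>L i\<close>, with approximate optimality instead of
  attainment: Farkas' lemma is applied to the infeasible system that asks for a plan of cost at most
  the infimum minus \<open>\<delta> / 2\<close>.\<close>

lemma finite_transport_duality:
  fixes m :: "'i::finite \<Rightarrow> 'l \<Rightarrow> real" and cost :: "('i \<Rightarrow> 'l) \<Rightarrow> real"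
  assumes fin: "\<And>i. finite (L i)"
    and m: "\<And>i a. a \<in> L i \<Longrightarrow> 0 \<le> m i a" "\<And>i. (\<Sum>a\<in>L i. m i a) = 1"
    and cost: "\<And>j. j \<in> Pi UNIV L \<Longrightarrow> 0 \<le> cost j" and "\<delta> > 0"
  obtains \<pi> \<phi> where "\<And>j. j \<in> Pi UNIV L \<Longrightarrow> 0 \<le> \<pi> j"
    and "\<And>i a. a \<in> L i \<Longrightarrow> (\<Sum>j | j \<in> Pi UNIV L \<and> j i = a. \<pi> j) = m i a"
    and "\<And>j. j \<in> Pi UNIV L \<Longrightarrow> (\<Sum>i\<in>UNIV. \<phi> i (j i)) \<le> cost j"
    and "(\<Sum>j\<in>Pi UNIV L. \<pi> j * cost j) \<le> (\<Sum>i\<in>UNIV. \<Sum>a\<in>L i. \<phi> i a * m i a) + \<delta>"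
proof -
  let ?J = "Pi UNIV L"
  have "Pi UNIV L = PiE UNIV L" by (simp add: PiE_def)
  then have finJ: "finite ?J" using fin by (simp add: finite_PiE)
  define F where "F = {\<pi>. (\<forall>j\<in>?J. 0 \<le> \<pi> j) \<and>
     (\<forall>i. \<forall>a\<in>L i. (\<Sum>j | j \<in> ?J \<and> j i = a. \<pi> j) = m i a)}"
  define cst where "cst \<pi> = (\<Sum>j\<in>?J. \<pi> j * cost j)" for \<pi> :: "('i \<Rightarrow> 'l) \<Rightarrow> real"
  define \<pi>0 where "\<pi>0 j = (\<Prod>i\<in>UNIV. m i (j i))" for j
  have \<pi>0: "\<pi>0 \<in> F"
  proof -
    have "0 \<le> \<pi>0 j" if "j \<in> ?J" for j
      using that m(1) by (auto simp: \<pi>0_def intro!: prod_nonneg)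
    moreover have "(\<Sum>j | j \<in> ?J \<and> j i = a. \<pi>0 j) = m i a" if a: "a \<in> L i" for i a
    proof -
      have "{j. j \<in> ?J \<and> j i = a} = PiE UNIV (L(i := {a}))"
        using a by (auto simp: PiE_def Pi_def split: if_splits)
      then have "(\<Sum>j | j \<in> ?J \<and> j i = a. \<pi>0 j) = (\<Prod>k\<in>UNIV. \<Sum>b\<in>(L(i := {a})) k. m k b)"
        using fin by (subst prod_sum_PiE) (simp_all add: \<pi>0_def)
      also have "\<dots> = (\<Prod>k\<in>UNIV. if k = i then m i a else 1)"
        by (rule prod.cong) (auto simp: m(2))
      finally show ?thesis by simp
    qed
    ultimately show ?thesis by (auto simp: F_def)
  qed
  have bdd: "bdd_below (cst ` F)"
    using cost by (intro bdd_belowI[of _ 0]) (auto simp: cst_def F_def intro!: sum_nonneg)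
  define V where "V = Inf (cst ` F)"
  have "\<exists>\<pi>\<in>F. cst \<pi> < V + \<delta> / 2"
    using cInf_lessD[of "cst ` F" "V + \<delta>/2"] \<pi>0 \<open>\<delta> > 0\<close> by (auto simp: V_def)
  then obtain \<pi> where \<pi>: "\<pi> \<in> F" "cst \<pi> < V + \<delta> / 2" by blast
  have V: "V \<le> cst \<pi>'" if "\<pi>' \<in> F" for \<pi>'
    unfolding V_def using bdd that by (intro cInf_lower) auto
  \<comment> \<open>\<open>None\<close> indexes the cost constraint, \<open>Some (i, a)\<close> the marginal constraints.\<close>
  define I where "I = insert None (Some ` (SIGMA i:UNIV. L i))"
  have finI: "finite I" using fin by (auto simp: I_def)
  have sumI: "(\<Sum>k\<in>I. f k) = f None + (\<Sum>i\<in>UNIV. \<Sum>a\<in>L i. f (Some (i, a)))" for f :: "_ \<Rightarrow> real"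
  proof -
    have "(\<Sum>k\<in>Some ` (SIGMA i:UNIV. L i). f k) = (\<Sum>k\<in>(SIGMA i:UNIV. L i). f (Some k))"
      by (subst sum.reindex) auto
    also have "\<dots> = (\<Sum>i\<in>UNIV. \<Sum>a\<in>L i. f (Some (i, a)))"
      using fin by (subst sum.Sigma) (auto simp: split_def)
    finally show ?thesis unfolding I_def using fin by (subst sum.insert) auto
  qed
  \<comment> \<open>The generator \<open>None\<close> is the slack variable of the cost constraint.\<close>
  define A where "A j k = (case j of None \<Rightarrow> (case k of None \<Rightarrow> 1 | Some _ \<Rightarrow> 0)
      | Some j \<Rightarrow> (case k of None \<Rightarrow> cost j | Some (i, a) \<Rightarrow> (if j i = a then 1 else 0 :: real)))" for j k
  define B where "B k = (case k of None \<Rightarrow> V - \<delta> / 2 | Some (i, a) \<Rightarrow> m i a)" for k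
  have A_sum: "(\<Sum>k\<in>I. A (Some j) k * x k) = cost j * x None + (\<Sum>i\<in>UNIV. x (Some (i, j i)))"
    if "j \<in> ?J" for j x
  proof -
    have "(\<Sum>a\<in>L i. A (Some j) (Some (i, a)) * x (Some (i, a))) = x (Some (i, j i))" for i
      using fin that by (simp add: A_def if_distrib[of "\<lambda>t. t * _"] Pi_iff sum.delta cong: if_cong)
    then show ?thesis by (simp add: sumI) (simp add: A_def)
  qed
  have "\<not> (\<exists>u. (\<forall>j\<in>insert None (Some ` ?J). 0 \<le> u j) \<and>
      (\<forall>k\<in>I. B k = (\<Sum>j\<in>insert None (Some ` ?J). u j * A j k)))"
  proof
    assume "\<exists>u. (\<forall>j\<in>insert None (Some ` ?J). 0 \<le> u j) \<and>
      (\<forall>k\<in>I. B k = (\<Sum>j\<in>insert None (Some ` ?J). u j * A j k))"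
    then obtain u where u: "\<And>j. j \<in> ?J \<Longrightarrow> 0 \<le> u (Some j)" "0 \<le> u None"
      and e: "\<And>k. k \<in> I \<Longrightarrow> B k = u None * A None k + (\<Sum>j\<in>?J. u (Some j) * A (Some j) k)"
      using finJ by (auto simp: sum.reindex)
    have "(\<lambda>j. u (Some j)) \<in> F"
      unfolding F_def
    proof (intro CollectI conjI ballI allI)
      fix i a assume a: "a \<in> L i"
      have "m i a = (\<Sum>j\<in>?J. u (Some j) * (if j i = a then 1 else 0))"
        using e[of "Some (i, a)"] a by (auto simp: I_def B_def A_def)
      also have "\<dots> = (\<Sum>j | j \<in> ?J \<and> j i = a. u (Some j))"
        using finJ by (simp add: sum.inter_filter[symmetric] if_distrib cong: if_cong)
      finally show "(\<Sum>j | j \<in> ?J \<and> j i = a. u (Some j)) = m i a" by simp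
    qed (use u in auto)
    then have "V \<le> cst (\<lambda>j. u (Some j))" by (rule V)
    moreover have "V - \<delta> / 2 = u None + cst (\<lambda>j. u (Some j))"
      using e[of None] by (simp add: I_def B_def A_def cst_def)
    ultimately show False using u(2) \<open>\<delta> > 0\<close> by simp
  qed
  moreover have "finite (insert None (Some ` ?J))" using finJ by simp
  ultimately obtain y where y: "\<And>j. j \<in> insert None (Some ` ?J) \<Longrightarrow> (\<Sum>k\<in>I. A j k * y k) \<le> 0"
    and "\<not> (\<Sum>k\<in>I. B k * y k) \<le> 0"
    using farkas[of "insert None (Some ` ?J)" I A B] finI by meson
  then have By: "(\<Sum>k\<in>I. B k * y k) > 0" by simp
  have y0: "y None \<le> 0" using y[of None] by (simp add: sumI) (simp add: A_def)
  have yj: "cost j * y None + (\<Sum>i\<in>UNIV. y (Some (i, j i))) \<le> 0" if "j \<in> ?J" for j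
    using y[of "Some j"] that by (simp add: A_sum)
  have Bm: "(V - \<delta>/2) * y None + (\<Sum>i\<in>UNIV. \<Sum>a\<in>L i. m i a * y (Some (i, a))) > 0"
    using By by (simp add: sumI B_def)
  have mF: "(\<Sum>i\<in>UNIV. \<Sum>a\<in>L i. m i a * f i a) = (\<Sum>j\<in>?J. \<pi>' j * (\<Sum>i\<in>UNIV. f i (j i)))"
    if "\<pi>' \<in> F" for \<pi>' f
  proof -
    have "(\<Sum>j\<in>?J. \<pi>' j * (\<Sum>i\<in>UNIV. f i (j i))) = (\<Sum>i\<in>UNIV. \<Sum>j\<in>?J. \<pi>' j * f i (j i))"
      by (subst sum.swap) (simp add: sum_distrib_left)
    also have "\<dots> = (\<Sum>i\<in>UNIV. \<Sum>a\<in>L i. \<Sum>j | j \<in> ?J \<and> j i = a. \<pi>' j * f i (j i))"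
      using fin finJ by (intro sum.cong refl sum.group[symmetric]) (auto simp: Pi_iff)
    also have "\<dots> = (\<Sum>i\<in>UNIV. \<Sum>a\<in>L i. \<Sum>j | j \<in> ?J \<and> j i = a. \<pi>' j * f i a)"
      by (intro sum.cong refl) auto
    also have "\<dots> = (\<Sum>i\<in>UNIV. \<Sum>a\<in>L i. m i a * f i a)"
      using that by (intro sum.cong refl) (auto simp: F_def sum_distrib_right[symmetric])
    finally show ?thesis by simp
  qed
  \<comment> \<open>If the cost had multiplier 0, the product plan would contradict the strict inequality \<open>Bm\<close>.\<close>
  have y_neg: "y None < 0"
  proof (rule ccontr)
    assume "\<not> y None < 0"
    then have "y None = 0" using y0 by simp
    then have "(\<Sum>j\<in>?J. \<pi>0 j * (\<Sum>i\<in>UNIV. y (Some (i, j i)))) > 0"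
      using Bm mF[OF \<pi>0, of "\<lambda>i a. y (Some (i, a))"] by simp
    moreover have "(\<Sum>j\<in>?J. \<pi>0 j * (\<Sum>i\<in>UNIV. y (Some (i, j i)))) \<le> 0"
    proof (rule sum_nonpos, rule mult_nonneg_nonpos)
      fix j assume "j \<in> ?J"
      then show "0 \<le> \<pi>0 j" "(\<Sum>i\<in>UNIV. y (Some (i, j i))) \<le> 0"
        using yj[of j] \<pi>0 \<open>y None = 0\<close> by (auto simp: F_def)
    qed
    ultimately show False by simp
  qed
  define \<phi> where "\<phi> i a = y (Some (i, a)) / (- y None)" for i a
  show thesis
  proof (rule that[of \<pi> \<phi>])
    fix j assume j: "j \<in> ?J"
    show "0 \<le> \<pi> j" using \<pi>(1) j by (auto simp: F_def)
    have "(\<Sum>i\<in>UNIV. y (Some (i, j i))) / (- y None) \<le> cost j"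
      using yj[OF j] y_neg by (simp add: pos_divide_le_eq del: divide_minus_right minus_divide_right)
    then show "(\<Sum>i\<in>UNIV. \<phi> i (j i)) \<le> cost j"
      by (simp only: \<phi>_def sum_divide_distrib)
  next
    fix i a assume "a \<in> L i" then show "(\<Sum>j | j \<in> ?J \<and> j i = a. \<pi> j) = m i a"
      using \<pi>(1) by (auto simp: F_def)
  next
    have "V - \<delta> / 2 \<le> (\<Sum>i\<in>UNIV. \<Sum>a\<in>L i. m i a * y (Some (i, a))) / (- y None)"
      using Bm y_neg by (simp add: pos_le_divide_eq del: divide_minus_right minus_divide_right)
    also have "\<dots> = (\<Sum>i\<in>UNIV. \<Sum>a\<in>L i. \<phi> i a * m i a)"
      by (simp only: \<phi>_def sum_divide_distrib) (simp add: mult_ac)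
    finally show "(\<Sum>j\<in>?J. \<pi> j * cost j) \<le> (\<Sum>i\<in>UNIV. \<Sum>a\<in>L i. \<phi> i a * m i a) + \<delta>"
      using \<pi>(2) by (simp add: cst_def)
  qed
qed


text \<open>The cell of the grid of mesh \<open>s\<close> that contains \<open>x\<close>, in the coordinates along the vectors of \<open>B\<close>; the
  index is a function on \<open>B\<close>, undefined elsewhere.\<close>

definition grid_index :: "real \<Rightarrow> 'a::real_inner set \<Rightarrow> 'a \<Rightarrow> 'a \<Rightarrow> int" where
  "grid_index s B x = (\<lambda>b\<in>B. \<lfloor>(x \<bullet> b) / s\<rfloor>)"

lemma grid_index_eqD:
  assumes "s > 0" "grid_index s B x = grid_index s B y" "b \<in> B"
  shows "\<bar>(x - y) \<bullet> b\<bar> \<le> s"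
proof -
  have "\<lfloor>(x \<bullet> b) / s\<rfloor> = \<lfloor>(y \<bullet> b) / s\<rfloor>"
    using fun_cong[OF assms(2), of b] assms(3) by (simp add: grid_index_def)
  then have "\<bar>(x \<bullet> b) / s - (y \<bullet> b) / s\<bar> < 1" by linarith
  then show ?thesis using \<open>s > 0\<close>
    by (simp add: inner_diff_left diff_divide_distrib[symmetric] abs_divide)
qed

lemma grid_index_image:
  assumes "s > 0" "\<delta> \<ge> 0" "finite B" "\<And>x b. x \<in> S \<Longrightarrow> b \<in> B \<Longrightarrow> \<bar>(x - y) \<bullet> b\<bar> \<le> \<delta>"
  shows "finite (grid_index s B ` S)" and "real (card (grid_index s B ` S)) \<le> (2 * \<delta> / s + 2) ^ card B"
proof -
  define R where "R b = {\<lfloor>(y \<bullet> b - \<delta>) / s\<rfloor>..\<lfloor>(y \<bullet> b + \<delta>) / s\<rfloor>}" for b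
  have "grid_index s B x \<in> PiE B R" if "x \<in> S" for x
  proof -
    have "\<lfloor>(x \<bullet> b) / s\<rfloor> \<in> R b" if "b \<in> B" for b
    proof -
      have "\<bar>(x - y) \<bullet> b\<bar> \<le> \<delta>" using assms(4) \<open>x \<in> S\<close> that .
      then show ?thesis unfolding R_def using \<open>s > 0\<close>
        by (auto intro!: floor_mono divide_right_mono simp: inner_diff_left)
    qed
    then show ?thesis by (auto simp: grid_index_def)
  qed
  then have sub: "grid_index s B ` S \<subseteq> PiE B R" by blast
  have fin: "finite (PiE B R)" using \<open>finite B\<close> by (intro finite_PiE) (auto simp: R_def)
  show "finite (grid_index s B ` S)" using sub fin by (rule finite_subset)
  have cR: "real (card (R b)) \<le> 2 * \<delta> / s + 2" for b
  proof -
    have "(y \<bullet> b + \<delta>) / s - (y \<bullet> b - \<delta>) / s = 2 * \<delta> / s"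
      by (simp add: diff_divide_distrib[symmetric])
    moreover have "2 * \<delta> / s \<ge> 0" using assms(1,2) by simp
    ultimately show ?thesis unfolding R_def by simp linarith
  qed
  have "real (card (grid_index s B ` S)) \<le> real (card (PiE B R))"
    using card_mono[OF fin sub] by simp
  also have "\<dots> = (\<Prod>b\<in>B. real (card (R b)))" using \<open>finite B\<close> by (simp add: card_PiE)
  also have "\<dots> \<le> (\<Prod>b\<in>B. 2 * \<delta> / s + 2)" using cR by (intro prod_mono) auto
  finally show "real (card (grid_index s B ` S)) \<le> (2 * \<delta> / s + 2) ^ card B" by simp
qed

lemma norm_le_sum_orthonormal:
  fixes B :: "'a::real_inner set"
  assumes "finite B" "pairwise orthogonal B" "\<And>b. b \<in> B \<Longrightarrow> norm b = 1" "v \<in> span B"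
  shows "v = (\<Sum>b\<in>B. (v \<bullet> b) *\<^sub>R b)" and "norm v \<le> (\<Sum>b\<in>B. \<bar>v \<bullet> b\<bar>)"
proof -
  obtain u where u: "v = (\<Sum>b\<in>B. u b *\<^sub>R b)" using assms(1,4) by (auto simp: span_finite)
  have "v \<bullet> b = u b" if "b \<in> B" for b
  proof -
    have "v \<bullet> b = (\<Sum>a\<in>B. if a = b then u b else 0)"
      unfolding u inner_sum_left using assms(2,3) that
      by (intro sum.cong) (auto simp: pairwise_def orthogonal_def norm_eq_1)
    then show ?thesis using assms(1) that by simp
  qed
  then show *: "v = (\<Sum>b\<in>B. (v \<bullet> b) *\<^sub>R b)" using u by simp
  have "norm v \<le> (\<Sum>b\<in>B. norm ((v \<bullet> b) *\<^sub>R b))" by (subst *) (rule norm_sum)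
  then show "norm v \<le> (\<Sum>b\<in>B. \<bar>v \<bullet> b\<bar>)" using assms(3) by simp
qed

lemma grid_index_dist:
  fixes B :: "'a::real_inner set"
  assumes "s > 0" "finite B" "pairwise orthogonal B" "\<And>b. b \<in> B \<Longrightarrow> norm b = 1" "x - y \<in> span B"
    and "grid_index s B x = grid_index s B y"
  shows "dist x y \<le> real (card B) * s"
proof -
  have "dist x y \<le> (\<Sum>b\<in>B. \<bar>(x - y) \<bullet> b\<bar>)"
    unfolding dist_norm using assms by (intro norm_le_sum_orthonormal) auto
  also have "\<dots> \<le> (\<Sum>b\<in>B. s)" using assms by (intro sum_mono grid_index_eqD) auto
  finally show ?thesis by simp
qed

lemma grid_index_vimage_borel:
  fixes B :: "'a::euclidean_space set"
  assumes "finite B"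
  shows "{x. grid_index s B x = a} \<in> sets borel"
proof (cases "a \<in> extensional B")
  case True
  then have "{x. grid_index s B x = a} = {x. \<forall>b\<in>B. \<lfloor>(x \<bullet> b) / s\<rfloor> = a b}"
    by (auto simp: grid_index_def fun_eq_iff extensional_def)
  also have "\<dots> = {x\<in>space borel. \<forall>b\<in>B. real_of_int \<lfloor>(x \<bullet> b) / s\<rfloor> = a b}" by simp
  also have "\<dots> \<in> sets borel" using assms by measurable
  finally show ?thesis .
next
  case False
  then have "{x. grid_index s B x = a} = {}" by (auto simp: grid_index_def)
  then show ?thesis by (simp only: sets.empty_sets)
qed

section \<open>Measures with bounded density with respect to Hausdorff measure\<close>

text \<open>Whether or not \<open>\<mu>\<close> is countably additive: the measure generated by a function that is not has the
  value 0 everywhere. Thus upper bounds on the Hausdorff set function transfer to the Hausdorff measure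
  without a proof that the latter is a measure.\<close>

lemma emeasure_measure_of_le:
  assumes "A \<subseteq> Pow \<Omega>"
  shows "emeasure (measure_of \<Omega> A \<mu>) B \<le> \<mu> B"
  using assms by (simp add: emeasure_measure_of_conv)

lemma emeasure_restrict_space_le: "emeasure (restrict_space M \<Omega>) A \<le> emeasure M A"
  unfolding restrict_space_def using sets.space_closed[of M] by (intro emeasure_measure_of_le) auto

lemma hausdorff_content_le_finite_cover:
  fixes A :: "'a::metric_space set"
  assumes "finite I" "A \<subseteq> (\<Union>i\<in>I. C i)" "\<delta> \<ge> 0"
    and "\<And>i. i \<in> I \<Longrightarrow> bounded (C i) \<and> diameter (C i) \<le> \<delta>"
    and "\<And>i. i \<in> I \<Longrightarrow> hausdorff_gauge d (C i) \<le> g"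
  shows "hausdorff_content d \<delta> A \<le> of_nat (card I) * g"
proof -
  obtain h where h: "bij_betw h {0..<card I} I" using \<open>finite I\<close> ex_bij_betw_nat_finite by blast
  define D where "D n = (if n < card I then C (h n) else {})" for n
  have "h n \<in> I" if "n < card I" for n using h that by (auto simp: bij_betw_def)
  then have hD: "bounded (D n) \<and> diameter (D n) \<le> \<delta>" for n
    using assms(3,4) by (auto simp: D_def)
  have "I = h ` {0..<card I}" using h by (simp add: bij_betw_def)
  then have "A \<subseteq> (\<Union>n\<in>{0..<card I}. C (h n))" using assms(2) by (metis image_image)
  then have "A \<subseteq> (\<Union>n. D n)" by (fastforce simp: D_def)
  then have "hausdorff_content d \<delta> A \<le> (\<Sum>n. hausdorff_gauge d (D n))"
    unfolding hausdorff_content_def using hD by (intro INF_lower) auto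
  also have "\<dots> = (\<Sum>n<card I. hausdorff_gauge d (D n))"
    by (rule suminf_finite) (auto simp: D_def hausdorff_gauge_def)
  also have "\<dots> \<le> (\<Sum>n<card I. g)"
    using \<open>\<And>n. n < card I \<Longrightarrow> h n \<in> I\<close> assms(5) by (intro sum_mono) (auto simp: D_def)
  finally show ?thesis by simp
qed

text \<open>The bound does not depend on \<open>\<delta>\<close>: a grid of mesh \<open>r / k\<close> has at most \<open>(4 k)\<^sup>d\<close> cells that meet \<open>T\<close>,
  and each image has a gauge of order \<open>(r / k)\<^sup>d\<close>, so \<open>k\<close> cancels and may be taken as large as the
  diameter bound \<open>\<delta>\<close> demands.\<close>

lemma hausdorff_content_lipschitz_image_le:
  fixes \<psi> :: "'a::euclidean_space \<Rightarrow> 'b::euclidean_space"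
  assumes B: "finite B" "pairwise orthogonal B" "\<And>b. b \<in> B \<Longrightarrow> norm b = 1"
    and L: "0 \<le> L" "\<And>x y. x \<in> T \<Longrightarrow> y \<in> T \<Longrightarrow> dist (\<psi> x) (\<psi> y) \<le> L * dist x y"
    and T: "T \<subseteq> span B" "\<And>x b. x \<in> T \<Longrightarrow> b \<in> B \<Longrightarrow> \<bar>(x - y0) \<bullet> b\<bar> \<le> r" and "r > 0" "\<delta> > 0"
  shows "hausdorff_content (card B) \<delta> (\<psi> ` T) \<le>
    ennreal (unit_ball_vol (real (card B)) * (2 * L * real (card B) * r) ^ card B)"
proof -
  let ?d = "card B"
  let ?m = "L * real ?d * r"
  obtain k where k: "real k > max 1 (?m / \<delta>)" using reals_Archimedean2 by blast
  then have k1: "real k > 1" and k2: "?m / real k \<le> \<delta>"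
    using \<open>\<delta> > 0\<close> by (auto simp: field_simps)
  define s where "s = r / real k"
  have s: "s > 0" using k1 \<open>r > 0\<close> by (simp add: s_def)
  define I where "I = grid_index s B ` T"
  define C where "C a = \<psi> ` {x\<in>T. grid_index s B x = a}" for a
  have fin: "finite I" and card: "real (card I) \<le> (2 * r / s + 2) ^ ?d"
    unfolding I_def using s B T(2) \<open>r > 0\<close>
    by (auto intro!: grid_index_image[where y = y0 and \<delta> = r])
  have bd: "dist u v \<le> ?m / real k" if uv: "u \<in> C a" "v \<in> C a" for u v a
  proof -
    obtain x y where xy: "x \<in> T" "y \<in> T" "grid_index s B x = a" "grid_index s B y = a"
      and uv_eq: "u = \<psi> x" "v = \<psi> y" using uv unfolding C_def by blast
    have "dist u v \<le> L * dist x y" using L(2) xy uv_eq by simp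
    also have "dist x y \<le> real ?d * s"
      using s B T(1) xy by (intro grid_index_dist) (auto intro: span_diff)
    finally show ?thesis using L(1) by (simp add: s_def mult_left_mono mult.assoc)
  qed
  have m0: "0 \<le> ?m / real k" using L(1) \<open>r > 0\<close> by simp
  have diam: "diameter (C a) \<le> ?m / real k" for a
    using bd m0 by (intro diameter_le) (auto simp: dist_norm)
  have bdd: "bounded (C a)" for a
    using bd unfolding bounded_two_points by blast
  have gauge: "hausdorff_gauge ?d (C a) \<le> ennreal (unit_ball_vol (real ?d) * (?m / real k / 2) ^ ?d)" for a
    using diam[of a] diameter_ge_0[OF bdd[of a]]
    by (auto simp: hausdorff_gauge_def intro!: ennreal_leI mult_left_mono power_mono)
  have "hausdorff_content ?d \<delta> (\<psi> ` T) \<le>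
      of_nat (card I) * ennreal (unit_ball_vol (real ?d) * (?m / real k / 2) ^ ?d)"
    using fin \<open>\<delta> > 0\<close> bdd gauge order_trans[OF diam k2]
    by (intro hausdorff_content_le_finite_cover[where C = C]) (auto simp: C_def I_def)
  also have "\<dots> = ennreal (real (card I) * (unit_ball_vol (real ?d) * (?m / real k / 2) ^ ?d))"
    using m0 by (simp add: ennreal_mult' ennreal_of_nat_eq_real_of_nat)
  also have "\<dots> \<le> ennreal ((4 * real k) ^ ?d * (unit_ball_vol (real ?d) * (?m / real k / 2) ^ ?d))"
  proof -
    have "2 * r / s + 2 \<le> 4 * real k" using k1 \<open>r > 0\<close> by (simp add: s_def)
    moreover have "0 \<le> 2 * r / s + 2" using s \<open>r > 0\<close> by simp
    ultimately have "real (card I) \<le> (4 * real k) ^ ?d"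
      using card power_mono[of "2 * r / s + 2" "4 * real k" ?d] by linarith
    moreover have m1: "0 \<le> ?m / real k / 2" using m0 by (rule divide_nonneg_nonneg) simp
    ultimately show ?thesis
      by (intro ennreal_leI mult_right_mono mult_nonneg_nonneg zero_le_power unit_ball_vol_nonneg m1) simp_all
  qed
  also have "(4 * real k) ^ ?d * (unit_ball_vol (real ?d) * (?m / real k / 2) ^ ?d) =
      unit_ball_vol (real ?d) * (4 * real k * (?m / real k / 2)) ^ ?d"
    by (simp only: power_mult_distrib[of "4 * real k"] mult.left_commute)
  also have "4 * real k * (?m / real k / 2) = 2 * L * real ?d * r" using k1 by simp
  finally show ?thesis .
qed

lemma emeasure_bounded_density_le:
  assumes "bounded_density_wrt_hausdorff d X \<mu>"
  obtains M where "0 \<le> M" "\<And>A. emeasure \<mu> A \<le> ennreal M * (SUP \<delta>\<in>{0<..}. hausdorff_content d \<delta> A)"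
proof -
  let ?H = "restrict_space (hausdorff_measure d) X"
  obtain \<rho> M0 where \<rho>: "\<rho> \<in> borel_measurable ?H" "\<mu> = density ?H \<rho>"
    and M0: "AE x in ?H. \<rho> x \<le> ennreal M0"
    using assms unfolding bounded_density_wrt_hausdorff_def Let_def by blast
  define M where "M = max 0 M0"
  have M: "AE x in ?H. \<rho> x \<le> ennreal M"
    using M0 by eventually_elim (auto simp: M_def intro: order_trans ennreal_leI)
  show thesis
  proof (rule that)
    show "0 \<le> M" by (simp add: M_def)
    fix A
    have "emeasure \<mu> A \<le> ennreal M * emeasure ?H A"
    proof (cases "A \<in> sets ?H")
      case True
      then have "emeasure \<mu> A = (\<integral>\<^sup>+x. \<rho> x * indicator A x \<partial>?H)"
        using \<rho> by (simp add: emeasure_density)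
      also have "\<dots> \<le> (\<integral>\<^sup>+x. ennreal M * indicator A x \<partial>?H)"
        using M by (intro nn_integral_mono_AE) (auto elim!: eventually_mono intro!: mult_right_mono)
      also have "\<dots> = ennreal M * emeasure ?H A" using True by (rule nn_integral_cmult_indicator)
      finally show ?thesis .
    next
      case False
      then have "A \<notin> sets \<mu>" using \<rho>(2) by simp
      then show ?thesis by (simp add: emeasure_notin_sets)
    qed
    also have "emeasure ?H A \<le> (SUP \<delta>\<in>{0<..}. hausdorff_content d \<delta> A)"
      by (rule order_trans[OF emeasure_restrict_space_le])
        (auto simp: hausdorff_measure_def intro!: emeasure_measure_of_le)
    finally show "emeasure \<mu> A \<le> ennreal M * (SUP \<delta>\<in>{0<..}. hausdorff_content d \<delta> A)"
      by (simp add: mult_left_mono)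
  qed
qed

lemma C2_on_locally_lipschitz:
  fixes f :: "'a::euclidean_space \<Rightarrow> 'b::real_normed_vector"
  assumes "open V" "y \<in> V" "C2_on V f"
  obtains r L where "r > 0" "ball y r \<subseteq> V" "L \<ge> 0"
    "\<And>a b. a \<in> ball y r \<Longrightarrow> b \<in> ball y r \<Longrightarrow> dist (f a) (f b) \<le> L * dist a b"
proof -
  obtain f' :: "'a \<Rightarrow> 'a \<Rightarrow>\<^sub>L 'b" and f'' where f': "\<And>x. x \<in> V \<Longrightarrow> (f has_derivative blinfun_apply (f' x)) (at x)"
    and f'': "\<And>x. x \<in> V \<Longrightarrow> (f' has_derivative blinfun_apply (f'' x)) (at x)"
    using assms(3) unfolding C2_on_def by blast
  have "isCont f' y" using f''[OF \<open>y \<in> V\<close>] by (rule has_derivative_continuous)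
  then obtain r1 where r1: "r1 > 0" "\<And>x. dist x y < r1 \<Longrightarrow> dist (f' x) (f' y) < 1"
    unfolding continuous_at_eps_delta by (meson zero_less_one)
  obtain r2 where r2: "r2 > 0" "ball y r2 \<subseteq> V" using assms(1,2) openE by blast
  define r where "r = min r1 r2"
  define L where "L = norm (f' y) + 1"
  have bd: "norm (f' x) \<le> L" if "x \<in> ball y r" for x
  proof -
    have "dist (f' x) (f' y) < 1" using r1(2) that by (auto simp: r_def dist_commute)
    then show ?thesis using norm_triangle_sub[of "f' x" "f' y"] by (simp add: L_def dist_norm)
  qed
  have der: "(f has_derivative blinfun_apply (f' x)) (at x within ball y r)" if "x \<in> ball y r" for x
    by (rule has_derivative_at_withinI, rule f') (use that r2(2) in \<open>auto simp: r_def\<close>)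
  have on: "onorm (blinfun_apply (f' x)) \<le> L" if "x \<in> ball y r" for x
    using bd[OF that] by (simp only: norm_blinfun.rep_eq)
  have "dist (f a) (f b) \<le> L * dist a b" if ab: "a \<in> ball y r" "b \<in> ball y r" for a b
    unfolding dist_norm by (rule differentiable_bound[OF convex_ball der on ab])
  moreover have "r > 0" "ball y r \<subseteq> V" "L \<ge> 0" using r1 r2 by (auto simp: r_def L_def)
  ultimately show thesis by (intro that)
qed

text \<open>Balls of radius \<open>\<delta>\<close> in chart coordinates have measure \<open>O(\<delta>\<^sup>d)\<close>, uniformly in their centre \<open>y\<close>. For
  non-measurable \<open>A\<close> the claim holds because the measure is then 0.\<close>

lemma slice_chart_upper_regular:
  fixes X :: "'a::euclidean_space set"
  assumes "bounded_density_wrt_hausdorff (card B) X \<mu>" "B \<subseteq> Basis"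
    and "open V" "\<phi> p \<in> V" "homeomorphism U V \<phi> \<psi>" "C2_on V \<psi>" "\<phi> ` (U \<inter> X) = V \<inter> span B"
  obtains r M where "r > 0" "M \<ge> 0" "ball (\<phi> p) r \<subseteq> V"
    "\<And>\<delta> y A. \<delta> > 0 \<Longrightarrow> A \<subseteq> {x\<in>U \<inter> X. \<phi> x \<in> ball (\<phi> p) r \<and> dist (\<phi> x) y \<le> \<delta>} \<Longrightarrow>
       emeasure \<mu> A \<le> ennreal (M * \<delta> ^ card B)"
proof -
  obtain r L where r: "r > 0" "ball (\<phi> p) r \<subseteq> V" "L \<ge> 0" and
    L: "\<And>a b. a \<in> ball (\<phi> p) r \<Longrightarrow> b \<in> ball (\<phi> p) r \<Longrightarrow> dist (\<psi> a) (\<psi> b) \<le> L * dist a b"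
    using C2_on_locally_lipschitz[OF assms(3,4,6)] by blast
  obtain M where M: "0 \<le> M" "\<And>A. emeasure \<mu> A \<le> ennreal M * (SUP \<delta>\<in>{0<..}. hausdorff_content (card B) \<delta> A)"
    using emeasure_bounded_density_le[OF assms(1)] by blast
  have B: "finite B" "pairwise orthogonal B" "\<And>b. b \<in> B \<Longrightarrow> norm b = 1"
    using assms(2) finite_Basis
    by (auto simp: finite_subset pairwise_def orthogonal_def subset_iff intro: inner_not_same_Basis)
  define K where "K = unit_ball_vol (real (card B)) * (2 * L * real (card B)) ^ card B"
  have K: "K \<ge> 0" using r by (simp add: K_def)
  show thesis
  proof (rule that[OF r(1) _ r(2)])
    show "0 \<le> M * K" using M K by simp
    fix \<delta> y A assume "\<delta> > 0" and A: "A \<subseteq> {x\<in>U \<inter> X. \<phi> x \<in> ball (\<phi> p) r \<and> dist (\<phi> x) y \<le> \<delta>}"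
    have "hausdorff_content (card B) \<eta> A \<le> ennreal (K * \<delta> ^ card B)" if "\<eta> > 0" for \<eta>
    proof -
      have "\<psi> (\<phi> x) = x" if "x \<in> A" for x
        using A that homeomorphism_apply1[OF assms(5)] by blast
      then have im: "\<psi> ` \<phi> ` A = A" by (simp add: image_image)
      have "\<bar>(\<phi> x - y) \<bullet> b\<bar> \<le> \<delta>" if "x \<in> A" "b \<in> B" for x b
      proof -
        have "\<bar>(\<phi> x - y) \<bullet> b\<bar> \<le> norm (\<phi> x - y) * norm b" by (rule Cauchy_Schwarz_ineq2)
        also have "\<dots> = dist (\<phi> x) y" using B(3) that by (simp add: dist_norm)
        also have "\<dots> \<le> \<delta>" using A that by blast
        finally show ?thesis .
      qed
      then have cs: "\<bar>(x - y) \<bullet> b\<bar> \<le> \<delta>" if "x \<in> \<phi> ` A" "b \<in> B" for x b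
        using that by blast
      have span: "\<phi> ` A \<subseteq> span B" using A assms(7) by blast
      have sub: "\<phi> ` A \<subseteq> ball (\<phi> p) r" using A by blast
      have lip: "dist (\<psi> x) (\<psi> x') \<le> L * dist x x'" if "x \<in> \<phi> ` A" "x' \<in> \<phi> ` A" for x x'
        by (rule L; rule subsetD[OF sub]; fact)
      have "hausdorff_content (card B) \<eta> (\<psi> ` \<phi> ` A) \<le>
          ennreal (unit_ball_vol (real (card B)) * (2 * L * real (card B) * \<delta>) ^ card B)"
        using hausdorff_content_lipschitz_image_le[OF B r(3) lip span cs \<open>\<delta> > 0\<close> \<open>\<eta> > 0\<close>] .
      then show ?thesis by (simp only: im K_def power_mult_distrib mult.assoc)
    qed
    then have "(SUP \<eta>\<in>{0<..}. hausdorff_content (card B) \<eta> A) \<le> ennreal (K * \<delta> ^ card B)"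
      by (intro SUP_least) auto
    then have "emeasure \<mu> A \<le> ennreal M * ennreal (K * \<delta> ^ card B)"
      using M(2)[of A] by (meson mult_left_mono order_trans zero_le)
    then show "emeasure \<mu> A \<le> ennreal (M * K * \<delta> ^ card B)"
      using M K \<open>\<delta> > 0\<close> by (simp add: ennreal_mult[symmetric] mult.assoc)
  qed
qed

section \<open>Calculus of twice continuously differentiable maps\<close>

text \<open>Continuously differentiable on \<open>U\<close>, with the derivative as a bounded linear map. A \<open>C\<^sup>2\<close> function is
  one whose derivative is \<open>C\<^sup>1\<close>.\<close>

definition C1_on :: "'a::real_normed_vector set \<Rightarrow> ('a \<Rightarrow> 'b::real_normed_vector) \<Rightarrow> bool" where
  "C1_on U f \<longleftrightarrow> (\<exists>f' :: 'a \<Rightarrow> 'a \<Rightarrow>\<^sub>L 'b.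
     (\<forall>x\<in>U. (f has_derivative blinfun_apply (f' x)) (at x)) \<and> continuous_on U f')"

lemma C2_on_iff_C1_on_derivative:
  "C2_on U f \<longleftrightarrow> (\<exists>f'. (\<forall>x\<in>U. (f has_derivative blinfun_apply (f' x)) (at x)) \<and> C1_on U f')"
  unfolding C2_on_def C1_on_def by blast

text \<open>On a finite-dimensional domain, continuity of the derivative can be tested on each vector \<open>h\<close>.\<close>

lemma C1_onI:
  fixes f :: "'a::euclidean_space \<Rightarrow> 'b::real_normed_vector"
  assumes "\<And>x. x \<in> U \<Longrightarrow> (f has_derivative F x) (at x)"
    and "\<And>h. continuous_on U (\<lambda>x. F x h)"
  shows "C1_on U f"
proof -
  have F: "blinfun_apply (Blinfun (F x)) = F x" if "x \<in> U" for x
    using assms(1)[OF that] has_derivative_bounded_linear bounded_linear_Blinfun_apply by blast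
  have "continuous_on U (\<lambda>x. Blinfun (F x))"
  proof (rule continuous_on_blinfun_componentwise)
    fix i :: 'a
    show "continuous_on U (\<lambda>x. blinfun_apply (Blinfun (F x)) i)"
      using assms(2)[of i] by (rule continuous_on_eq) (simp add: F)
  qed
  moreover have "\<forall>x\<in>U. (f has_derivative blinfun_apply (Blinfun (F x))) (at x)"
    using assms(1) F by simp
  ultimately show ?thesis
    unfolding C1_on_def by (intro exI[of _ "\<lambda>x. Blinfun (F x)"] conjI)
qed

lemma C1_onE:
  assumes "C1_on U f"
  obtains f' where "\<And>x. x \<in> U \<Longrightarrow> (f has_derivative blinfun_apply (f' x)) (at x)" "continuous_on U f'"
  using assms unfolding C1_on_def by blast

lemma C2_onE:
  assumes "C2_on U f"
  obtains f' where "\<And>x. x \<in> U \<Longrightarrow> (f has_derivative blinfun_apply (f' x)) (at x)" "C1_on U f'"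
  using assms unfolding C2_on_iff_C1_on_derivative by blast

lemma C1_on_continuous_on:
  assumes "C1_on U f"
  shows "continuous_on U f"
proof -
  obtain f' where "\<And>x. x \<in> U \<Longrightarrow> (f has_derivative blinfun_apply (f' x)) (at x)"
    using C1_onE[OF assms] by blast
  then have "isCont f x" if "x \<in> U" for x
    using that has_derivative_continuous by blast
  then show ?thesis by (intro continuous_at_imp_continuous_on) blast
qed

lemma C2_on_imp_C1_on:
  assumes "C2_on U f"
  shows "C1_on U f"
proof -
  obtain f' where "\<forall>x\<in>U. (f has_derivative blinfun_apply (f' x)) (at x)" "C1_on U f'"
    using assms unfolding C2_on_iff_C1_on_derivative by blast
  then show ?thesis
    unfolding C1_on_def[of U f] by (intro exI[of _ f'] conjI C1_on_continuous_on)
qed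

lemma C2_on_subset:
  assumes "C2_on U f" "V \<subseteq> U"
  shows "C2_on V f"
  using assms unfolding C2_on_def by (blast intro: continuous_on_subset)

lemma C1_on_const: "C1_on U (\<lambda>x. c)"
  unfolding C1_on_def by (intro exI[of _ "\<lambda>x. 0"]) (auto simp: zero_blinfun.rep_eq)

lemma C1_on_add:
  assumes "C1_on U f" "C1_on U g"
  shows "C1_on U (\<lambda>x. f x + g x)"
proof -
  obtain f' where f': "\<And>x. x \<in> U \<Longrightarrow> (f has_derivative blinfun_apply (f' x)) (at x)" "continuous_on U f'"
    using C1_onE[OF assms(1)] by blast
  obtain g' where g': "\<And>x. x \<in> U \<Longrightarrow> (g has_derivative blinfun_apply (g' x)) (at x)" "continuous_on U g'"
    using C1_onE[OF assms(2)] by blast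
  have "((\<lambda>x. f x + g x) has_derivative blinfun_apply (f' x + g' x)) (at x)" if "x \<in> U" for x
    using has_derivative_add[OF f'(1) g'(1)] that by (simp add: plus_blinfun.rep_eq)
  then show ?thesis unfolding C1_on_def
    using f'(2) g'(2) by (intro exI[of _ "\<lambda>x. f' x + g' x"]) (auto intro: continuous_on_add)
qed

lemma C1_on_bilinear:
  fixes f :: "'a::euclidean_space \<Rightarrow> 'b::real_normed_vector"
    and pr :: "'b \<Rightarrow> 'c::real_normed_vector \<Rightarrow> 'd::real_normed_vector"
  assumes "bounded_bilinear pr" "C1_on U f" "C1_on U g"
  shows "C1_on U (\<lambda>x. pr (f x) (g x))"
proof -
  interpret bounded_bilinear pr by fact
  obtain f' where f': "\<And>x. x \<in> U \<Longrightarrow> (f has_derivative blinfun_apply (f' x)) (at x)" "continuous_on U f'"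
    using C1_onE[OF assms(2)] by blast
  obtain g' where g': "\<And>x. x \<in> U \<Longrightarrow> (g has_derivative blinfun_apply (g' x)) (at x)" "continuous_on U g'"
    using C1_onE[OF assms(3)] by blast
  show ?thesis
  proof (rule C1_onI)
    fix x assume "x \<in> U"
    then show "((\<lambda>x. pr (f x) (g x)) has_derivative (\<lambda>h. pr (f x) (g' x h) + pr (f' x h) (g x))) (at x)"
      by (intro FDERIV f' g')
  next
    fix h
    show "continuous_on U (\<lambda>x. pr (f x) (g' x h) + pr (f' x h) (g x))"
      using C1_on_continuous_on[OF assms(2)] C1_on_continuous_on[OF assms(3)] f'(2) g'(2)
      by (intro continuous_on_add continuous_on blinfun.continuous_on continuous_on_const)
  qed
qed

lemma C1_on_compose:
  fixes g :: "'a::euclidean_space \<Rightarrow> 'b::real_normed_vector"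
  assumes "C1_on U g" "C1_on V f" "g ` U \<subseteq> V"
  shows "C1_on U (\<lambda>x. f (g x))"
proof -
  obtain f' where f': "\<And>x. x \<in> V \<Longrightarrow> (f has_derivative blinfun_apply (f' x)) (at x)" "continuous_on V f'"
    using C1_onE[OF assms(2)] by blast
  obtain g' where g': "\<And>x. x \<in> U \<Longrightarrow> (g has_derivative blinfun_apply (g' x)) (at x)" "continuous_on U g'"
    using C1_onE[OF assms(1)] by blast
  show ?thesis
  proof (rule C1_onI)
    fix x assume "x \<in> U"
    then show "((\<lambda>x. f (g x)) has_derivative (\<lambda>h. f' (g x) (g' x h))) (at x)"
      using assms(3) by (intro has_derivative_compose[OF g'(1)] f'(1)) auto
  next
    fix h
    show "continuous_on U (\<lambda>x. f' (g x) (g' x h))"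
      using C1_on_continuous_on[OF assms(1)] g'(2) f'(2) assms(3)
      by (intro blinfun.continuous_on continuous_on_const continuous_on_compose2[OF f'(2)])
  qed
qed

lemma C2_on_compose:
  fixes g :: "'a::euclidean_space \<Rightarrow> 'b::real_normed_vector"
  assumes "C2_on U g" "C2_on V f" "g ` U \<subseteq> V"
  shows "C2_on U (\<lambda>x. f (g x))"
proof -
  obtain f' where f': "\<And>x. x \<in> V \<Longrightarrow> (f has_derivative blinfun_apply (f' x)) (at x)" "C1_on V f'"
    using C2_onE[OF assms(2)] by blast
  obtain g' where g': "\<And>x. x \<in> U \<Longrightarrow> (g has_derivative blinfun_apply (g' x)) (at x)" "C1_on U g'"
    using C2_onE[OF assms(1)] by blast
  have "((\<lambda>x. f (g x)) has_derivative blinfun_apply (f' (g x) o\<^sub>L g' x)) (at x)" if "x \<in> U" for x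
  proof -
    have "g x \<in> V" using assms(3) that by blast
    from has_derivative_compose[OF g'(1)[OF that] f'(1)[OF this]]
    show ?thesis by (simp add: blinfun_compose.rep_eq comp_def)
  qed
  moreover have "C1_on U (\<lambda>x. f' (g x) o\<^sub>L g' x)"
    by (intro C1_on_bilinear[OF bounded_bilinear_blinfun_compose] g'(2)
        C1_on_compose[OF C2_on_imp_C1_on[OF assms(1)] f'(2) assms(3)])
  ultimately show ?thesis
    unfolding C2_on_iff_C1_on_derivative by (intro exI[of _ "\<lambda>x. f' (g x) o\<^sub>L g' x"]) blast
qed

lemma C2_on_bounded_linear:
  assumes "bounded_linear f"
  shows "C2_on U f"
  unfolding C2_on_iff_C1_on_derivative
  using assms by (intro exI[of _ "\<lambda>x. Blinfun f"])
    (auto simp: bounded_linear_Blinfun_apply C1_on_const intro: bounded_linear_imp_has_derivative)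

lemma C2_on_add:
  assumes "C2_on U f" "C2_on U g"
  shows "C2_on U (\<lambda>x. f x + g x)"
proof -
  obtain f' where f': "\<And>x. x \<in> U \<Longrightarrow> (f has_derivative blinfun_apply (f' x)) (at x)" "C1_on U f'"
    using C2_onE[OF assms(1)] by blast
  obtain g' where g': "\<And>x. x \<in> U \<Longrightarrow> (g has_derivative blinfun_apply (g' x)) (at x)" "C1_on U g'"
    using C2_onE[OF assms(2)] by blast
  have "((\<lambda>x. f x + g x) has_derivative blinfun_apply (f' x + g' x)) (at x)" if "x \<in> U" for x
    using has_derivative_add[OF f'(1) g'(1)] that by (simp add: plus_blinfun.rep_eq)
  then show ?thesis unfolding C2_on_iff_C1_on_derivative
    using f'(2) g'(2) by (intro exI[of _ "\<lambda>x. f' x + g' x"]) (auto intro: C1_on_add)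
qed

lemma C2_on_sum:
  assumes "finite I" "\<And>i. i \<in> I \<Longrightarrow> C2_on U (f i)"
  shows "C2_on U (\<lambda>x. \<Sum>i\<in>I. f i x)"
  using assms
proof (induction I rule: finite_induct)
  case empty
  then show ?case using C2_on_bounded_linear[OF bounded_linear_zero] by simp
next
  case (insert i I)
  then show ?case by (simp add: C2_on_add)
qed

lemma bounded_linear_axis: "bounded_linear (axis i :: 'a::euclidean_space \<Rightarrow> 'a ^ 'm::finite)"
  by (rule linear_conv_bounded_linear[THEN iffD1], rule linearI) (auto simp: axis_def vec_eq_iff)

lemma C2_on_product_map:
  fixes \<psi> :: "'m::finite \<Rightarrow> 'a::euclidean_space \<Rightarrow> 'b::euclidean_space"
  assumes "\<And>i. C2_on (V i) (\<psi> i)"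
  shows "C2_on {y. \<forall>i. y $ i \<in> V i} (\<lambda>y. \<chi> i. \<psi> i (y $ i))"
proof -
  have "C2_on {y. \<forall>i. y $ i \<in> V i} (\<lambda>y. axis i (\<psi> i (y $ i)) :: 'b ^ 'm)" for i
    by (rule C2_on_compose[OF C2_on_compose[OF C2_on_bounded_linear assms] C2_on_bounded_linear[OF bounded_linear_axis]])
      (auto intro: bounded_linear_vec_nth)
  then have "C2_on {y. \<forall>i. y $ i \<in> V i} (\<lambda>y. \<Sum>i\<in>UNIV. axis i (\<psi> i (y $ i)) :: 'b ^ 'm)"
    by (intro C2_on_sum) auto
  moreover have "(\<Sum>i\<in>UNIV. axis i (\<psi> i (y $ i))) = (\<chi> i. \<psi> i (y $ i))" for y :: "'a ^ 'm"
    by (simp add: vec_eq_iff axis_def)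
  ultimately show ?thesis by simp
qed

text \<open>The mean value theorem for \<open>x \<mapsto> f (x + k) - f x - f'' y0 k x\<close>, whose derivative is small near \<open>y0\<close>
  because \<open>f'\<close> is strictly differentiable there.\<close>

lemma C2_on_mixed_difference:
  fixes f :: "'a::euclidean_space \<Rightarrow> real"
  assumes "open U" "y0 \<in> U"
    and f': "\<And>x. x \<in> U \<Longrightarrow> (f has_derivative blinfun_apply (f' x)) (at x)"
    and f'': "\<And>x. x \<in> U \<Longrightarrow> (f' has_derivative blinfun_apply (f'' x)) (at x)" "continuous_on U f''"
    and "\<eta> > 0"
  obtains r where "r > 0"
    "\<And>y h k. y \<in> ball y0 r \<Longrightarrow> y + h \<in> ball y0 r \<Longrightarrow> y + k \<in> ball y0 r \<Longrightarrow> y + h + k \<in> ball y0 r \<Longrightarrow>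
      \<bar>f (y + h + k) - f (y + h) - f (y + k) + f y - f'' y0 k h\<bar> \<le> \<eta> * norm h * norm k"
proof -
  have "isCont f'' y0" using f''(2) assms(1,2) by (simp add: continuous_on_eq_continuous_at)
  then obtain r1 where r1: "r1 > 0" "\<And>x. dist x y0 < r1 \<Longrightarrow> dist (f'' x) (f'' y0) < \<eta>"
    unfolding continuous_at_eps_delta using \<open>\<eta> > 0\<close> by meson
  obtain r2 where r2: "r2 > 0" "ball y0 r2 \<subseteq> U" using assms(1,2) openE by blast
  define r where "r = min r1 r2"
  have rU: "ball y0 r \<subseteq> U" using r2(2) by (auto simp: r_def)
  have lin: "norm (f' a - f' b - f'' y0 (a - b)) \<le> \<eta> * norm (a - b)"
    if ab: "a \<in> ball y0 r" "b \<in> ball y0 r" for a b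
  proof -
    have der: "((\<lambda>x. f' x - f'' y0 x) has_derivative blinfun_apply (f'' x - f'' y0)) (at x within ball y0 r)"
      if "x \<in> ball y0 r" for x
    proof -
      have "((\<lambda>x. f' x - f'' y0 x) has_derivative (\<lambda>h. f'' x h - f'' y0 h)) (at x)"
        using that rU by (intro has_derivative_diff f''(1) bounded_linear_imp_has_derivative blinfun.bounded_linear_right) auto
      from has_derivative_at_withinI[OF this] show ?thesis by (simp add: minus_blinfun.rep_eq)
    qed
    have on: "onorm (blinfun_apply (f'' x - f'' y0)) \<le> \<eta>" if "x \<in> ball y0 r" for x
    proof -
      have "dist (f'' x) (f'' y0) < \<eta>" using that by (intro r1(2)) (simp add: r_def dist_commute)
      then show ?thesis by (simp only: norm_blinfun.rep_eq[symmetric] dist_norm)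
    qed
    show ?thesis using differentiable_bound[OF convex_ball der on ab]
      by (simp add: blinfun.diff_right algebra_simps)
  qed
  show thesis
  proof (rule that)
    show "r > 0" using r1 r2 by (simp add: r_def)
    fix y h k assume y: "y \<in> ball y0 r" "y + h \<in> ball y0 r" "y + k \<in> ball y0 r" "y + h + k \<in> ball y0 r"
    let ?S = "ball y0 r \<inter> ball (y0 - k) r"
    let ?g = "\<lambda>x. f (x + k) - f x - f'' y0 k x"
    have S: "x \<in> ?S \<longleftrightarrow> x \<in> ball y0 r \<and> x + k \<in> ball y0 r" for x
      by (auto simp: dist_norm algebra_simps)
    have der: "(?g has_derivative blinfun_apply (f' (x + k) - f' x - f'' y0 k)) (at x within ?S)"
      if "x \<in> ?S" for x
    proof -
      have x: "x \<in> U" "x + k \<in> U" using that rU unfolding S by auto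
      have "((\<lambda>x. f (x + k)) has_derivative blinfun_apply (f' (x + k))) (at x)"
      proof -
        have "((\<lambda>x. x + k) has_derivative (\<lambda>v. v)) (at x)" by (auto intro!: derivative_eq_intros)
        from has_derivative_compose[OF this f'[OF x(2)]] show ?thesis .
      qed
      then have "(?g has_derivative (\<lambda>v. f' (x + k) v - f' x v - f'' y0 k v)) (at x)"
        using x by (intro has_derivative_diff f' bounded_linear_imp_has_derivative blinfun.bounded_linear_right)
      from has_derivative_at_withinI[OF this] show ?thesis by (simp add: minus_blinfun.rep_eq)
    qed
    have on: "onorm (blinfun_apply (f' (x + k) - f' x - f'' y0 k)) \<le> \<eta> * norm k" if "x \<in> ?S" for x
      using lin[of "x + k" x] that unfolding S by (simp add: norm_blinfun.rep_eq[symmetric])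
    have "convex ?S" by (intro convex_Int convex_ball)
    moreover have "y + h \<in> ?S" "y \<in> ?S" unfolding S using y by auto
    ultimately have "norm (?g (y + h) - ?g y) \<le> \<eta> * norm k * norm (y + h - y)"
      using differentiable_bound[of ?S ?g "\<lambda>x. blinfun_apply (f' (x + k) - f' x - f'' y0 k)" "\<eta> * norm k" "y + h" y]
        der on by blast
    then show "\<bar>f (y + h + k) - f (y + h) - f (y + k) + f y - f'' y0 k h\<bar> \<le> \<eta> * norm h * norm k"
      by (simp add: blinfun.add_right algebra_simps)
  qed
qed

text \<open>The second derivative at \<open>y0\<close> as a symmetric bilinear form \<open>H\<close>. It computes iterated partial
  derivatives of any \<open>F\<close> that agrees with \<open>f\<close> on a small parallelogram, and it approximates mixed second
  differences. Symmetry follows from the last property, since mixed differences are symmetric in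
  the two increments.\<close>

lemma C2_on_second_derivative:
  fixes f :: "'a::euclidean_space \<Rightarrow> real"
  assumes "open U" "y0 \<in> U" "C2_on U f"
  obtains H where "bounded_bilinear H" "\<And>a b. H a b = H b a"
    and "\<And>F a b r. r > 0 \<Longrightarrow> (\<And>s t. \<bar>s\<bar> < r \<Longrightarrow> \<bar>t\<bar> < r \<Longrightarrow> F s t = f (y0 + s *\<^sub>R a + t *\<^sub>R b)) \<Longrightarrow>
        deriv (\<lambda>s. deriv (\<lambda>t. F s t) 0) 0 = H a b"
    and "\<And>\<eta>. \<eta> > 0 \<Longrightarrow> \<exists>r>0. \<forall>y h k. y \<in> ball y0 r \<longrightarrow> y + h \<in> ball y0 r \<longrightarrow> y + k \<in> ball y0 r \<longrightarrow>
        y + h + k \<in> ball y0 r \<longrightarrow>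
        \<bar>f (y + h + k) - f (y + h) - f (y + k) + f y - H k h\<bar> \<le> \<eta> * norm h * norm k"
proof -
  obtain f' :: "'a \<Rightarrow> 'a \<Rightarrow>\<^sub>L real" and f'' where f': "\<And>x. x \<in> U \<Longrightarrow> (f has_derivative blinfun_apply (f' x)) (at x)"
    and f'': "\<And>x. x \<in> U \<Longrightarrow> (f' has_derivative blinfun_apply (f'' x)) (at x)" "continuous_on U f''"
    using assms(3) unfolding C2_on_def by blast
  define H where "H a b = f'' y0 a b" for a b
  have bil: "bounded_bilinear H"
    unfolding H_def
    by (intro bounded_bilinear.comp1[OF bounded_bilinear_blinfun_apply] blinfun.bounded_linear_right)
  interpret H: bounded_bilinear H by fact
  have mix: "\<exists>r>0. \<forall>y h k. y \<in> ball y0 r \<longrightarrow> y + h \<in> ball y0 r \<longrightarrow> y + k \<in> ball y0 r \<longrightarrow>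
        y + h + k \<in> ball y0 r \<longrightarrow>
        \<bar>f (y + h + k) - f (y + h) - f (y + k) + f y - H k h\<bar> \<le> \<eta> * norm h * norm k"
    if \<eta>: "\<eta> > 0" for \<eta>
  proof -
    obtain r where "r > 0"
      "\<And>y h k. y \<in> ball y0 r \<Longrightarrow> y + h \<in> ball y0 r \<Longrightarrow> y + k \<in> ball y0 r \<Longrightarrow> y + h + k \<in> ball y0 r \<Longrightarrow>
        \<bar>f (y + h + k) - f (y + h) - f (y + k) + f y - f'' y0 k h\<bar> \<le> \<eta> * norm h * norm k"
      using C2_on_mixed_difference[OF assms(1,2) f' f'' \<eta>] by blast
    then show ?thesis unfolding H_def by blast
  qed
  have sym: "H a b = H b a" for a b
  proof -
    have le: "\<bar>H a b - H b a\<bar> \<le> \<eta> * (2 * norm a * norm b)" if \<eta>: "\<eta> > 0" for \<eta>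
    proof -
      obtain r where r: "r > 0" and R: "\<And>y h k. y \<in> ball y0 r \<Longrightarrow> y + h \<in> ball y0 r \<Longrightarrow> y + k \<in> ball y0 r \<Longrightarrow>
          y + h + k \<in> ball y0 r \<Longrightarrow>
          \<bar>f (y + h + k) - f (y + h) - f (y + k) + f y - H k h\<bar> \<le> \<eta> * norm h * norm k"
        using mix[OF \<eta>] by metis
      \<comment> \<open>Scaled down by \<open>t\<close>, the parallelogram spanned by \<open>a\<close> and \<open>b\<close> fits into the ball; \<open>t\<^sup>2\<close> cancels in the end.\<close>
      define t where "t = r / (norm a + norm b + 1)"
      have t: "t > 0" using r by (simp add: t_def add_nonneg_pos)
      have tr: "t * (norm a + norm b) < r"
      proof -
        have "t * (norm a + norm b) < t * (norm a + norm b + 1)" using t by simp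
        also have "\<dots> = r" unfolding t_def using norm_ge_zero[of a] norm_ge_zero[of b] by (simp add: add_nonneg_eq_0_iff)
        finally show ?thesis .
      qed
      have na: "norm (t *\<^sub>R a) = t * norm a" "norm (t *\<^sub>R b) = t * norm b" using t by auto
      have tab: "t * norm a + t * norm b < r" "0 \<le> t * norm a" "0 \<le> t * norm b"
        using tr t by (auto simp: algebra_simps)
      have "norm (t *\<^sub>R a + t *\<^sub>R b) \<le> t * norm a + t * norm b"
        by (rule order_trans[OF norm_triangle_ineq]) (simp only: na order_refl)
      then have B: "y0 \<in> ball y0 r" "y0 + t *\<^sub>R a \<in> ball y0 r" "y0 + t *\<^sub>R b \<in> ball y0 r"
        "y0 + t *\<^sub>R a + t *\<^sub>R b \<in> ball y0 r" "y0 + t *\<^sub>R b + t *\<^sub>R a \<in> ball y0 r"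
        using tab r na by (auto simp: dist_norm add.assoc norm_minus_commute add.commute[of "t *\<^sub>R b"])
      have "\<bar>f (y0 + t *\<^sub>R a + t *\<^sub>R b) - f (y0 + t *\<^sub>R a) - f (y0 + t *\<^sub>R b) + f y0 - H (t *\<^sub>R b) (t *\<^sub>R a)\<bar>
          \<le> \<eta> * norm (t *\<^sub>R a) * norm (t *\<^sub>R b)"
        using B by (intro R) auto
      moreover have "\<bar>f (y0 + t *\<^sub>R b + t *\<^sub>R a) - f (y0 + t *\<^sub>R b) - f (y0 + t *\<^sub>R a) + f y0 - H (t *\<^sub>R a) (t *\<^sub>R b)\<bar>
          \<le> \<eta> * norm (t *\<^sub>R b) * norm (t *\<^sub>R a)"
        using B by (intro R) auto
      moreover have "y0 + t *\<^sub>R b + t *\<^sub>R a = y0 + t *\<^sub>R a + t *\<^sub>R b" by simp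
      ultimately have "\<bar>H (t *\<^sub>R a) (t *\<^sub>R b) - H (t *\<^sub>R b) (t *\<^sub>R a)\<bar>
          \<le> \<eta> * norm (t *\<^sub>R a) * norm (t *\<^sub>R b) + \<eta> * norm (t *\<^sub>R b) * norm (t *\<^sub>R a)"
        by (simp only: abs_le_iff) linarith
      also have "\<dots> = t * t * (\<eta> * (2 * norm a * norm b))" by (simp add: na)
      also have "H (t *\<^sub>R a) (t *\<^sub>R b) - H (t *\<^sub>R b) (t *\<^sub>R a) = t * t * (H a b - H b a)"
        by (simp add: H.scaleR_left H.scaleR_right algebra_simps)
      finally show ?thesis using t by (simp add: abs_mult)
    qed
    have "\<bar>H a b - H b a\<bar> \<le> 0"
    proof (rule field_le_epsilon)
      fix e :: real assume e: "e > 0"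
      have "\<bar>H a b - H b a\<bar> \<le> e / (2 * norm a * norm b + 1) * (2 * norm a * norm b)"
        using e by (intro le) (simp add: add_nonneg_pos)
      also have "\<dots> \<le> e"
        using e by (simp add: divide_le_eq add_nonneg_pos)
      finally show "\<bar>H a b - H b a\<bar> \<le> 0 + e" by simp
    qed
    then show ?thesis by simp
  qed
  have deriv: "deriv (\<lambda>s. deriv (\<lambda>t. F s t) 0) 0 = H a b"
    if r: "r > 0" and F: "\<And>s t. \<bar>s\<bar> < r \<Longrightarrow> \<bar>t\<bar> < r \<Longrightarrow> F s t = f (y0 + s *\<^sub>R a + t *\<^sub>R b)" for F a b r
  proof -
    obtain q where q: "q > 0" "ball y0 q \<subseteq> U" using assms(1,2) openE by blast
    define e where "e = min r (q / (norm a + 1))"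
    have e: "e > 0" using r q by (simp add: e_def add_nonneg_pos)
    have inU: "y0 + s *\<^sub>R a \<in> U" if "\<bar>s\<bar> < e" for s
    proof -
      have "\<bar>s\<bar> * norm a \<le> \<bar>s\<bar> * (norm a + 1)" by (simp add: mult_left_mono)
      also have "\<dots> < q" using that by (simp add: e_def pos_less_divide_eq add_nonneg_pos)
      finally show ?thesis using q(2) by (auto simp: dist_norm subset_iff)
    qed
    have inner: "deriv (\<lambda>t. F s t) 0 = f' (y0 + s *\<^sub>R a) b" if s: "\<bar>s\<bar> < e" for s
    proof -
      have 1: "((\<lambda>t. y0 + s *\<^sub>R a + t *\<^sub>R b) has_derivative (\<lambda>t. t *\<^sub>R b)) (at 0)"
        by (auto intro!: derivative_eq_intros)
      have 2: "(f has_derivative f' (y0 + s *\<^sub>R a)) (at (y0 + s *\<^sub>R a + 0 *\<^sub>R b))"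
        using f'[OF inU[OF s]] by simp
      have "((\<lambda>t. f (y0 + s *\<^sub>R a + t *\<^sub>R b)) has_derivative (\<lambda>t. f' (y0 + s *\<^sub>R a) (t *\<^sub>R b))) (at 0)"
        by (rule has_derivative_compose[OF 1 2])
      then have "((\<lambda>t. f (y0 + s *\<^sub>R a + t *\<^sub>R b)) has_field_derivative f' (y0 + s *\<^sub>R a) b) (at 0)"
        unfolding has_field_derivative_def
        by (rule has_derivative_eq_rhs) (auto simp: blinfun.scaleR_right)
      moreover have "\<forall>\<^sub>F t in nhds 0. f (y0 + s *\<^sub>R a + t *\<^sub>R b) = F s t"
        using F s r by (auto simp: e_def eventually_nhds_metric intro!: exI[of _ r])
      ultimately have "(F s has_field_derivative f' (y0 + s *\<^sub>R a) b) (at 0)"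
        by (subst (asm) DERIV_cong_ev[OF refl _ refl]) auto
      then show ?thesis by (rule DERIV_imp_deriv)
    qed
    have 1: "((\<lambda>s. y0 + s *\<^sub>R a) has_derivative (\<lambda>s. s *\<^sub>R a)) (at 0)"
      by (auto intro!: derivative_eq_intros)
    have 2: "(f' has_derivative f'' y0) (at (y0 + 0 *\<^sub>R a))"
      using f''(1)[OF \<open>y0 \<in> U\<close>] by simp
    have "((\<lambda>s. f' (y0 + s *\<^sub>R a)) has_derivative (\<lambda>s. f'' y0 (s *\<^sub>R a))) (at 0)"
      by (rule has_derivative_compose[OF 1 2])
    then have "((\<lambda>s. f' (y0 + s *\<^sub>R a) b) has_derivative (\<lambda>s. f'' y0 (s *\<^sub>R a) b)) (at 0)"
      by (rule bounded_linear.has_derivative[OF blinfun.bounded_linear_left])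
    then have "((\<lambda>s. f' (y0 + s *\<^sub>R a) b) has_field_derivative H a b) (at 0)"
      unfolding has_field_derivative_def H_def
      by (rule has_derivative_eq_rhs) (auto simp: blinfun.scaleR_right blinfun.scaleR_left)
    moreover have "\<forall>\<^sub>F s in nhds 0. f' (y0 + s *\<^sub>R a) b = deriv (\<lambda>t. F s t) 0"
      using inner e by (auto simp: eventually_nhds_metric intro!: exI[of _ e])
    ultimately have "((\<lambda>s. deriv (\<lambda>t. F s t) 0) has_field_derivative H a b) (at 0)"
      by (subst (asm) DERIV_cong_ev[OF refl _ refl]) auto
    then show ?thesis by (rule DERIV_imp_deriv)
  qed
  show thesis by (rule that[OF bil]) (fact sym deriv mix)+
qed

section \<open>Forms that are positive definite on a subspace\<close>

lemma form_eigenspace_span: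
  fixes b :: "'b::euclidean_space \<Rightarrow> 'b \<Rightarrow> real"
  assumes lin: "\<And>v. linear (\<lambda>u. b u v)" and sym: "\<And>u v. b u v = b v u"
    and "v \<in> span (form_eigenspace T b l)" "w \<in> span T"
  shows "b v w = l * (v \<bullet> w)"
proof -
  have lin2: "linear (\<lambda>u. b v u)" for v using lin[of v] sym[of v] by simp
  have 1: "b v w = l * (v \<bullet> w)" if v: "v \<in> form_eigenspace T b l" and w: "w \<in> span T" for v w
    using w
  proof (rule span_induct)
    show "subspace {w. b v w = l * (v \<bullet> w)}"
      by (auto simp: subspace_def linear_0[OF lin2[of v]] linear_add[OF lin2[of v]] linear_cmul[OF lin2[of v]]
          inner_add_right algebra_simps)
    show "\<And>w. w \<in> T \<Longrightarrow> b v w = l * (v \<bullet> w)" using v by (auto simp: form_eigenspace_def)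
  qed
  show ?thesis using assms(3)
  proof (rule span_induct)
    show "subspace {v. b v w = l * (v \<bullet> w)}"
      by (auto simp: subspace_def linear_0[OF lin[of w]] linear_add[OF lin[of w]] linear_cmul[OF lin[of w]]
          inner_add_left algebra_simps)
    show "\<And>v. v \<in> form_eigenspace T b l \<Longrightarrow> b v w = l * (v \<bullet> w)" using 1 assms(4) by blast
  qed
qed

text \<open>The set \<open>T\<close> need not be a subspace: eigenvectors for different positive eigenvalues are orthogonal,
  so orthonormal bases of the spans of the eigenspaces together form a basis of a subspace on which \<open>b\<close> is
  diagonal with positive entries.\<close>

lemma positive_index_subspace:
  fixes b :: "'b::euclidean_space \<Rightarrow> 'b \<Rightarrow> real"
  assumes lin: "\<And>v. linear (\<lambda>u. b u v)" and sym: "\<And>u v. b u v = b v u"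
  obtains W where "subspace W" "dim W = positive_index T b" "\<And>w. w \<in> W \<Longrightarrow> w \<noteq> 0 \<Longrightarrow> 0 < b w w"
proof -
  define E where "E = form_eigenspace T b"
  define S where "S = {l. 0 < l \<and> (\<exists>v\<in>E l. v \<noteq> 0)}"
  have pos: "positive_index T b = (\<Sum>l\<in>S. dim (E l))"
    by (simp add: positive_index_def S_def E_def)
  show thesis
  proof (cases "finite S")
    \<comment> \<open>The sum over an infinite set of eigenvalues is 0 by convention.\<close>
    case False
    then have "positive_index T b = 0" by (simp add: pos)
    then show thesis using that[of "{0}"] by (simp add: subspace_0)
  next
    case True
    have ET: "span (E l) \<subseteq> span T" for l by (intro span_mono) (auto simp: E_def form_eigenspace_def)
    have eig: "b v w = l * (v \<bullet> w)" if "v \<in> span (E l)" "w \<in> span T" for v w l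
      using form_eigenspace_span[OF lin sym] that unfolding E_def by blast
    have ortho: "v \<bullet> w = 0" if "v \<in> span (E l)" "w \<in> span (E l')" "l \<noteq> l'" for v w l l'
    proof -
      have "l * (v \<bullet> w) = l' * (w \<bullet> v)"
        using eig[of v l w] eig[of w l' v] that ET sym[of v w] by (simp add: subset_iff)
      then show ?thesis using that(3) by (simp add: inner_commute)
    qed
    have "\<exists>B. B \<subseteq> span (E l) \<and> pairwise orthogonal B \<and> (\<forall>x\<in>B. norm x = 1) \<and> card B = dim (E l) \<and> finite B" for l
      by (rule orthonormal_basis_subspace[OF subspace_span[of "E l"]])
        (metis dim_span independent_imp_finite)
    then obtain B where B: "\<And>l. B l \<subseteq> span (E l)" "\<And>l. pairwise orthogonal (B l)"
      "\<And>l x. x \<in> B l \<Longrightarrow> norm x = 1" "\<And>l. card (B l) = dim (E l)" "\<And>l. finite (B l)"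
      by metis
    define P where "P = (\<Union>l\<in>S. B l)"
    have finP: "finite P" using True B(5) by (simp add: P_def)
    have nz: "0 \<notin> P" using B(3) by (force simp: P_def)
    have orthP: "pairwise orthogonal P"
      unfolding pairwise_def
    proof (intro ballI impI)
      fix x y assume xy: "x \<in> P" "y \<in> P" "x \<noteq> y"
      then obtain l l' where "x \<in> B l" "y \<in> B l'" by (auto simp: P_def)
      then show "orthogonal x y"
        using B(1)[of l] B(1)[of l'] B(2)[of l] ortho[of x l y l'] xy(3)
        by (cases "l = l'") (auto simp: pairwise_def orthogonal_def)
    qed
    have ind: "independent P" by (rule pairwise_orthogonal_independent[OF orthP nz])
    have disj: "B l \<inter> B l' = {}" if ne: "l \<noteq> l'" for l l'
    proof (rule ccontr)
      assume "B l \<inter> B l' \<noteq> {}"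
      then obtain x where "x \<in> B l" "x \<in> B l'" by blast
      then have "x \<bullet> x = 0" using B(1) ne by (intro ortho) auto
      then show False using B(3)[OF \<open>x \<in> B l\<close>] by simp
    qed
    have "card P = (\<Sum>l\<in>S. card (B l))"
      unfolding P_def using True B(5) disj by (intro card_UN_disjoint) auto
    then have "dim (span P) = positive_index T b"
      using ind B(4) by (simp add: pos dim_eq_card_independent)
    moreover have "0 < b w w" if w: "w \<in> span P" "w \<noteq> 0" for w
    proof -
      obtain u where u: "w = (\<Sum>x\<in>P. u x *\<^sub>R x)" using w(1) finP by (auto simp: span_finite)
      have "\<exists>l. l > 0 \<and> x \<in> B l" if "x \<in> P" for x using that by (auto simp: P_def S_def)
      then obtain l where l: "\<And>x. x \<in> P \<Longrightarrow> l x > 0 \<and> x \<in> B (l x)" by metis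
      have bxy: "b x y = (if x = y then l x else 0)" if "x \<in> P" "y \<in> P" for x y
      proof -
        have "x \<in> span (E (l x))" "y \<in> span T" using l[OF that(1)] l[OF that(2)] B(1) ET by blast+
        then have "b x y = l x * (x \<bullet> y)" by (rule eig)
        moreover have "x \<bullet> y = (if x = y then 1 else 0)"
          using orthP that B(3) l[OF that(1)] by (auto simp: pairwise_def orthogonal_def norm_eq_1)
        ultimately show ?thesis by simp
      qed
      have lin2: "linear (\<lambda>u. b v u)" for v using lin[of v] sym[of v] by simp
      have "b w w = (\<Sum>x\<in>P. u x * b x w)"
        by (subst (1) u) (simp add: linear_sum[OF lin] linear_cmul[OF lin])
      also have "\<dots> = (\<Sum>x\<in>P. u x * (\<Sum>y\<in>P. u y * b x y))"
        by (subst u) (simp add: linear_sum[OF lin2] linear_cmul[OF lin2])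
      also have "\<dots> = (\<Sum>x\<in>P. l x * (u x)\<^sup>2)"
      proof (rule sum.cong[OF refl])
        fix x assume x: "x \<in> P"
        have "(\<Sum>y\<in>P. u y * b x y) = (\<Sum>y\<in>P. if x = y then u y * l x else 0)"
          using x by (intro sum.cong) (auto simp: bxy)
        also have "\<dots> = u x * l x" using finP x by simp
        finally show "u x * (\<Sum>y\<in>P. u y * b x y) = l x * (u x)\<^sup>2" by (simp add: power2_eq_square)
      qed
      also have "\<dots> > 0"
      proof -
        have "\<exists>x\<in>P. u x \<noteq> 0"
        proof (rule ccontr)
          assume "\<not> (\<exists>x\<in>P. u x \<noteq> 0)"
          then have "(\<Sum>x\<in>P. u x *\<^sub>R x) = 0" by (intro sum.neutral) auto
          from trans[OF u this] w(2) show False by contradiction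
        qed
        then obtain x where x: "x \<in> P" "u x \<noteq> 0" by blast
        have "0 < l x * (u x)\<^sup>2" using l[OF x(1)] x(2) by simp
        moreover have "0 \<le> l y * (u y)\<^sup>2" if y: "y \<in> P" for y
          by (rule mult_nonneg_nonneg[OF less_imp_le[OF conjunct1[OF l[OF y]]] zero_le_power2])
        ultimately show ?thesis by (intro sum_pos2[OF finP x(1)])
      qed
      finally show ?thesis .
    qed
    ultimately show thesis using that[of "span P"] by (simp add: subspace_span)
  qed
qed

lemma positive_definite_coercive:
  fixes Q :: "'b::euclidean_space \<Rightarrow> 'b \<Rightarrow> real"
  assumes "bounded_bilinear Q" "subspace Z" "\<And>z. z \<in> Z \<Longrightarrow> z \<noteq> 0 \<Longrightarrow> 0 < Q z z"
  obtains l L where "l > 0" "L \<ge> 0"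
    "\<And>z w. z \<in> Z \<Longrightarrow> l * (norm (z + w))\<^sup>2 - L * (norm w)\<^sup>2 \<le> Q (z + w) (z + w)"
proof -
  interpret Q: bounded_bilinear Q by fact
  obtain K where K: "K > 0" "\<And>a b. norm (Q a b) \<le> norm a * norm b * K" using Q.pos_bounded by blast
  obtain m where m: "m > 0" "\<And>z. z \<in> Z \<Longrightarrow> m * (norm z)\<^sup>2 \<le> Q z z"
  proof (cases "Z \<subseteq> {0}")
    case True
    then show ?thesis using that[of 1] by (force simp: Q.zero_left)
  next
    case False
    then obtain z0 where z0: "z0 \<in> Z" "z0 \<noteq> 0" by blast
    define S where "S = Z \<inter> sphere 0 1"
    have "compact S" unfolding S_def
      using closed_subspace[OF assms(2)] by (intro closed_Int_compact) auto
    moreover have "(1 / norm z0) *\<^sub>R z0 \<in> S"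
      using z0 assms(2) by (auto simp: S_def subspace_scale)
    then have "S \<noteq> {}" by blast
    moreover have "continuous_on S (\<lambda>z. Q z z)" by (intro Q.continuous_on continuous_on_id)
    ultimately obtain z1 where z1: "z1 \<in> S" "\<And>z. z \<in> S \<Longrightarrow> Q z1 z1 \<le> Q z z"
      using continuous_attains_inf[of S "\<lambda>z. Q z z"] by blast
    show ?thesis
    proof (rule that[of "Q z1 z1"])
      show "0 < Q z1 z1" using z1(1) by (intro assms(3)) (auto simp: S_def)
      fix z assume z: "z \<in> Z"
      show "Q z1 z1 * (norm z)\<^sup>2 \<le> Q z z"
      proof (cases "z = 0")
        case True
        then show ?thesis by (simp add: Q.zero_left)
      next
        case False
        have "(1 / norm z) *\<^sub>R z \<in> S" using z False assms(2) by (auto simp: S_def subspace_scale)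
        then have "Q z1 z1 \<le> Q ((1 / norm z) *\<^sub>R z) ((1 / norm z) *\<^sub>R z)" by (rule z1(2))
        also have "\<dots> = Q z z / (norm z)\<^sup>2"
          by (simp add: Q.scaleR_left Q.scaleR_right power2_eq_square)
        finally show ?thesis using False by (simp add: pos_le_divide_eq)
      qed
    qed
  qed
  define L where "L = m / 2 + 2 * K\<^sup>2 / m + K"
  show thesis
  proof (rule that[of "m / 4" L])
    show "m / 4 > 0" "L \<ge> 0" using m(1) K(1) by (auto simp: L_def)
    fix z w assume z: "z \<in> Z"
    have "Q (z + w) (z + w) = Q z z + Q z w + Q w z + Q w w"
      by (simp add: Q.add_left Q.add_right)
    moreover have "\<bar>Q z w\<bar> \<le> K * norm z * norm w" "\<bar>Q w z\<bar> \<le> K * norm z * norm w" "\<bar>Q w w\<bar> \<le> K * (norm w)\<^sup>2"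
      using K(2)[of z w] K(2)[of w z] K(2)[of w w] by (auto simp: mult_ac power2_eq_square)
    ultimately have 1: "m * (norm z)\<^sup>2 - 2 * (K * norm z * norm w) - K * (norm w)\<^sup>2 \<le> Q (z + w) (z + w)"
      using m(2)[OF z] by linarith
    have "0 \<le> (m * norm z - 2 * K * norm w)\<^sup>2" by simp
    then have "2 * m * (2 * (K * norm z * norm w)) \<le> m\<^sup>2 * (norm z)\<^sup>2 + 4 * K\<^sup>2 * (norm w)\<^sup>2"
      by (simp add: power2_eq_square algebra_simps)
    also have "\<dots> = 2 * m * (m / 2 * (norm z)\<^sup>2 + 2 * K\<^sup>2 / m * (norm w)\<^sup>2)"
      using m(1) by (simp add: field_simps power2_eq_square)
    finally have 2: "2 * (K * norm z * norm w) \<le> m / 2 * (norm z)\<^sup>2 + 2 * K\<^sup>2 / m * (norm w)\<^sup>2"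
      using m(1) by simp
    have "norm (z + w) \<le> norm z + norm w" by (rule norm_triangle_ineq)
    then have "(norm (z + w))\<^sup>2 \<le> (norm z + norm w)\<^sup>2" by (rule power_mono) simp
    also have "\<dots> \<le> 2 * (norm z)\<^sup>2 + 2 * (norm w)\<^sup>2"
      using sum_squares_bound[of "norm z" "norm w"] by (simp add: power2_sum)
    finally have "m / 4 * (norm (z + w))\<^sup>2 \<le> m / 4 * (2 * (norm z)\<^sup>2 + 2 * (norm w)\<^sup>2)"
      using m(1) by (intro mult_left_mono) auto
    then show "m / 4 * (norm (z + w))\<^sup>2 - L * (norm w)\<^sup>2 \<le> Q (z + w) (z + w)"
      using 1 2 by (simp add: L_def algebra_simps)
  qed
qed

text \<open>The geometric core. Differences \<open>h\<close> of points of \<open>S\<close> satisfy \<open>\<bar>h\<bar>\<^sup>2 = O(s\<^sup>2 + \<bar>w\<bar>\<^sup>2)\<close>, where \<open>w\<close> is the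
  component of \<open>h\<close> in the orthogonal complement of \<open>Z\<close> in \<open>Y\<close>. A grid of mesh \<open>s\<close> in this complement
  therefore cuts \<open>S\<close> into pieces of diameter \<open>O(s)\<close>; their number is \<open>O(s\<^bsup>-(dim Y - dim Z)\<^esup>)\<close>, which is stated
  without negative exponents.\<close>

lemma coercive_covering:
  fixes Q :: "'b::euclidean_space \<Rightarrow> 'b \<Rightarrow> real"
  assumes "bounded_bilinear Q" "subspace Z" "\<And>z. z \<in> Z \<Longrightarrow> z \<noteq> 0 \<Longrightarrow> 0 < Q z z"
    and "subspace Y" "Z \<subseteq> Y" "R \<ge> 0"
  obtains \<eta> C where "\<eta> > 0" "C > 0"
    "\<forall>s S y0. 0 < s \<and> s \<le> 1 \<and> S \<subseteq> cball y0 R \<and> (\<forall>x\<in>S. \<forall>y\<in>S. y - x \<in> Y) \<and>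
      (\<forall>x\<in>S. \<forall>y\<in>S. Q (y - x) (y - x) / 2 - \<eta> * (norm (y - x))\<^sup>2 \<le> 2 * s\<^sup>2) \<longrightarrow>
      (\<exists>\<C>. finite \<C> \<and> S \<subseteq> \<Union>\<C> \<and> real (card \<C>) * s ^ dim Y \<le> C * s ^ dim Z \<and>
        (\<forall>A\<in>\<C>. A \<subseteq> S \<and> (\<forall>x\<in>A. \<forall>y\<in>A. dist x y \<le> C * s)))"
proof -
  obtain l L where l: "l > 0" "L \<ge> 0" and
    coer: "\<And>z w. z \<in> Z \<Longrightarrow> l * (norm (z + w))\<^sup>2 - L * (norm w)\<^sup>2 \<le> Q (z + w) (z + w)"
    using positive_definite_coercive[OF assms(1-3)] by blast
  define V where "V = {y\<in>Y. \<forall>x\<in>Z. orthogonal x y}"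
  have V: "subspace V"
    using assms(4) by (auto simp: V_def subspace_def orthogonal_def inner_add_right)
  have dimV: "dim V + dim Z = dim Y"
    unfolding V_def by (rule dim_subspace_orthogonal_to_vectors) (use assms in auto)
  obtain E where E: "E \<subseteq> V" "pairwise orthogonal E" "\<And>x. x \<in> E \<Longrightarrow> norm x = 1" "independent E"
    "card E = dim V" "span E = V"
    using orthonormal_basis_subspace[OF V] by metis
  have finE: "finite E" using E(4) by (rule independent_imp_finite)
  define n where "n = real (card E)"
  \<comment> \<open>\<open>C1\<close> controls the diameter of the pieces, the power of \<open>2 * R + 2\<close> their number.\<close>
  define C1 where "C1 = sqrt ((8 + 2 * L * n\<^sup>2) / l)"
  define C where "C = max C1 ((2 * R + 2) ^ card E) + 1"
  have "(2 * R + 2) ^ card E \<ge> 0" using \<open>R \<ge> 0\<close> by simp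
  then have C: "C > 0" "C1 \<le> C" "(2 * R + 2) ^ card E \<le> C" by (auto simp: C_def)
  show thesis
  proof (rule that[of "l / 4" C], goal_cases)
    case 1 show ?case using l by simp
  next
    case 2 show ?case by (rule C(1))
  next
    case 3
    show ?case
    proof (intro allI impI, elim conjE)
      fix s S y0 assume s: "0 < s" "s \<le> 1" and S: "S \<subseteq> cball y0 R"
        and SY': "\<forall>x\<in>S. \<forall>y\<in>S. y - x \<in> Y"
        and SQ': "\<forall>x\<in>S. \<forall>y\<in>S. Q (y - x) (y - x) / 2 - l / 4 * (norm (y - x))\<^sup>2 \<le> 2 * s\<^sup>2"
      note SY = bspec[OF bspec[OF SY']] and SQ = bspec[OF bspec[OF SQ']]
      define I where "I = grid_index s E ` S"
      define A where "A a = {x\<in>S. grid_index s E x = a}" for a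
      have bnd: "\<bar>(x - y0) \<bullet> e\<bar> \<le> R" if "x \<in> S" "e \<in> E" for x e
      proof -
        have "\<bar>(x - y0) \<bullet> e\<bar> \<le> norm (x - y0) * norm e" by (rule Cauchy_Schwarz_ineq2)
        also have "\<dots> \<le> R" using S that E(3) by (auto simp: dist_norm norm_minus_commute subset_iff)
        finally show ?thesis .
      qed
      note grid = grid_index_image[OF s(1) \<open>R \<ge> 0\<close> finE bnd]
      have finI: "finite I" unfolding I_def by (rule grid(1))
      have "real (card I) * s ^ dim Y \<le> (2 * R / s + 2) ^ card E * s ^ dim Y"
        unfolding I_def using s by (intro mult_right_mono grid(2)) auto
      also have "\<dots> = ((2 * R / s + 2) * s) ^ card E * s ^ dim Z"
        by (simp add: dimV[symmetric] E(5) power_add power_mult_distrib)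
      also have "(2 * R / s + 2) * s = 2 * R + 2 * s" using s by (simp add: field_simps)
      also have "(2 * R + 2 * s) ^ card E * s ^ dim Z \<le> C * s ^ dim Z"
      proof (rule mult_right_mono)
        have "(2 * R + 2 * s) ^ card E \<le> (2 * R + 2) ^ card E"
          using s \<open>R \<ge> 0\<close> by (intro power_mono) auto
        then show "(2 * R + 2 * s) ^ card E \<le> C" using C(3) by linarith
      qed (use s in auto)
      finally have cI: "real (card I) * s ^ dim Y \<le> C * s ^ dim Z" .
      have "card (A ` I) \<le> card I" using finI by (rule card_image_le)
      then have "real (card (A ` I)) * s ^ dim Y \<le> real (card I) * s ^ dim Y"
        using s by (intro mult_right_mono) auto
      then have card: "real (card (A ` I)) * s ^ dim Y \<le> C * s ^ dim Z" using cI by linarith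
      have "dist x y \<le> C * s" if "x \<in> A a" "y \<in> A a" for x y a
      proof -
        have xy: "x \<in> S" "y \<in> S" "grid_index s E y = grid_index s E x" using that by (auto simp: A_def)
        define h where "h = y - x"
        obtain z w where zw: "z \<in> span Z" "\<And>v. v \<in> span Z \<Longrightarrow> orthogonal w v" "h = z + w"
          using orthogonal_subspace_decomp_exists[of Z h] by metis
        have z: "z \<in> Z" using zw(1) assms(2) by (simp add: span_eq_iff[THEN iffD2])
        have "w = h - z" using zw(3) by simp
        then have "w \<in> Y" using SY[OF xy(1,2)] z assms(4,5) unfolding h_def by (auto intro: subspace_diff)
        then have "w \<in> V" using zw(2) span_base by (auto simp: V_def orthogonal_commute)
        then have wE: "w \<in> span E" using E(6) by simp
        have "norm w \<le> (\<Sum>e\<in>E. \<bar>w \<bullet> e\<bar>)"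
          using norm_le_sum_orthonormal(2)[OF finE E(2,3) wE] .
        also have "\<dots> \<le> (\<Sum>e\<in>E. s)"
        proof (rule sum_mono)
          fix e assume e: "e \<in> E"
          then have "z \<bullet> e = 0" using E(1) z by (auto simp: V_def orthogonal_def)
          then have "w \<bullet> e = (y - x) \<bullet> e" using zw(3) by (simp add: h_def[symmetric] inner_add_left)
          then show "\<bar>w \<bullet> e\<bar> \<le> s" using grid_index_eqD[OF s(1) xy(3) e] by simp
        qed
        finally have "norm w \<le> n * s" by (simp add: n_def)
        then have w2: "(norm w)\<^sup>2 \<le> n\<^sup>2 * s\<^sup>2"
          using power_mono[of "norm w" "n * s" 2] by (simp add: power_mult_distrib)
        have "l * (norm h)\<^sup>2 - L * (norm w)\<^sup>2 \<le> Q h h" using coer[OF z, of w] zw(3) by simp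
        moreover have "Q h h / 2 - l / 4 * (norm h)\<^sup>2 \<le> 2 * s\<^sup>2" using SQ[OF xy(1,2)] by (simp add: h_def)
        ultimately have "l * (norm h)\<^sup>2 \<le> 8 * s\<^sup>2 + 2 * (L * (norm w)\<^sup>2)" by (simp add: algebra_simps)
        also have "\<dots> \<le> 8 * s\<^sup>2 + 2 * (L * (n\<^sup>2 * s\<^sup>2))" using w2 l(2) by (simp add: mult_left_mono)
        also have "\<dots> = (8 + 2 * L * n\<^sup>2) * s\<^sup>2" by (simp add: algebra_simps)
        finally have "(norm h)\<^sup>2 \<le> (8 + 2 * L * n\<^sup>2) / l * s\<^sup>2" using l(1) by (simp add: field_simps)
        then have "norm h \<le> sqrt ((8 + 2 * L * n\<^sup>2) / l * s\<^sup>2)" by (rule real_le_rsqrt)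
        also have "\<dots> = C1 * s" using s by (simp add: C1_def real_sqrt_mult del: times_divide_eq_left)
        also have "\<dots> \<le> C * s" using C(2) s by (intro mult_right_mono) auto
        finally show ?thesis by (simp add: h_def dist_norm norm_minus_commute)
      qed
      moreover have "S \<subseteq> \<Union>(A ` I)" by (auto simp: A_def I_def)
      moreover have "finite (A ` I)" using finI by simp
      moreover have "A a \<subseteq> S" for a by (auto simp: A_def)
      ultimately show "\<exists>\<C>. finite \<C> \<and> S \<subseteq> \<Union>\<C> \<and> real (card \<C>) * s ^ dim Y \<le> C * s ^ dim Z \<and>
          (\<forall>A\<in>\<C>. A \<subseteq> S \<and> (\<forall>x\<in>A. \<forall>y\<in>A. dist x y \<le> C * s))"
        using card by (intro exI[of _ "A ` I"]) auto
    qed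
  qed
qed

section \<open>Couplings and the product measure\<close>

text \<open>Marginals on the Borel sets of \<open>X i\<close>; the product measure is called \<open>ref\<close>, the reference measure of
  the entropy.\<close>

locale marginals =
  fixes X :: "'m::finite \<Rightarrow> 'a::euclidean_space set" and \<mu> :: "'m \<Rightarrow> 'a measure"
  assumes prob: "\<And>i. prob_space (\<mu> i)"
    and sets_marginal: "\<And>i. sets (\<mu> i) = sets (restrict_space borel (X i))"
begin

lemma space_marginal: "space (\<mu> i) = X i"
  using sets_eq_imp_space_eq[OF sets_marginal[of i]] by (simp add: space_restrict_space)

sublocale product_prob_space \<mu> UNIV
  by (intro product_prob_spaceI prob)

sublocale finite_product_sigma_finite \<mu> UNIV
  by standard simp

abbreviation ref where "ref \<equiv> prod_measure X \<mu>"

abbreviation borel_prod where "borel_prod \<equiv> restrict_space borel (prod_set X)"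

lemma space_borel_prod: "space borel_prod = prod_set X"
  by (simp add: space_restrict_space)

lemma measurable_coord: "(\<lambda>x. x $ i) \<in> measurable borel_prod (\<mu> i)"
proof -
  have "(\<lambda>x. x $ i) \<in> measurable borel_prod (restrict_space borel (X i))"
  proof (rule measurable_restrict_space2)
    show "(\<lambda>x. x $ i) \<in> space borel_prod \<rightarrow> X i" unfolding space_borel_prod by (auto simp: prod_set_def)
    have "(\<lambda>x::'a^'m. x $ i) \<in> borel_measurable borel"
      by (intro borel_measurable_continuous_onI linear_continuous_on bounded_linear_vec_nth)
    then show "(\<lambda>x. x $ i) \<in> measurable borel_prod borel"
      by (rule measurable_restrict_space1)
  qed
  then show ?thesis using measurable_cong_sets[OF refl sets_marginal] by blast
qed

lemma borel_measurable_marginal: "f \<in> borel_measurable borel \<Longrightarrow> f \<in> borel_measurable (\<mu> i)"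
  using measurable_restrict_space1[of f borel borel "X i"] measurable_cong_sets[OF sets_marginal refl] by blast

lemma measurable_tuple: "(\<lambda>f. \<chi> i. f i) \<in> measurable (PiM UNIV \<mu>) borel_prod"
proof (rule measurable_restrict_space2)
  show "(\<lambda>f. \<chi> i. f i) \<in> space (PiM UNIV \<mu>) \<rightarrow> prod_set X"
    by (auto simp: space_PiM space_marginal prod_set_def PiE_def Pi_def)
  show "(\<lambda>f. \<chi> i. f i) \<in> borel_measurable (PiM UNIV \<mu>)"
  proof (subst borel_measurable_euclidean_space, intro ballI)
    fix b :: "'a ^ 'm" assume "b \<in> Basis"
    then obtain k e where b: "b = axis k e" "e \<in> Basis" by (auto simp: Basis_vec_def)
    have "(\<lambda>x. x \<bullet> e) \<in> borel_measurable (\<mu> k)" by (rule borel_measurable_marginal) measurable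
    then have "(\<lambda>f. f k \<bullet> e) \<in> borel_measurable (PiM UNIV \<mu>)"
      by (rule measurable_compose[OF measurable_component_singleton[OF UNIV_I]])
    then show "(\<lambda>f. (\<chi> i. f i) \<bullet> b) \<in> borel_measurable (PiM UNIV \<mu>)"
      by (simp add: b(1) inner_axis)
  qed
qed

lemma sets_ref[measurable_cong]: "sets ref = sets borel_prod"
  by (simp add: prod_measure_def)

lemma space_ref: "space ref = prod_set X"
  using sets_eq_imp_space_eq[OF sets_ref] by (simp add: space_borel_prod)

lemma prob_space_ref: "prob_space ref"
  unfolding prod_measure_def by (rule prob_space_distr[OF measurable_tuple])

lemma nn_integral_ref_prod:
  assumes "\<And>i. f i \<in> borel_measurable (\<mu> i)"
  shows "(\<integral>\<^sup>+x. (\<Prod>i\<in>UNIV. f i (x $ i)) \<partial>ref) = (\<Prod>i\<in>UNIV. \<integral>\<^sup>+x. f i x \<partial>\<mu> i)"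
proof -
  have "(\<lambda>x. \<Prod>i\<in>UNIV. f i (x $ i)) \<in> borel_measurable borel_prod"
    by (intro borel_measurable_prod_ennreal measurable_compose[OF measurable_coord assms])
  then have "(\<integral>\<^sup>+x. (\<Prod>i\<in>UNIV. f i (x $ i)) \<partial>ref) = (\<integral>\<^sup>+g. (\<Prod>i\<in>UNIV. f i (g i)) \<partial>PiM UNIV \<mu>)"
    unfolding prod_measure_def by (subst nn_integral_distr[OF measurable_tuple]) simp_all
  also have "\<dots> = (\<Prod>i\<in>UNIV. \<integral>\<^sup>+x. f i x \<partial>\<mu> i)"
    using assms by (intro product_nn_integral_prod) auto
  finally show ?thesis .
qed

lemma emeasure_ref_box:
  assumes "\<And>i. A i \<in> sets (\<mu> i)"
  shows "{x\<in>prod_set X. \<forall>i. x $ i \<in> A i} \<in> sets ref"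
    and "emeasure ref {x\<in>prod_set X. \<forall>i. x $ i \<in> A i} = (\<Prod>i\<in>UNIV. emeasure (\<mu> i) (A i))"
proof -
  let ?T = "{x\<in>prod_set X. \<forall>i. x $ i \<in> A i}"
  have "{x\<in>space borel_prod. \<forall>i\<in>UNIV. x $ i \<in> A i} \<in> sets borel_prod"
    using measurable_sets[OF measurable_coord assms]
    by (intro sets.sets_Collect_finite_All) (auto simp: vimage_def Int_def conj_commute)
  then show T: "?T \<in> sets ref" by (simp add: space_borel_prod sets_ref)
  have "emeasure ref ?T = (\<integral>\<^sup>+x. indicator ?T x \<partial>ref)" using T by simp
  also have "\<dots> = (\<integral>\<^sup>+x. (\<Prod>i\<in>UNIV. indicator (A i) (x $ i)) \<partial>ref)"
  proof (rule nn_integral_cong)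
    fix x assume "x \<in> space ref"
    then have "x \<in> prod_set X" by (simp add: space_ref)
    then show "indicator ?T x = (\<Prod>i\<in>UNIV. indicator (A i) (x $ i) :: ennreal)"
      by (cases "\<forall>i. x $ i \<in> A i") (auto simp: indicator_def prod_zero_iff)
  qed
  also have "\<dots> = (\<Prod>i\<in>UNIV. \<integral>\<^sup>+x. indicator (A i) x \<partial>\<mu> i)"
    using assms by (intro nn_integral_ref_prod) auto
  finally show "emeasure ref ?T = (\<Prod>i\<in>UNIV. emeasure (\<mu> i) (A i))" using assms by simp
qed

lemma couplingsI:
  assumes "sets \<gamma> = sets borel_prod" "\<And>i A. A \<in> sets (\<mu> i) \<Longrightarrow> emeasure \<gamma> {x\<in>prod_set X. x $ i \<in> A} = emeasure (\<mu> i) A"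
  shows "\<gamma> \<in> couplings X \<mu>"
proof -
  have sp: "space \<gamma> = prod_set X" using sets_eq_imp_space_eq[OF assms(1)] by (simp add: space_borel_prod)
  have coord: "(\<lambda>x. x $ i) \<in> measurable \<gamma> (restrict_space borel (X i))" for i
    using measurable_coord[of i] measurable_cong_sets[OF assms(1) refl]
      measurable_cong_sets[OF refl sets_marginal[of i]] by blast
  have "emeasure \<gamma> (space \<gamma>) = 1"
  proof -
    fix i :: 'm
    have "{x\<in>prod_set X. x $ i \<in> X i} = prod_set X" by (auto simp: prod_set_def)
    then show ?thesis
      using assms(2)[of "X i" i] prob_space.emeasure_space_1[OF prob[of i]] space_marginal[of i] sp
        sets.top[of "\<mu> i"] by simp
  qed
  then have "prob_space \<gamma>" by (rule prob_spaceI)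
  moreover have "distr \<gamma> (restrict_space borel (X i)) (\<lambda>x. x $ i) = \<mu> i" for i
  proof (rule measure_eqI)
    show "sets (distr \<gamma> (restrict_space borel (X i)) (\<lambda>x. x $ i)) = sets (\<mu> i)"
      by (simp add: sets_marginal)
    fix A assume "A \<in> sets (distr \<gamma> (restrict_space borel (X i)) (\<lambda>x. x $ i))"
    then have A: "A \<in> sets (restrict_space borel (X i))" by simp
    have "(\<lambda>x. x $ i) -` A \<inter> space \<gamma> = {x\<in>prod_set X. x $ i \<in> A}" by (auto simp: sp)
    then show "emeasure (distr \<gamma> (restrict_space borel (X i)) (\<lambda>x. x $ i)) A = emeasure (\<mu> i) A"
      using A assms(2)[of A i] by (simp add: emeasure_distr[OF coord] sets_marginal)
  qed
  ultimately show ?thesis using assms(1) by (simp add: couplings_def)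
qed

lemma ref_coupling: "ref \<in> couplings X \<mu>"
proof (rule couplingsI[OF sets_ref])
  fix i A assume A: "A \<in> sets (\<mu> i)"
  let ?A = "\<lambda>k. if k = i then A else X k"
  have X: "X k \<in> sets (\<mu> k)" for k using sets.top[of "\<mu> k"] by (simp add: space_marginal)
  have "{x\<in>prod_set X. x $ i \<in> A} = {x\<in>prod_set X. \<forall>k. x $ k \<in> ?A k}" by (auto simp: prod_set_def)
  also have "emeasure ref \<dots> = (\<Prod>k\<in>UNIV. emeasure (\<mu> k) (?A k))"
    using A X by (intro emeasure_ref_box) auto
  also have "\<dots> = (\<Prod>k\<in>UNIV. if k = i then emeasure (\<mu> i) A else 1)"
    using prob_space.emeasure_space_1[OF prob] by (intro prod.cong) (auto simp: space_marginal)
  finally show "emeasure ref {x\<in>prod_set X. x $ i \<in> A} = emeasure (\<mu> i) A" by simp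
qed

lemma couplingsD:
  assumes "\<gamma> \<in> couplings X \<mu>"
  shows "prob_space \<gamma>" "sets \<gamma> = sets borel_prod" "space \<gamma> = prod_set X"
    "(\<lambda>x. x $ i) \<in> measurable \<gamma> (\<mu> i)" "distr \<gamma> (\<mu> i) (\<lambda>x. x $ i) = \<mu> i"
proof -
  show "prob_space \<gamma>" and s: "sets \<gamma> = sets borel_prod" using assms by (auto simp: couplings_def)
  show "space \<gamma> = prod_set X" using sets_eq_imp_space_eq[OF s] by (simp add: space_borel_prod)
  show "(\<lambda>x. x $ i) \<in> measurable \<gamma> (\<mu> i)"
    using measurable_coord[of i] measurable_cong_sets[OF s refl] by blast
  have "distr \<gamma> (\<mu> i) (\<lambda>x. x $ i) = distr \<gamma> (restrict_space borel (X i)) (\<lambda>x. x $ i)"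
    by (rule distr_cong) (auto simp: sets_marginal)
  then show "distr \<gamma> (\<mu> i) (\<lambda>x. x $ i) = \<mu> i" using assms by (auto simp: couplings_def)
qed

lemma AE_coupling:
  assumes "\<gamma> \<in> couplings X \<mu>" "\<And>i. AE y in \<mu> i. P i y"
  shows "AE x in \<gamma>. \<forall>i. P i (x $ i)"
proof -
  have "AE x in \<gamma>. P i (x $ i)" for i
  proof (rule AE_distrD[OF couplingsD(4)[OF assms(1)]])
    show "AE y in distr \<gamma> (\<mu> i) (\<lambda>x. x $ i). P i y"
      unfolding couplingsD(5)[OF assms(1)] by (rule assms(2))
  qed
  then show ?thesis using AE_all_countable[of "\<lambda>i x. P i (x $ i)" \<gamma>] by blast
qed

lemma integral_coupling:
  fixes f :: "'a \<Rightarrow> real"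
  assumes "\<gamma> \<in> couplings X \<mu>" "f \<in> borel_measurable (\<mu> i)" "\<And>x. \<bar>f x\<bar> \<le> M"
  shows "integrable \<gamma> (\<lambda>x. f (x $ i))" "(\<integral>x. f (x $ i) \<partial>\<gamma>) = (\<integral>x. f x \<partial>\<mu> i)"
proof -
  interpret g: prob_space \<gamma> by (rule couplingsD(1)[OF assms(1)])
  have m: "(\<lambda>x. f (x $ i)) \<in> borel_measurable \<gamma>"
    by (rule measurable_compose[OF couplingsD(4)[OF assms(1)] assms(2)])
  show "integrable \<gamma> (\<lambda>x. f (x $ i))"
    using m assms(3) by (intro g.integrable_const_bound[where B = M]) auto
  show "(\<integral>x. f (x $ i) \<partial>\<gamma>) = (\<integral>x. f x \<partial>\<mu> i)"
    using integral_distr[OF couplingsD(4)[OF assms(1)] assms(2)] couplingsD(5)[OF assms(1), of i] by simp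
qed

end

section \<open>Cost gaps and product charts\<close>

lemma two_partitions_cases:
  assumes "p \<in> (two_partitions :: 'm::finite set set set)"
  obtains q where "p = {q, - q}" "q \<noteq> - q" "q \<noteq> {}" "q \<noteq> UNIV"
proof -
  have p: "partition_on UNIV p" "card p = 2" using assms by (auto simp: two_partitions_def)
  obtain a b where ab: "p = {a, b}" "a \<noteq> b" using p(2) by (auto simp: card_2_iff)
  have "a \<union> b = UNIV" "a \<inter> b = {}" "a \<noteq> {}" "b \<noteq> {}"
    using p(1) ab by (auto simp: partition_on_def disjoint_def)
  then have "b = - a" "a \<noteq> UNIV" by auto
  then show thesis using ab \<open>a \<noteq> {}\<close> by (intro that[of a]) auto
qed

lemma two_partitions_nonempty:
  assumes "CARD('m::finite) \<ge> 2"
  shows "(two_partitions :: 'm set set set) \<noteq> {}"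
proof -
  fix a :: 'm
  have "- {a} \<noteq> {}"
  proof
    assume "- {a} = {}"
    then have "(UNIV :: 'm set) = {a}" by auto
    then have "CARD('m) = card {a}" by simp
    with assms show False by simp
  qed
  then have "partition_on UNIV {{a}, - {a}}" by (auto simp: partition_on_def disjoint_def)
  moreover have "{a} \<noteq> - {a}" by auto
  then have "card {{a}, - {a}} = 2" by simp
  ultimately show ?thesis by (auto simp: two_partitions_def)
qed

text \<open>The part of \<open>h\<close> in the blocks \<open>i \<in> q\<close>, and the point \<open>x\<close> with its blocks in \<open>q\<close> replaced by
  those of \<open>x'\<close>.\<close>

definition coord_proj :: "'m::finite set \<Rightarrow> 'a::real_vector ^ 'm \<Rightarrow> 'a ^ 'm" where
  "coord_proj q h = (\<chi> i. if i \<in> q then h $ i else 0)"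

definition swap_coords :: "'m::finite set \<Rightarrow> 'a ^ 'm \<Rightarrow> 'a ^ 'm \<Rightarrow> 'a ^ 'm" where
  "swap_coords q x x' = (\<chi> i. if i \<in> q then x' $ i else x $ i)"

text \<open>The cost lost by exchanging the blocks in \<open>q\<close> between \<open>x\<close> and \<open>x'\<close>.\<close>

definition cost_gap :: "('a ^ 'm::finite \<Rightarrow> real) \<Rightarrow> 'm set \<Rightarrow> 'a ^ 'm \<Rightarrow> 'a ^ 'm \<Rightarrow> real" where
  "cost_gap c q x x' = c x + c x' - c (swap_coords q x x') - c (swap_coords (- q) x x')"

text \<open>Subsets \<open>S\<close> of \<open>A\<close> on which every exchange loses at most \<open>2 s\<^sup>2\<close> have outer measure at most \<open>C s\<^sup>k\<close>. The
  exponent \<open>k\<close> refers to \<open>s\<close>, the square root of the level.\<close>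

definition sublevel_bound ::
    "('a ^ 'm::finite) measure \<Rightarrow> ('a ^ 'm \<Rightarrow> real) \<Rightarrow> nat \<Rightarrow> ('a ^ 'm) set \<Rightarrow> real \<Rightarrow> bool" where
  "sublevel_bound Q c k A C \<longleftrightarrow> 0 \<le> C \<and> (\<forall>s S. 0 < s \<longrightarrow> s \<le> 1 \<longrightarrow> S \<subseteq> A \<longrightarrow>
     (\<forall>x\<in>S. \<forall>x'\<in>S. \<forall>q. cost_gap c q x x' \<le> 2 * s\<^sup>2) \<longrightarrow>
     (\<exists>T\<in>sets Q. S \<subseteq> T \<and> emeasure Q T \<le> ennreal (C * s ^ k)))"

lemma sublevel_bound_subset:
  assumes "sublevel_bound Q c k A C" "A' \<subseteq> A"
  shows "sublevel_bound Q c k A' C"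
  using assms unfolding sublevel_bound_def by (meson subset_trans)

lemma coord_proj_linear:
  "coord_proj q (h + k) = coord_proj q h + coord_proj q k"
  "coord_proj q (a *\<^sub>R h) = a *\<^sub>R coord_proj q h"
  by (auto simp: coord_proj_def vec_eq_iff)

lemma coord_proj_eq_sum:
  fixes h :: "'a::real_normed_vector ^ 'm::finite"
  shows "coord_proj q h = (\<Sum>i\<in>q. axis i (h $ i))"
  by (auto simp: coord_proj_def vec_eq_iff axis_def)

lemma norm_coord_proj_le: "norm (coord_proj q h) \<le> norm (h :: 'a::euclidean_space ^ 'm::finite)"
  unfolding norm_vec_def by (rule L2_set_mono) (auto simp: coord_proj_def)

lemma dist_vec_less:
  fixes x y :: "'a::euclidean_space ^ 'm::finite"
  assumes "\<And>i. dist (x $ i) (y $ i) < r"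
  shows "dist x y < real CARD('m) * r"
proof -
  have "dist x y \<le> (\<Sum>i\<in>UNIV. dist (x $ i) (y $ i))"
    unfolding dist_vec_def by (rule L2_set_le_sum) simp
  also have "\<dots> < (\<Sum>i\<in>(UNIV::'m set). r)" using assms by (intro sum_strict_mono) auto
  finally show ?thesis by simp
qed

lemma open_vec_box:
  assumes "\<And>i. open (V i)"
  shows "open {y :: 'a::topological_space ^ 'm::finite. \<forall>i. y $ i \<in> V i}"
proof -
  have "{y :: 'a ^ 'm. \<forall>i. y $ i \<in> V i} = (\<Inter>i\<in>UNIV. (\<lambda>y. y $ i) -` V i)" by auto
  also have "open \<dots>" using assms by (intro open_INT) (auto intro: open_vimage_vec_nth)
  finally show ?thesis .
qed

lemma swap_coords_in_prod_set:
  assumes "x \<in> prod_set K" "x' \<in> prod_set K"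
  shows "swap_coords q x x' \<in> prod_set K"
  using assms by (auto simp: swap_coords_def prod_set_def)

text \<open>Charts \<open>\<phi> i\<close> with inverses \<open>\<psi> i\<close> around the components of a point \<open>x0\<close> of the product.\<close>

locale product_chart =
  fixes X :: "'m::finite \<Rightarrow> 'a::euclidean_space set" and x0 :: "'a ^ 'm"
    and B U V :: "'m \<Rightarrow> 'a set" and \<phi> \<psi> :: "'m \<Rightarrow> 'a \<Rightarrow> 'a"
  assumes x0: "x0 \<in> prod_set X" and B: "\<And>i. B i \<subseteq> Basis"
    and U: "\<And>i. open (U i)" "\<And>i. x0 $ i \<in> U i" and V: "\<And>i. open (V i)"
    and homeo: "\<And>i. homeomorphism (U i) (V i) (\<phi> i) (\<psi> i)"
    and C2: "\<And>i. C2_on (U i) (\<phi> i)" "\<And>i. C2_on (V i) (\<psi> i)"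
    and img: "\<And>i. \<phi> i ` (U i \<inter> X i) = V i \<inter> span (B i)"
begin

text \<open>The product chart \<open>\<Phi>\<close>, its inverse \<open>\<Psi>\<close>, the coordinate space \<open>Y\<close> in which the product of
  the submanifolds is straightened, and the map \<open>\<Lambda>\<close> that reads off the coordinates of a tangent vector at \<open>x0\<close>.\<close>

definition \<Phi> :: "'a ^ 'm \<Rightarrow> 'a ^ 'm" where "\<Phi> x = (\<chi> i. \<phi> i (x $ i))"

definition \<Psi> :: "'a ^ 'm \<Rightarrow> 'a ^ 'm" where "\<Psi> y = (\<chi> i. \<psi> i (y $ i))"

definition Y :: "('a ^ 'm) set" where "Y = {h. \<forall>i. h $ i \<in> span (B i)}"

definition \<Lambda> :: "'a ^ 'm \<Rightarrow> 'a ^ 'm" where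
  "\<Lambda> u = (\<chi> i. \<Sum>\<alpha>\<in>B i. (frechet_derivative (\<phi> i) (at (x0 $ i)) (u $ i) \<bullet> \<alpha>) *\<^sub>R \<alpha>)"

lemma finite_B: "finite (B i)" using B finite_Basis by (rule finite_subset)

lemma inverse_chart: "x \<in> U i \<Longrightarrow> \<psi> i (\<phi> i x) = x"
  using homeo homeomorphism_apply1 by blast

lemma \<Psi>_\<Phi>: "(\<And>i. x $ i \<in> U i) \<Longrightarrow> \<Psi> (\<Phi> x) = x"
  by (simp add: \<Psi>_def \<Phi>_def vec_eq_iff inverse_chart)

lemma \<Psi>_in_prod_set:
  assumes "y \<in> Y" "\<And>i. y $ i \<in> V i"
  shows "\<Psi> y \<in> prod_set X"
proof -
  have "\<psi> i (y $ i) \<in> X i" for i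
  proof -
    have "y $ i \<in> \<phi> i ` (U i \<inter> X i)" using assms by (simp add: img Y_def)
    then show ?thesis using inverse_chart by auto
  qed
  then show ?thesis by (simp add: \<Psi>_def prod_set_def)
qed

lemma chart_mem: "x \<in> U i \<Longrightarrow> x \<in> X i \<Longrightarrow> \<phi> i x \<in> V i \<and> \<phi> i x \<in> span (B i)"
  using img[of i] by blast

lemma \<Phi>_in_Y: "x \<in> prod_set X \<Longrightarrow> (\<And>i. x $ i \<in> U i) \<Longrightarrow> \<Phi> x \<in> Y"
  using chart_mem by (simp add: Y_def \<Phi>_def prod_set_def)

lemma subspace_Y: "subspace Y"
  by (auto simp: subspace_def Y_def span_0 span_add span_scale)

lemma dim_Y: "dim Y = (\<Sum>i\<in>UNIV. card (B i))"
proof -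
  define P where "P = (\<Union>i\<in>UNIV. axis i ` B i)"
  have P: "P \<subseteq> Basis" using B by (auto simp: P_def Basis_vec_def)
  have ax: "i = j \<and> b = b'" if "axis i b = axis j b'" "b \<noteq> 0" for i j :: 'm and b b' :: 'a
  proof -
    have "axis i b $ i = axis j b' $ i" using that(1) by simp
    then show ?thesis using that(2) by (auto simp: axis_def split: if_splits)
  qed
  have nz: "b \<noteq> 0" if "b \<in> B i" for b i using that B nonzero_Basis by blast
  have "card P = (\<Sum>i\<in>UNIV. card (axis i ` B i))"
    unfolding P_def
  proof (rule card_UN_disjoint)
    show "\<forall>i\<in>UNIV. \<forall>j\<in>UNIV. i \<noteq> j \<longrightarrow> axis i ` B i \<inter> axis j ` B j = {}"
    proof (intro ballI impI equals0I)
      fix i j a assume "i \<noteq> j" "a \<in> axis i ` B i \<inter> axis j ` B j"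
      then obtain b b' where "b \<in> B i" "axis i b = axis j b'" by auto
      then show False using ax[of i b j b'] nz \<open>i \<noteq> j\<close> by blast
    qed
  qed (auto simp: finite_B)
  also have "\<dots> = (\<Sum>i\<in>UNIV. card (B i))"
    by (intro sum.cong refl card_image) (use ax nz in \<open>auto simp: inj_on_def\<close>)
  finally have card: "card P = (\<Sum>i\<in>UNIV. card (B i))" .
  have "span P = Y"
  proof
    show "span P \<subseteq> Y"
    proof (rule span_minimal[OF _ subspace_Y])
      show "P \<subseteq> Y" by (auto simp: P_def Y_def axis_def span_base span_0)
    qed
    show "Y \<subseteq> span P"
    proof
      fix h assume h: "h \<in> Y"
      have "axis i (h $ i) \<in> span P" for i
      proof -
        have "linear (axis i :: 'a \<Rightarrow> 'a ^ 'm)" using bounded_linear_axis by (rule bounded_linear.linear)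
        then have "span (axis i ` B i) = axis i ` span (B i)" by (rule linear_span_image)
        moreover have "h $ i \<in> span (B i)" using h by (simp add: Y_def)
        moreover have "span (axis i ` B i) \<subseteq> span P" by (intro span_mono) (auto simp: P_def)
        ultimately show ?thesis by blast
      qed
      then have "(\<Sum>i\<in>UNIV. axis i (h $ i)) \<in> span P" by (intro span_sum)
      then show "h \<in> span P" using coord_proj_eq_sum[of UNIV h] by (simp add: coord_proj_def)
    qed
  qed
  moreover have "independent P" using independent_mono[OF independent_Basis P] .
  ultimately show ?thesis using card dim_eq_card_independent[of P] by (metis dim_span)
qed

lemma differentiable_chart: "\<phi> i differentiable (at (x0 $ i))"
  using C2(1)[of i] U(2)[of i] unfolding C2_on_def differentiable_def by blast

lemma linear_\<Lambda>: "linear \<Lambda>"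
proof -
  have l: "linear (frechet_derivative (\<phi> i) (at (x0 $ i)))" for i
    using differentiable_chart by (rule linear_frechet_derivative)
  show ?thesis
    by (rule linearI)
      (simp_all add: \<Lambda>_def vec_eq_iff linear_add[OF l] linear_cmul[OF l] inner_add_left
        scaleR_add_left sum.distrib scaleR_sum_right)
qed

lemma \<Lambda>_in_Y: "\<Lambda> u \<in> Y"
proof -
  have "(\<Sum>\<alpha>\<in>B i. f \<alpha> *\<^sub>R \<alpha>) \<in> span (B i)" for f i
    by (intro span_sum span_scale) (rule span_base)
  then show ?thesis by (simp add: \<Lambda>_def Y_def)
qed

text \<open>The points of the product whose components are within \<open>r\<close> of \<open>x0\<close> in the charts, a set closed under
  exchange of blocks.\<close>

definition chart_box :: "real \<Rightarrow> ('a ^ 'm) set" where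
  "chart_box r = {x\<in>prod_set X. \<forall>i. x $ i \<in> U i \<and> dist (\<phi> i (x $ i)) (\<phi> i (x0 $ i)) < r}"

lemma swap_coords_in_chart_box:
  "x \<in> chart_box r \<Longrightarrow> x' \<in> chart_box r \<Longrightarrow> swap_coords q x x' \<in> chart_box r"
  by (auto simp: chart_box_def swap_coords_def prod_set_def)

text \<open>The form \<open>H\<close> is the Hessian at \<open>\<Phi> x0\<close> of \<open>F \<circ> \<Psi>\<close>, an ambient \<open>C\<^sup>2\<close> function that represents the
  cost in the chart coordinates.\<close>

lemma second_order_form:
  assumes "open W" "x0 \<in> W" "C2_on W F" "\<And>y. y \<in> W \<inter> prod_set X \<Longrightarrow> F y = c y"
  obtains H where "bounded_bilinear H" "\<And>h k. H h k = H k h"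
    and "\<And>i j \<alpha> \<beta>. i \<noteq> j \<Longrightarrow> \<alpha> \<in> B i \<Longrightarrow> \<beta> \<in> B j \<Longrightarrow>
      mixed_partial c x0 i (\<phi> i) (\<psi> i) \<alpha> j (\<phi> j) (\<psi> j) \<beta> = H (axis i \<alpha>) (axis j \<beta>)"
    and "\<And>\<eta>. \<eta> > 0 \<Longrightarrow> \<exists>r>0. \<forall>x\<in>chart_box r. \<forall>x'\<in>chart_box r. \<forall>q.
      H (coord_proj q (\<Phi> x' - \<Phi> x)) (coord_proj (- q) (\<Phi> x' - \<Phi> x)) - \<eta> * (norm (\<Phi> x' - \<Phi> x))\<^sup>2
        \<le> cost_gap c q x x'"
proof -
  define D where "D = {y. (\<forall>i. y $ i \<in> V i) \<and> \<Psi> y \<in> W}"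
  define f where "f y = F (\<Psi> y)" for y
  let ?D0 = "{y :: 'a ^ 'm. \<forall>i. y $ i \<in> V i}"
  have oD0: "open ?D0" using V by (rule open_vec_box)
  have C2\<Psi>: "C2_on ?D0 \<Psi>" unfolding \<Psi>_def[abs_def] using C2(2) by (rule C2_on_product_map)
  have "continuous_on ?D0 \<Psi>" by (intro C1_on_continuous_on C2_on_imp_C1_on C2\<Psi>)
  then have "open (?D0 \<inter> \<Psi> -` W)" using oD0 assms(1) by (rule continuous_open_preimage)
  moreover have "D = ?D0 \<inter> \<Psi> -` W" by (auto simp: D_def)
  ultimately have oD: "open D" by simp
  have x0U: "x0 $ i \<in> U i" "x0 $ i \<in> X i" for i using U(2) x0 by (auto simp: prod_set_def)
  have y0: "\<Phi> x0 \<in> D"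
    using x0U chart_mem[OF x0U] assms(2) by (simp add: D_def \<Psi>_\<Phi>) (simp add: \<Phi>_def)
  have C2f: "C2_on D f" unfolding f_def
    by (rule C2_on_compose[OF C2_on_subset[OF C2\<Psi>] assms(3)]) (auto simp: D_def)
  have fc: "f y = c (\<Psi> y)" if "y \<in> D" "y \<in> Y" for y
    using that \<Psi>_in_prod_set[of y] assms(4)[of "\<Psi> y"] by (simp add: D_def f_def)
  obtain H where H: "bounded_bilinear H" "\<And>a b. H a b = H b a"
    and Hder: "\<And>F a b r. r > 0 \<Longrightarrow> (\<And>s t. \<bar>s\<bar> < r \<Longrightarrow> \<bar>t\<bar> < r \<Longrightarrow> F s t = f (\<Phi> x0 + s *\<^sub>R a + t *\<^sub>R b)) \<Longrightarrow>
        deriv (\<lambda>s. deriv (\<lambda>t. F s t) 0) 0 = H a b"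
    and Hdiff: "\<And>\<eta>. \<eta> > 0 \<Longrightarrow> \<exists>r>0. \<forall>y h k. y \<in> ball (\<Phi> x0) r \<longrightarrow> y + h \<in> ball (\<Phi> x0) r \<longrightarrow> y + k \<in> ball (\<Phi> x0) r \<longrightarrow>
        y + h + k \<in> ball (\<Phi> x0) r \<longrightarrow>
        \<bar>f (y + h + k) - f (y + h) - f (y + k) + f y - H k h\<bar> \<le> \<eta> * norm h * norm k"
    using C2_on_second_derivative[OF oD y0 C2f] by blast
  obtain r0 where r0: "r0 > 0" "ball (\<Phi> x0) r0 \<subseteq> D" using oD y0 openE by blast
  have mixed: "mixed_partial c x0 i (\<phi> i) (\<psi> i) \<alpha> j (\<phi> j) (\<psi> j) \<beta> = H (axis i \<alpha>) (axis j \<beta>)"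
    if ij: "i \<noteq> j" and ab: "\<alpha> \<in> B i" "\<beta> \<in> B j" for i j \<alpha> \<beta>
    unfolding mixed_partial_def
  proof (rule Hder)
    show "0 < r0 / 2" using r0 by simp
    fix s t :: real assume st: "\<bar>s\<bar> < r0 / 2" "\<bar>t\<bar> < r0 / 2"
    let ?y = "\<Phi> x0 + s *\<^sub>R axis i \<alpha> + t *\<^sub>R axis j \<beta>"
    have "norm (s *\<^sub>R (axis i \<alpha> :: 'a^'m) + t *\<^sub>R axis j \<beta>) \<le> norm (s *\<^sub>R (axis i \<alpha> :: 'a^'m)) + norm (t *\<^sub>R (axis j \<beta> :: 'a^'m))"
      by (rule norm_triangle_ineq)
    also have "\<dots> < r0"
    proof -
      have "axis i \<alpha> \<in> (Basis :: ('a ^ 'm) set)" "axis j \<beta> \<in> (Basis :: ('a ^ 'm) set)"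
        using ab B by (auto simp: Basis_vec_def)
      then show ?thesis using st by simp
    qed
    finally have "dist ?y (\<Phi> x0) < r0" by (simp add: dist_norm algebra_simps)
    then have "?y \<in> ball (\<Phi> x0) r0" by (simp only: mem_ball dist_commute)
    then have yD: "?y \<in> D" using r0(2) by blast
    have "\<Phi> x0 \<in> Y" using x0 x0U by (intro \<Phi>_in_Y)
    moreover have "axis i \<alpha> \<in> Y" "axis j \<beta> \<in> Y"
      using ab by (auto simp: Y_def axis_def span_base span_0)
    ultimately have yY: "?y \<in> Y" using subspace_Y by (intro subspace_add subspace_scale)
    have "\<Psi> ?y = (\<chi> k. if k = i then \<psi> i (\<phi> i (x0 $ i) + s *\<^sub>R \<alpha>)
        else if k = j then \<psi> j (\<phi> j (x0 $ j) + t *\<^sub>R \<beta>) else x0 $ k)"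
      using ij x0U inverse_chart by (auto simp: \<Psi>_def \<Phi>_def vec_eq_iff axis_def)
    then show "c (\<chi> k. if k = i then \<psi> i (\<phi> i (x0 $ i) + s *\<^sub>R \<alpha>)
        else if k = j then \<psi> j (\<phi> j (x0 $ j) + t *\<^sub>R \<beta>) else x0 $ k) = f ?y"
      using fc[OF yD yY] by simp
  qed
  have diff: "\<exists>r>0. \<forall>x\<in>chart_box r. \<forall>x'\<in>chart_box r. \<forall>q.
      H (coord_proj q (\<Phi> x' - \<Phi> x)) (coord_proj (- q) (\<Phi> x' - \<Phi> x)) - \<eta> * (norm (\<Phi> x' - \<Phi> x))\<^sup>2
        \<le> cost_gap c q x x'"
    if eta: "\<eta> > 0" for \<eta>
  proof -
    obtain r1 where r1: "r1 > 0" and R1: "\<And>y h k. y \<in> ball (\<Phi> x0) r1 \<Longrightarrow> y + h \<in> ball (\<Phi> x0) r1 \<Longrightarrow> y + k \<in> ball (\<Phi> x0) r1 \<Longrightarrow>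
        y + h + k \<in> ball (\<Phi> x0) r1 \<Longrightarrow>
        \<bar>f (y + h + k) - f (y + h) - f (y + k) + f y - H k h\<bar> \<le> \<eta> * norm h * norm k"
      using Hdiff[OF eta] by metis
    define r where "r = min r0 r1 / real CARD('m)"
    have r: "r > 0" using r0 r1 by (simp add: r_def)
    show ?thesis
    proof (intro exI[of _ r] conjI ballI allI r)
      fix x x' q assume x: "x \<in> chart_box r" "x' \<in> chart_box r"
      have ball: "\<Phi> z \<in> ball (\<Phi> x0) r0 \<and> \<Phi> z \<in> ball (\<Phi> x0) r1 \<and> f (\<Phi> z) = c z"
        if z: "z \<in> chart_box r" for z
      proof -
        have "dist (\<Phi> z) (\<Phi> x0) < real CARD('m) * r"
          using z by (intro dist_vec_less) (simp add: \<Phi>_def chart_box_def)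
        also have "\<dots> = min r0 r1" by (simp add: r_def)
        finally have *: "dist (\<Phi> x0) (\<Phi> z) < min r0 r1" by (simp add: dist_commute)
        then have "\<Phi> z \<in> D" using r0(2) by auto
        moreover have "\<Phi> z \<in> Y" using z by (intro \<Phi>_in_Y) (auto simp: chart_box_def)
        ultimately have "f (\<Phi> z) = c (\<Psi> (\<Phi> z))" by (rule fc)
        also have "\<Psi> (\<Phi> z) = z" using z by (intro \<Psi>_\<Phi>) (auto simp: chart_box_def)
        finally show ?thesis using * by simp
      qed
      define h where "h = \<Phi> x' - \<Phi> x"
      have s1: "\<Phi> (swap_coords q x x') = \<Phi> x + coord_proj q h"
        and s2: "\<Phi> (swap_coords (- q) x x') = \<Phi> x + coord_proj (- q) h"
        and s3: "\<Phi> x' = \<Phi> x + coord_proj q h + coord_proj (- q) h"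
        by (auto simp: \<Phi>_def swap_coords_def coord_proj_def h_def vec_eq_iff)
      note sw = swap_coords_in_chart_box[OF x]
      note b1 = ball[OF sw, of q, unfolded s1] and b2 = ball[OF sw, of "- q", unfolded s2]
        and b3 = ball[OF x(1)] and b4 = ball[OF x(2), unfolded s3]
      have "\<bar>f (\<Phi> x + coord_proj q h + coord_proj (- q) h) - f (\<Phi> x + coord_proj q h)
          - f (\<Phi> x + coord_proj (- q) h) + f (\<Phi> x) - H (coord_proj (- q) h) (coord_proj q h)\<bar>
          \<le> \<eta> * norm (coord_proj q h) * norm (coord_proj (- q) h)"
        by (rule R1) (use b1 b2 b3 b4 in simp_all)
      moreover have "\<eta> * norm (coord_proj q h) * norm (coord_proj (- q) h) \<le> \<eta> * norm h * norm h"
        using eta by (intro mult_mono norm_coord_proj_le) auto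
      moreover have "f (\<Phi> x + coord_proj q h + coord_proj (- q) h) = c x'"
        "f (\<Phi> x + coord_proj q h) = c (swap_coords q x x')"
        "f (\<Phi> x + coord_proj (- q) h) = c (swap_coords (- q) x x')" "f (\<Phi> x) = c x"
        using b1 b2 b3 b4 by simp_all
      ultimately have "H (coord_proj q h) (coord_proj (- q) h) - \<eta> * (norm h)\<^sup>2
        \<le> cost_gap c q x x'"
        using H(2)[of "coord_proj q h" "coord_proj (- q) h"]
        by (simp add: cost_gap_def power2_eq_square mult.assoc)
      then show "H (coord_proj q (\<Phi> x' - \<Phi> x)) (coord_proj (- q) (\<Phi> x' - \<Phi> x)) - \<eta> * (norm (\<Phi> x' - \<Phi> x))\<^sup>2
        \<le> cost_gap c q x x'"
        by (simp only: h_def)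
    qed
  qed
  show thesis by (rule that[OF H(1)]) (fact H(2) mixed diff)+
qed

end

section \<open>The local sublevel estimate\<close>

text \<open>In chart coordinates, the convex combination \<open>\<Sum>\<^sub>p t\<^sub>p g\<^sub>p\<close> of the forms of the two-block partitions.\<close>

definition partition_form ::
    "('a::real_normed_vector ^ 'm \<Rightarrow> 'a ^ 'm \<Rightarrow> real) \<Rightarrow> ('m::finite set set \<Rightarrow> real) \<Rightarrow> 'a ^ 'm \<Rightarrow> 'a ^ 'm \<Rightarrow> real" where
  "partition_form H t h k =
     (\<Sum>p\<in>two_partitions. t p * (\<Sum>q\<in>p. \<Sum>q'\<in>p - {q}. H (coord_proj q h) (coord_proj q' k)))"

lemma sum_two_partition:
  assumes "q \<noteq> - q"
  shows "(\<Sum>a\<in>{q, - q}. \<Sum>b\<in>{q, - q} - {a}. F a b) = F q (- q) + F (- q) (q :: 'm::finite set)"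
proof -
  have "{q, - q} - {q} = {- q}" "{q, - q} - {- q} = {q}" using assms by auto
  then show ?thesis using assms by simp
qed

lemma partition_form_bilinear:
  fixes H :: "'a::euclidean_space ^ 'm::finite \<Rightarrow> 'a ^ 'm \<Rightarrow> real"
  assumes "bounded_bilinear H"
  shows "bounded_bilinear (partition_form H t)"
proof -
  interpret H: bounded_bilinear H by fact
  have "bilinear (partition_form H t)"
    unfolding bilinear_def partition_form_def
    by (auto intro!: linearI simp: coord_proj_linear H.add_left H.add_right H.scaleR_left H.scaleR_right
        sum.distrib sum_distrib_left algebra_simps)
  then show ?thesis by (simp add: bilinear_conv_bounded_bilinear)
qed

lemma partition_form_sym:
  assumes "\<And>h k. H h k = H k h"
  shows "partition_form H t h k = partition_form H t k h"
  unfolding partition_form_def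
proof (rule sum.cong[OF refl])
  fix p :: "'b::finite set set" assume "p \<in> two_partitions"
  then obtain q where p: "p = {q, - q}" "q \<noteq> - q" by (rule two_partitions_cases)
  show "t p * (\<Sum>q\<in>p. \<Sum>q'\<in>p - {q}. H (coord_proj q h) (coord_proj q' k)) =
      t p * (\<Sum>q\<in>p. \<Sum>q'\<in>p - {q}. H (coord_proj q k) (coord_proj q' h))"
    unfolding p(1) sum_two_partition[OF p(2)]
    by (simp only: assms[of "coord_proj q h"] assms[of "coord_proj (- q) h"] add.commute)
qed

text \<open>At \<open>h\<close>, the form of a partition \<open>{q, - q}\<close> is twice the Hessian term that approximates the cost gap for \<open>q\<close>.\<close>

lemma partition_form_le:
  assumes H_sym: "\<And>h k. H h k = H k h" and t: "\<And>p. p \<in> two_partitions \<Longrightarrow> 0 \<le> t p" "(\<Sum>p\<in>two_partitions. t p) = 1"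
    and le: "\<And>q. q \<noteq> {} \<Longrightarrow> q \<noteq> UNIV \<Longrightarrow> H (coord_proj q h) (coord_proj (- q) h) \<le> a"
  shows "partition_form H t h h / 2 \<le> a"
proof -
  have "partition_form H t h h \<le> (\<Sum>p\<in>two_partitions. t p * (2 * a))"
    unfolding partition_form_def
  proof (rule sum_mono)
    fix p :: "'b::finite set set" assume p2: "p \<in> two_partitions"
    then obtain q where p: "p = {q, - q}" "q \<noteq> - q" "q \<noteq> {}" "q \<noteq> UNIV" by (rule two_partitions_cases)
    show "t p * (\<Sum>q\<in>p. \<Sum>q'\<in>p - {q}. H (coord_proj q h) (coord_proj q' h)) \<le> t p * (2 * a)"
    proof (rule mult_left_mono[OF _ t(1)[OF p2]])
      show "(\<Sum>q\<in>p. \<Sum>q'\<in>p - {q}. H (coord_proj q h) (coord_proj q' h)) \<le> 2 * a"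
        unfolding p(1) sum_two_partition[OF p(2)]
        using le[OF p(3,4)] H_sym[of "coord_proj q h"] by simp
    qed
  qed
  also have "\<dots> = 2 * a" using t(2) by (simp add: sum_distrib_right[symmetric])
  finally show ?thesis by simp
qed

context product_chart
begin

context
  fixes d :: "'m \<Rightarrow> nat" and c :: "'a ^ 'm \<Rightarrow> real" and H :: "'a ^ 'm \<Rightarrow> 'a ^ 'm \<Rightarrow> real"
  assumes sc: "\<And>i. some_chart (X i) (d i) (x0 $ i) = (B i, \<phi> i, \<psi> i)"
    and H: "bounded_bilinear H" and H_sym: "\<And>h k. H h k = H k h"
    and mixed: "\<And>i j \<alpha> \<beta>. i \<noteq> j \<Longrightarrow> \<alpha> \<in> B i \<Longrightarrow> \<beta> \<in> B j \<Longrightarrow>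
      mixed_partial c x0 i (\<phi> i) (\<psi> i) \<alpha> j (\<phi> j) (\<psi> j) \<beta> = H (axis i \<alpha>) (axis j \<beta>)"
begin

interpretation H: bounded_bilinear H by (rule H)

lemma D2_mixed_eq:
  assumes "i \<noteq> j"
  shows "D2_mixed X d c i j x0 u v = H (axis i (\<Lambda> u $ i)) (axis j (\<Lambda> v $ j))"
proof -
  define a where "a k w \<alpha> = frechet_derivative (\<phi> k) (at (x0 $ k)) (w $ k) \<bullet> \<alpha>" for k w \<alpha>
  have ax: "axis k (\<Lambda> w $ k) = (\<Sum>\<alpha>\<in>B k. a k w \<alpha> *\<^sub>R axis k \<alpha>)" for k :: 'm and w
  proof -
    have l: "linear (axis k :: 'a \<Rightarrow> 'a ^ 'm)" using bounded_linear_axis by (rule bounded_linear.linear)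
    show ?thesis by (simp add: \<Lambda>_def a_def linear_sum[OF l] linear_cmul[OF l])
  qed
  have "D2_mixed X d c i j x0 u v = (\<Sum>\<alpha>\<in>B i. \<Sum>\<beta>\<in>B j. H (axis i \<alpha>) (axis j \<beta>) * a i u \<alpha> * a j v \<beta>)"
    unfolding D2_mixed_def sc prod.case a_def
    by (intro sum.cong refl) (simp add: mixed[OF assms])
  also have "\<dots> = H (axis i (\<Lambda> u $ i)) (axis j (\<Lambda> v $ j))"
    unfolding ax H.sum_left unfolding H.sum_right
    by (intro sum.cong refl) (simp add: H.scaleR_left H.scaleR_right)
  finally show ?thesis .
qed

lemma D2_block_eq:
  assumes "q \<inter> q' = {}"
  shows "D2_block X d c q q' x0 u v = H (coord_proj q (\<Lambda> u)) (coord_proj q' (\<Lambda> v))"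
proof -
  have "D2_block X d c q q' x0 u v = (\<Sum>i\<in>q. \<Sum>j\<in>q'. H (axis i (\<Lambda> u $ i)) (axis j (\<Lambda> v $ j)))"
    unfolding D2_block_def using assms by (intro sum.cong refl D2_mixed_eq) auto
  then show ?thesis unfolding coord_proj_eq_sum H.sum_left unfolding H.sum_right .
qed

lemma G_set_eq:
  "(\<Sum>p\<in>two_partitions. t p * g_form X d c p x0 u v) = partition_form H t (\<Lambda> u) (\<Lambda> v)"
  unfolding partition_form_def
proof (rule sum.cong[OF refl])
  fix p :: "'m set set" assume "p \<in> two_partitions"
  then obtain q where p: "p = {q, - q}" "q \<noteq> - q" by (rule two_partitions_cases)
  show "t p * g_form X d c p x0 u v =
      t p * (\<Sum>q\<in>p. \<Sum>q'\<in>p - {q}. H (coord_proj q (\<Lambda> u)) (coord_proj q' (\<Lambda> v)))"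
    unfolding g_form_def p(1) sum_two_partition[OF p(2)] by (simp add: D2_block_eq)
qed

text \<open>The set of positive indices is finite, being bounded by the dimension, so the maximum in \<open>d_plus\<close> is
  attained. A subspace on which the maximising form is positive definite is mapped injectively into
  coordinates by \<open>\<Lambda>\<close>, since the form factors through \<open>\<Lambda>\<close>.\<close>

lemma exists_positive_definite_form:
  assumes "CARD('m) \<ge> 2" "\<kappa> \<le> d_plus X d c x0"
  obtains t Z where "\<And>p. p \<in> two_partitions \<Longrightarrow> 0 \<le> t p" "(\<Sum>p\<in>two_partitions. t p) = 1"
    "subspace Z" "Z \<subseteq> Y" "\<kappa> \<le> dim Z" "\<And>z. z \<in> Z \<Longrightarrow> z \<noteq> 0 \<Longrightarrow> 0 < partition_form H t z z"
proof -
  define b where "b t u v = partition_form H t (\<Lambda> u) (\<Lambda> v)" for t u v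
  let ?T = "prod_tangent X x0"
  define Ts where "Ts = {t :: 'm set set \<Rightarrow> real. (\<forall>p\<in>two_partitions. 0 \<le> t p) \<and> (\<Sum>p\<in>two_partitions. t p) = 1}"
  have lin: "linear (\<lambda>u. b t u v)" for t v
    unfolding b_def
    using linear_compose[OF linear_\<Lambda> bounded_linear.linear[OF bounded_bilinear.bounded_linear_left[OF partition_form_bilinear[OF H]]]]
    by (simp add: comp_def)
  have sym: "b t u v = b t v u" for t u v
    unfolding b_def by (rule partition_form_sym[OF H_sym])
  have img: "{positive_index ?T (g x0) | g. g \<in> G_set X d c} = (\<lambda>t. positive_index ?T (b t)) ` Ts"
  proof -
    define G where "G t = (\<lambda>x u v. \<Sum>p\<in>two_partitions. t p * g_form X d c p x u v)" for t
    have "G t x0 = b t" for t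
      by (simp add: fun_eq_iff b_def G_def G_set_eq)
    moreover have "G_set X d c = G ` Ts" by (auto simp: G_set_def G_def Ts_def)
    ultimately show ?thesis by (simp add: setcompr_eq_image image_image)
  qed
  have le: "positive_index ?T (b t) \<le> DIM('a ^ 'm)" for t
  proof -
    obtain W :: "('a ^ 'm) set" where "dim W = positive_index ?T (b t)"
      using positive_index_subspace[OF lin sym] by metis
    then show ?thesis using dim_subset_UNIV[of W] by simp
  qed
  have "finite ((\<lambda>t. positive_index ?T (b t)) ` Ts)"
    by (rule finite_subset[of _ "{..DIM('a ^ 'm)}"]) (use le in auto)
  moreover have "Ts \<noteq> {}"
  proof -
    have "(\<lambda>p. 1 / real (card (two_partitions :: 'm set set set))) \<in> Ts"
    proof -
      have "card (two_partitions :: 'm set set set) \<noteq> 0"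
        using two_partitions_nonempty[OF assms(1)] by (simp add: card_eq_0_iff)
      then show ?thesis by (simp add: Ts_def)
    qed
    then show ?thesis by blast
  qed
  ultimately have "d_plus X d c x0 \<in> (\<lambda>t. positive_index ?T (b t)) ` Ts"
    unfolding d_plus_def img by (intro Max_in) auto
  then obtain t where t: "t \<in> Ts" "d_plus X d c x0 = positive_index ?T (b t)" by blast
  obtain W where W: "subspace W" "dim W = positive_index ?T (b t)" "\<And>w. w \<in> W \<Longrightarrow> w \<noteq> 0 \<Longrightarrow> 0 < b t w w"
    using positive_index_subspace[OF lin sym] by metis
  have "w = 0" if "w \<in> W" "\<Lambda> w = 0" for w
    using W(3)[OF that(1)] that(2) bounded_bilinear.zero_left[OF partition_form_bilinear[OF H]]
    by (auto simp: b_def)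
  then have inj: "inj_on \<Lambda> W" using W(1) linear_\<Lambda> by (simp add: linear_injective_on_subspace_0)
  show thesis
  proof (rule that[of t "\<Lambda> ` W"])
    show "\<And>p. p \<in> two_partitions \<Longrightarrow> 0 \<le> t p" "(\<Sum>p\<in>two_partitions. t p) = 1" using t(1) by (auto simp: Ts_def)
    show "subspace (\<Lambda> ` W)" using linear_\<Lambda> W(1) by (rule linear_subspace_image)
    show "\<Lambda> ` W \<subseteq> Y" using \<Lambda>_in_Y by blast
    have "dim (\<Lambda> ` W) = dim W"
      using linear_\<Lambda> inj W(1) by (intro dim_image_eq) (simp_all add: span_eq_iff[THEN iffD2])
    then show "\<kappa> \<le> dim (\<Lambda> ` W)" using W(2) t(2) assms(2) by simp
    fix z assume z: "z \<in> \<Lambda> ` W" "z \<noteq> 0"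
    then obtain w where "w \<in> W" "z = \<Lambda> w" by blast
    moreover have "w \<noteq> 0" using z(2) calculation(2) linear_0[OF linear_\<Lambda>] by auto
    ultimately show "0 < partition_form H t z z" using W(3)[of w] by (simp add: b_def)
  qed
qed

end

text \<open>On a small chart box the cost gaps dominate a form that is positive definite on a subspace of dimension at
  least \<open>\<kappa>\<close>, up to an error \<open>\<eta> \<bar>h\<bar>\<^sup>2\<close>. The pieces supplied by \<open>coercive_covering\<close> are enclosed in boxes,
  whose measure is the product of \<open>O(s\<^bsup>d i\<^esup>)\<close> bounds for the marginals.\<close>

lemma local_sublevel_estimate:
  assumes marg: "marginals X \<mu>"
    and dens: "\<And>i. bounded_density_wrt_hausdorff (card (B i)) (X i) (\<mu> i)"
    and m: "CARD('m) \<ge> 2"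
    and sc: "\<And>i. some_chart (X i) (d i) (x0 $ i) = (B i, \<phi> i, \<psi> i)"
    and F: "open W" "x0 \<in> W" "C2_on W F" "\<And>y. y \<in> W \<inter> prod_set X \<Longrightarrow> F y = c y"
    and \<kappa>: "\<kappa> \<le> d_plus X d c x0"
  obtains N C where "open N" "x0 \<in> N" "sublevel_bound (prod_measure X \<mu>) c \<kappa> (N \<inter> prod_set X) C"
proof -
  interpret marginals X \<mu> by fact
  obtain H where H: "bounded_bilinear H" and H_sym: "\<And>h k. H h k = H k h"
    and mixed: "\<And>i j \<alpha> \<beta>. i \<noteq> j \<Longrightarrow> \<alpha> \<in> B i \<Longrightarrow> \<beta> \<in> B j \<Longrightarrow>
      mixed_partial c x0 i (\<phi> i) (\<psi> i) \<alpha> j (\<phi> j) (\<psi> j) \<beta> = H (axis i \<alpha>) (axis j \<beta>)"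
    and Hdiff: "\<And>\<eta>. \<eta> > 0 \<Longrightarrow> \<exists>r>0. \<forall>x\<in>chart_box r. \<forall>x'\<in>chart_box r. \<forall>q.
      H (coord_proj q (\<Phi> x' - \<Phi> x)) (coord_proj (- q) (\<Phi> x' - \<Phi> x)) - \<eta> * (norm (\<Phi> x' - \<Phi> x))\<^sup>2
        \<le> cost_gap c q x x'"
    using second_order_form[OF F] by blast
  obtain t Z where t: "\<And>p. p \<in> two_partitions \<Longrightarrow> 0 \<le> t p" "(\<Sum>p\<in>two_partitions. t p) = 1"
    and Z: "subspace Z" "Z \<subseteq> Y" "\<kappa> \<le> dim Z"
    and pd: "\<And>z. z \<in> Z \<Longrightarrow> z \<noteq> 0 \<Longrightarrow> 0 < partition_form H t z z"
    using exists_positive_definite_form[OF sc H H_sym mixed m \<kappa>] by blast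
  have R0: "real CARD('m) \<ge> 0" by simp
  obtain \<eta> C where \<eta>: "\<eta> > 0" and C: "C > 0" and cover:
    "\<forall>s S y0. 0 < s \<and> s \<le> 1 \<and> S \<subseteq> cball y0 (real CARD('m)) \<and> (\<forall>x\<in>S. \<forall>y\<in>S. y - x \<in> Y) \<and>
      (\<forall>x\<in>S. \<forall>y\<in>S. partition_form H t (y - x) (y - x) / 2 - \<eta> * (norm (y - x))\<^sup>2 \<le> 2 * s\<^sup>2) \<longrightarrow>
      (\<exists>\<C>. finite \<C> \<and> S \<subseteq> \<Union>\<C> \<and> real (card \<C>) * s ^ dim Y \<le> C * s ^ dim Z \<and>
        (\<forall>A\<in>\<C>. A \<subseteq> S \<and> (\<forall>x\<in>A. \<forall>y\<in>A. dist x y \<le> C * s)))"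
    by (rule coercive_covering[OF partition_form_bilinear[OF H] Z(1) _ subspace_Y Z(2) R0, of t], erule (1) pd, rule that)
  obtain r1 where r1: "r1 > 0" and R1: "\<And>x x' q. x \<in> chart_box r1 \<Longrightarrow> x' \<in> chart_box r1 \<Longrightarrow>
      H (coord_proj q (\<Phi> x' - \<Phi> x)) (coord_proj (- q) (\<Phi> x' - \<Phi> x)) - \<eta> * (norm (\<Phi> x' - \<Phi> x))\<^sup>2
        \<le> cost_gap c q x x'"
    using Hdiff[OF \<eta>] by metis
  have x0U: "x0 $ i \<in> U i" "x0 $ i \<in> X i" for i using U(2) x0 by (auto simp: prod_set_def)
  define P where "P i r M \<longleftrightarrow> r > 0 \<and> M \<ge> 0 \<and> (\<forall>\<delta> y A. \<delta> > 0 \<longrightarrow>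
      A \<subseteq> {x\<in>U i \<inter> X i. \<phi> i x \<in> ball (\<phi> i (x0 $ i)) r \<and> dist (\<phi> i x) y \<le> \<delta>} \<longrightarrow>
      emeasure (\<mu> i) A \<le> ennreal (M * \<delta> ^ card (B i)))" for i r M
  have "\<exists>r M. P i r M" for i
  proof -
    have "\<phi> i (x0 $ i) \<in> V i" using chart_mem[OF x0U] by blast
    then show ?thesis
    proof (rule slice_chart_upper_regular[OF dens B V _ homeo C2(2) img])
      fix r M assume "r > 0" "M \<ge> 0" and *: "\<And>\<delta> y A. \<delta> > 0 \<Longrightarrow>
        A \<subseteq> {x\<in>U i \<inter> X i. \<phi> i x \<in> ball (\<phi> i (x0 $ i)) r \<and> dist (\<phi> i x) y \<le> \<delta>} \<Longrightarrow>
        emeasure (\<mu> i) A \<le> ennreal (M * \<delta> ^ card (B i))"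
      show ?thesis
        unfolding P_def by (intro exI[of _ r] exI[of _ M] conjI allI impI *) fact+
    qed
  qed
  then obtain r2 M where P: "\<And>i. P i (r2 i) (M i)" by metis
  then have r2: "\<And>i. r2 i > 0" and M: "\<And>i. M i \<ge> 0" by (auto simp: P_def)
  have reg: "emeasure (\<mu> i) A \<le> ennreal (M i * \<delta> ^ card (B i))"
    if "\<delta> > 0" "A \<subseteq> {x\<in>U i \<inter> X i. \<phi> i x \<in> ball (\<phi> i (x0 $ i)) (r2 i) \<and> dist (\<phi> i x) z \<le> \<delta>}" for i \<delta> z A
    using P[of i, unfolded P_def] that by blast
  define r where "r = Min (insert 1 (insert r1 (range r2)))"
  have r: "r > 0" using r1 r2 by (auto simp: r_def)
  have r: "r > 0" "r \<le> 1" "r \<le> r1" "\<And>i. r \<le> r2 i"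
    using r unfolding r_def by (auto simp del: Min_insert intro!: Min_le)
  define N where "N = {x. \<forall>i. x $ i \<in> {z\<in>U i. \<phi> i z \<in> ball (\<phi> i (x0 $ i)) r}}"
  have opA: "open {z\<in>U i. \<phi> i z \<in> G}" if "open G" for i G
  proof -
    have "continuous_on (U i) (\<phi> i)" by (intro C1_on_continuous_on C2_on_imp_C1_on C2)
    then have "open (U i \<inter> \<phi> i -` G)" using U(1) that by (rule continuous_open_preimage)
    moreover have "U i \<inter> \<phi> i -` G = {z\<in>U i. \<phi> i z \<in> G}" by auto
    ultimately show ?thesis by simp
  qed
  define C' where "C' = (\<Prod>i\<in>UNIV. M i) * (C + 1) ^ dim Y * C"
  show thesis
  proof (rule that[of N C'])
    show "open N" unfolding N_def by (intro open_vec_box opA open_ball)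
    show "x0 \<in> N" using x0U r(1) by (simp add: N_def)
    show "sublevel_bound ref c \<kappa> (N \<inter> prod_set X) C'"
      unfolding sublevel_bound_def
    proof (intro conjI allI impI)
      show "0 \<le> C'" using M C by (auto simp: C'_def intro!: mult_nonneg_nonneg prod_nonneg)
      fix s S assume s: "0 < s" "s \<le> 1" and S: "S \<subseteq> N \<inter> prod_set X"
        and sub: "\<forall>x\<in>S. \<forall>x'\<in>S. \<forall>q. cost_gap c q x x' \<le> 2 * s\<^sup>2"
      have SX: "x \<in> prod_set X" and SN: "\<forall>i. x $ i \<in> U i \<and> dist (\<phi> i (x $ i)) (\<phi> i (x0 $ i)) < r"
        if "x \<in> S" for x
        using S that by (auto simp: N_def dist_commute subset_iff)
      have S_box: "x \<in> chart_box r1" if "x \<in> S" for x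
        using SX[OF that] SN[OF that] r(3) unfolding chart_box_def by (auto intro: less_le_trans)
      have PhiY: "\<Phi> x \<in> Y" if "x \<in> S" for x using SX[OF that] SN[OF that] by (intro \<Phi>_in_Y) auto
      have "\<exists>\<C>. finite \<C> \<and> \<Phi> ` S \<subseteq> \<Union>\<C> \<and> real (card \<C>) * s ^ dim Y \<le> C * s ^ dim Z \<and>
          (\<forall>A\<in>\<C>. A \<subseteq> \<Phi> ` S \<and> (\<forall>x\<in>A. \<forall>y\<in>A. dist x y \<le> C * s))"
      proof (rule cover[rule_format], intro conjI ballI s)
        show "\<Phi> ` S \<subseteq> cball (\<Phi> x0) (real CARD('m))"
        proof
          fix y assume "y \<in> \<Phi> ` S"
          then obtain x where x: "x \<in> S" "y = \<Phi> x" by blast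
          have "dist (\<Phi> x) (\<Phi> x0) < real CARD('m) * 1"
            using SN[OF x(1)] r(2) by (intro dist_vec_less) (simp add: \<Phi>_def, meson less_le_trans)
          then show "y \<in> cball (\<Phi> x0) (real CARD('m))" using x(2) by (simp add: dist_commute)
        qed
        show "y - x \<in> Y" if "x \<in> \<Phi> ` S" "y \<in> \<Phi> ` S" for x y
          using that PhiY subspace_Y by (auto intro: subspace_diff)
        show "partition_form H t (y - x) (y - x) / 2 - \<eta> * (norm (y - x))\<^sup>2 \<le> 2 * s\<^sup>2"
          if xy: "x \<in> \<Phi> ` S" "y \<in> \<Phi> ` S" for x y
        proof -
          obtain u v where uv: "u \<in> S" "x = \<Phi> u" "v \<in> S" "y = \<Phi> v" using xy by blast
          have "H (coord_proj q (y - x)) (coord_proj (- q) (y - x)) \<le> 2 * s\<^sup>2 + \<eta> * (norm (y - x))\<^sup>2" for q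
            using R1[OF S_box[OF uv(1)] S_box[OF uv(3)], of q] sub[rule_format, OF uv(1,3), of q]
            unfolding uv(2,4) by linarith
          then have "partition_form H t (y - x) (y - x) / 2 \<le> 2 * s\<^sup>2 + \<eta> * (norm (y - x))\<^sup>2"
            using H_sym t by (intro partition_form_le)
          then show ?thesis by linarith
        qed
      qed
      then obtain \<C> where \<C>: "finite \<C>" "\<Phi> ` S \<subseteq> \<Union>\<C>" "real (card \<C>) * s ^ dim Y \<le> C * s ^ dim Z"
        and \<C>_dist: "\<forall>A\<in>\<C>. A \<subseteq> \<Phi> ` S \<and> (\<forall>x\<in>A. \<forall>y\<in>A. dist x y \<le> C * s)"
        by (elim exE conjE)
      have diam: "dist x y \<le> C * s" if "A \<in> \<C>" "x \<in> A" "y \<in> A" for A x y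
        using \<C>_dist that by blast
      \<comment> \<open>The pieces have diameter at most \<open>C * s\<close>; open balls of the larger radius \<open>\<delta>\<close> make the boxes measurable.\<close>
    define \<delta> where "\<delta> = (C + 1) * s"
      have \<delta>: "\<delta> > 0" "C * s < \<delta>" using C s by (auto simp: \<delta>_def algebra_simps add_pos_pos)
      define y where "y A = (SOME a. a \<in> A)" for A :: "('a ^ 'm) set"
      define A' where "A' A i = {x\<in>U i. \<phi> i x \<in> ball (\<phi> i (x0 $ i)) r \<inter> ball (y A $ i) \<delta>} \<inter> X i" for A i
      define T where "T A = {x\<in>prod_set X. \<forall>i. x $ i \<in> A' A i}" for A
      have A'_sets: "A' A i \<in> sets (\<mu> i)" for A i
      proof -
        have "open {x\<in>U i. \<phi> i x \<in> ball (\<phi> i (x0 $ i)) r \<inter> ball (y A $ i) \<delta>}" by (rule opA) (intro open_Int open_ball)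
        then have "X i \<inter> {x\<in>U i. \<phi> i x \<in> ball (\<phi> i (x0 $ i)) r \<inter> ball (y A $ i) \<delta>} \<in> sets (restrict_space borel (X i))"
          unfolding sets_restrict_space by (intro imageI borel_open)
        then show ?thesis by (simp only: A'_def sets_marginal Int_commute)
      qed
      have A'_em: "emeasure (\<mu> i) (A' A i) \<le> ennreal (M i * \<delta> ^ card (B i))" for A i
        using r(4)[of i] by (intro reg[of \<delta> "A' A i" i "y A $ i"] \<delta>(1)) (auto simp: A'_def dist_commute)
      have T_em: "emeasure ref (T A) \<le> ennreal ((\<Prod>i\<in>UNIV. M i) * \<delta> ^ dim Y)" for A
      proof -
        have "emeasure ref (T A) = (\<Prod>i\<in>UNIV. emeasure (\<mu> i) (A' A i))"
          unfolding T_def using A'_sets by (rule emeasure_ref_box(2))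
        also have "\<dots> \<le> (\<Prod>i\<in>UNIV. ennreal (M i * \<delta> ^ card (B i)))"
          using A'_em by (intro prod_mono_ennreal)
        also have "\<dots> = ennreal (\<Prod>i\<in>UNIV. M i * \<delta> ^ card (B i))"
          using M \<delta> by (intro prod_ennreal) auto
        also have "(\<Prod>i\<in>UNIV. M i * \<delta> ^ card (B i)) = (\<Prod>i\<in>UNIV. M i) * \<delta> ^ dim Y"
          by (simp add: prod.distrib dim_Y power_sum)
        finally show ?thesis .
      qed
      have T_sets: "T A \<in> sets ref" for A unfolding T_def using A'_sets by (rule emeasure_ref_box(1))
      show "\<exists>T\<in>sets ref. S \<subseteq> T \<and> emeasure ref T \<le> ennreal (C' * s ^ \<kappa>)"
      proof (intro bexI[of _ "\<Union>A\<in>\<C>. T A"] conjI)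
        show "(\<Union>A\<in>\<C>. T A) \<in> sets ref" using \<C>(1) T_sets by (intro sets.finite_UN) auto
        show "S \<subseteq> (\<Union>A\<in>\<C>. T A)"
        proof
          fix x assume x: "x \<in> S"
          then obtain A where A: "A \<in> \<C>" "\<Phi> x \<in> A" using \<C>(2) by blast
          have "y A \<in> A" unfolding y_def using A(2) by (rule someI)
          then have "dist (\<Phi> x) (y A) \<le> C * s" by (rule diam[OF A])
          then have "dist (\<phi> i (x $ i)) (y A $ i) < \<delta>" for i
            using dist_vec_nth_le[of "\<Phi> x" i "y A"] \<delta>(2) by (simp add: \<Phi>_def)
          then have "x $ i \<in> A' A i" for i
            using SN[OF x] SX[OF x] by (auto simp: A'_def prod_set_def dist_commute)
          then have "x \<in> T A" using SX[OF x] by (simp add: T_def)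
          then show "x \<in> (\<Union>A\<in>\<C>. T A)" using A(1) by blast
        qed
        have "emeasure ref (\<Union>A\<in>\<C>. T A) \<le> (\<Sum>A\<in>\<C>. emeasure ref (T A))"
          using \<C>(1) T_sets by (intro emeasure_subadditive_finite) auto
        also have "\<dots> \<le> (\<Sum>A\<in>\<C>. ennreal ((\<Prod>i\<in>UNIV. M i) * \<delta> ^ dim Y))"
          using T_em by (intro sum_mono)
        also have "\<dots> = ennreal (real (card \<C>) * ((\<Prod>i\<in>UNIV. M i) * \<delta> ^ dim Y))"
          using M \<delta>(1) by (simp add: ennreal_mult' ennreal_of_nat_eq_real_of_nat)
        also have "\<dots> \<le> ennreal (C' * s ^ \<kappa>)"
        proof (rule ennreal_leI)
          have M0: "0 \<le> (\<Prod>i\<in>UNIV. M i) * (C + 1) ^ dim Y"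
            using M C by (intro mult_nonneg_nonneg prod_nonneg zero_le_power) auto
          have "real (card \<C>) * ((\<Prod>i\<in>UNIV. M i) * \<delta> ^ dim Y)
              = (\<Prod>i\<in>UNIV. M i) * (C + 1) ^ dim Y * (real (card \<C>) * s ^ dim Y)"
            by (simp add: \<delta>_def power_mult_distrib)
          also have "\<dots> \<le> (\<Prod>i\<in>UNIV. M i) * (C + 1) ^ dim Y * (C * s ^ dim Z)"
            using \<C>(3) M0 by (rule mult_left_mono)
          also have "\<dots> \<le> (\<Prod>i\<in>UNIV. M i) * (C + 1) ^ dim Y * (C * s ^ \<kappa>)"
            using M0 C s Z(3) by (intro mult_left_mono power_decreasing) auto
          finally show "real (card \<C>) * ((\<Prod>i\<in>UNIV. M i) * \<delta> ^ dim Y) \<le> C' * s ^ \<kappa>"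
            by (simp add: C'_def mult_ac)
        qed
        finally show "emeasure ref (\<Union>A\<in>\<C>. T A) \<le> ennreal (C' * s ^ \<kappa>)" .
      qed
    qed
  qed
qed

end

section \<open>Approximate Kantorovich duality\<close>

lemma compact_prod_set:
  fixes K :: "'m::finite \<Rightarrow> 'a::euclidean_space set"
  assumes "\<And>i. compact (K i)"
  shows "compact (prod_set K)"
proof -
  have "prod_set K = (\<Inter>i\<in>UNIV. (\<lambda>x. x $ i) -` K i)" by (auto simp: prod_set_def)
  moreover have "closed (\<Inter>i\<in>UNIV. (\<lambda>x :: 'a ^ 'm. x $ i) -` K i)"
    using assms compact_imp_closed by (intro closed_INT) (auto intro: closed_vimage_vec_nth)
  moreover have "bounded (prod_set K)"
  proof -
    have "\<exists>b. \<forall>x\<in>K i. norm x \<le> b" for i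
      using compact_imp_bounded[OF assms[of i]] by (simp add: bounded_iff)
    then obtain b where b: "\<And>i x. x \<in> K i \<Longrightarrow> norm x \<le> b i" by metis
    have "norm x \<le> (\<Sum>i\<in>UNIV. b i)" if x: "x \<in> prod_set K" for x
    proof -
      have "norm x \<le> (\<Sum>i\<in>UNIV. norm (x $ i))" unfolding norm_vec_def by (rule L2_set_le_sum) simp
      also have "\<dots> \<le> (\<Sum>i\<in>UNIV. b i)" using x by (intro sum_mono b) (simp add: prod_set_def)
      finally show ?thesis .
    qed
    then show ?thesis unfolding bounded_iff by blast
  qed
  ultimately show ?thesis by (simp add: compact_eq_bounded_closed)
qed

context marginals
begin

text \<open>The coupling has the density \<open>\<Sum>\<^sub>j \<pi> j \<Prod>\<^sub>i 1\<^bsub>D i (j i)\<^esub> / \<mu> i (D i (j i))\<close> with respect to the product measure. Cells of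
  measure 0 do no harm, because a plan gives them no mass and real division by 0 yields 0.\<close>

lemma step_coupling:
  fixes D :: "'m \<Rightarrow> 'l \<Rightarrow> 'a set" and \<pi> :: "('m \<Rightarrow> 'l) \<Rightarrow> real"
  assumes fin: "\<And>i. finite (L i)" and D: "\<And>i a. D i a \<in> sets (\<mu> i)"
    and disj: "\<And>i. disjoint_family_on (D i) (L i)"
    and full: "\<And>i. AE x in \<mu> i. x \<in> (\<Union>a\<in>L i. D i a)"
    and \<pi>: "\<And>j. j \<in> Pi UNIV L \<Longrightarrow> 0 \<le> \<pi> j"
    and marg: "\<And>i a. a \<in> L i \<Longrightarrow> (\<Sum>j | j \<in> Pi UNIV L \<and> j i = a. \<pi> j) = measure (\<mu> i) (D i a)"
  obtains \<gamma> where "\<gamma> \<in> couplings X \<mu>"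
    and "\<And>f b. f \<in> borel_measurable borel_prod \<Longrightarrow> (\<And>j. j \<in> Pi UNIV L \<Longrightarrow> 0 \<le> b j) \<Longrightarrow>
      (\<And>j x. j \<in> Pi UNIV L \<Longrightarrow> x \<in> prod_set X \<Longrightarrow> (\<And>i. x $ i \<in> D i (j i)) \<Longrightarrow> f x \<le> ennreal (b j)) \<Longrightarrow>
      (\<integral>\<^sup>+x. f x \<partial>\<gamma>) \<le> ennreal (\<Sum>j\<in>Pi UNIV L. \<pi> j * b j)"
proof -
  let ?J = "Pi UNIV L"
  have "?J = PiE UNIV L" by (simp add: PiE_def)
  then have finJ: "finite ?J" using fin by (simp add: finite_PiE)
  define m where "m i a = measure (\<mu> i) (D i a)" for i a
  define w where "w i a x = ennreal (indicator (D i a) x / m i a)" for i a x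
  define W where "W j x = (\<Prod>i\<in>UNIV. w i (j i) (x $ i))" for j x
  define h where "h x = (\<Sum>j\<in>?J. ennreal (\<pi> j) * W j x)" for x
  define \<gamma> where "\<gamma> = density ref h"
  have w_meas: "w i a \<in> borel_measurable (\<mu> i)" for i a
    unfolding w_def using D[of i a] by measurable
  have W_meas: "W j \<in> borel_measurable borel_prod" for j
    unfolding W_def by (intro borel_measurable_prod_ennreal measurable_compose[OF measurable_coord w_meas])
  have h_meas: "h \<in> borel_measurable borel_prod"
    unfolding h_def using W_meas by (intro borel_measurable_sum borel_measurable_times) auto
  define v where "v i a A = measure (\<mu> i) (D i a \<inter> A) / m i a" for i a A
  have m0: "m i a \<ge> 0" for i a by (simp add: m_def)
  have v0: "v i a A \<ge> 0" for i a A by (simp add: v_def m_def)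
  have w_int: "(\<integral>\<^sup>+x. w i a x * indicator A x \<partial>\<mu> i) = ennreal (v i a A)" if A: "A \<in> sets (\<mu> i)" for i a A
  proof -
    have "(\<integral>\<^sup>+x. w i a x * indicator A x \<partial>\<mu> i) = (\<integral>\<^sup>+x. ennreal (1 / m i a) * indicator (D i a \<inter> A) x \<partial>\<mu> i)"
      by (intro nn_integral_cong) (simp add: w_def indicator_def)
    also have "\<dots> = ennreal (1 / m i a) * emeasure (\<mu> i) (D i a \<inter> A)"
      using D A by (intro nn_integral_cmult_indicator) auto
    also have "\<dots> = ennreal (v i a A)"
      by (subst M.emeasure_eq_measure) (simp add: v_def ennreal_mult'[symmetric] m0)
    finally show ?thesis .
  qed
  \<comment> \<open>A cell used by the plan has positive measure, as its mass is a sum that contains \<open>\<pi> j\<close>.\<close>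
  have pos: "m i (j i) > 0" if j: "j \<in> ?J" "\<pi> j \<noteq> 0" for i j
  proof -
    have "\<pi> j \<le> (\<Sum>j' | j' \<in> ?J \<and> j' i = j i. \<pi> j')"
      using finJ j \<pi> by (intro member_le_sum) auto
    also have "\<dots> = m i (j i)" unfolding m_def using j(1) by (intro marg) (auto simp: Pi_iff)
    finally show ?thesis using \<pi>[OF j(1)] j(2) by linarith
  qed
  have vX: "v i (j i) (X i) = 1" if "j \<in> ?J" "\<pi> j \<noteq> 0" for i j
  proof -
    have "D i (j i) \<inter> X i = D i (j i)" using sets.sets_into_space[OF D[of i "j i"]] by (auto simp: space_marginal)
    then show ?thesis using pos[OF that, of i] by (simp add: v_def m_def)
  qed
  have X_sets: "X i \<in> sets (\<mu> i)" for i using sets.top[of "\<mu> i"] by (simp add: space_marginal)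
  have W_int: "ennreal (\<pi> j) * (\<integral>\<^sup>+x. W j x \<partial>ref) \<le> ennreal (\<pi> j)" if j: "j \<in> ?J" for j
  proof (cases "\<pi> j = 0")
    case False
    have "(\<integral>\<^sup>+x. W j x \<partial>ref) = (\<Prod>i\<in>UNIV. \<integral>\<^sup>+x. w i (j i) x \<partial>\<mu> i)"
      unfolding W_def using w_meas by (rule nn_integral_ref_prod)
    also have "\<dots> = (\<Prod>i\<in>(UNIV::'m set). 1)"
    proof (rule prod.cong[OF refl])
      fix i
      have "(\<integral>\<^sup>+x. w i (j i) x \<partial>\<mu> i) = (\<integral>\<^sup>+x. w i (j i) x * indicator (X i) x \<partial>\<mu> i)"
        by (intro nn_integral_cong) (simp add: space_marginal)
      then show "(\<integral>\<^sup>+x. w i (j i) x \<partial>\<mu> i) = 1"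
        using w_int[OF X_sets] vX[OF j False] by simp
    qed
    finally show ?thesis by simp
  qed simp
  have \<gamma>_int: "(\<integral>\<^sup>+x. f x \<partial>\<gamma>) = (\<Sum>j\<in>?J. ennreal (\<pi> j) * (\<integral>\<^sup>+x. W j x * f x \<partial>ref))"
    if f: "f \<in> borel_measurable borel_prod" for f
  proof -
    have mc: "borel_measurable ref = borel_measurable borel_prod" by (rule measurable_cong_sets[OF sets_ref refl])
    have "(\<integral>\<^sup>+x. f x \<partial>\<gamma>) = (\<integral>\<^sup>+x. h x * f x \<partial>ref)"
      unfolding \<gamma>_def using h_meas f by (intro nn_integral_density) (simp_all add: mc)
    also have "\<dots> = (\<integral>\<^sup>+x. (\<Sum>j\<in>?J. ennreal (\<pi> j) * (W j x * f x)) \<partial>ref)"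
      by (simp add: h_def sum_distrib_right mult.assoc)
    also have "\<dots> = (\<Sum>j\<in>?J. \<integral>\<^sup>+x. ennreal (\<pi> j) * (W j x * f x) \<partial>ref)"
      using W_meas f by (intro nn_integral_sum) (simp add: mc)
    also have "\<dots> = (\<Sum>j\<in>?J. ennreal (\<pi> j) * (\<integral>\<^sup>+x. W j x * f x \<partial>ref))"
      using W_meas f by (intro sum.cong refl nn_integral_cmult) (simp add: mc)
    finally show ?thesis .
  qed
  have coupling: "\<gamma> \<in> couplings X \<mu>"
  proof (rule couplingsI)
    show "sets \<gamma> = sets borel_prod" by (simp add: \<gamma>_def sets_ref)
    fix k A assume A: "A \<in> sets (\<mu> k)"
    define A' where "A' i = (if i = k then A else X i)" for i
    have A': "A' i \<in> sets (\<mu> i)" for i using A X_sets by (simp add: A'_def)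
    let ?T = "{x\<in>prod_set X. x $ k \<in> A}"
    have "?T = {x\<in>prod_set X. \<forall>i. x $ i \<in> A' i}" by (auto simp: A'_def prod_set_def)
    then have T: "?T \<in> sets borel_prod" using emeasure_ref_box(1)[OF A'] sets_ref by simp
    have 1: "(\<integral>\<^sup>+x. W j x * indicator ?T x \<partial>ref) = ennreal (\<Prod>i\<in>UNIV. v i (j i) (A' i))" for j
    proof -
      have "(\<integral>\<^sup>+x. W j x * indicator ?T x \<partial>ref) = (\<integral>\<^sup>+x. (\<Prod>i\<in>UNIV. w i (j i) (x $ i) * indicator (A' i) (x $ i)) \<partial>ref)"
      proof (rule nn_integral_cong)
        fix x assume "x \<in> space ref"
        then have x: "x \<in> prod_set X" by (simp add: space_ref)
        have "(\<Prod>i\<in>UNIV. indicator (A' i) (x $ i) :: ennreal) = (\<Prod>i\<in>UNIV. if i = k then indicator A (x $ k) else 1)"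
          using x by (intro prod.cong) (auto simp: A'_def prod_set_def)
        then show "W j x * indicator ?T x = (\<Prod>i\<in>UNIV. w i (j i) (x $ i) * indicator (A' i) (x $ i))"
          using x by (simp add: W_def prod.distrib indicator_def)
      qed
      also have "\<dots> = (\<Prod>i\<in>UNIV. \<integral>\<^sup>+x. w i (j i) x * indicator (A' i) x \<partial>\<mu> i)"
        by (intro nn_integral_ref_prod borel_measurable_times_ennreal borel_measurable_indicator w_meas A')
      also have "\<dots> = (\<Prod>i\<in>UNIV. ennreal (v i (j i) (A' i)))" using A' by (simp add: w_int)
      finally show ?thesis using v0 by (simp add: prod_ennreal)
    qed
    have 2: "\<pi> j * (\<Prod>i\<in>UNIV. v i (j i) (A' i)) = \<pi> j * v k (j k) A" if j: "j \<in> ?J" for j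
    proof (cases "\<pi> j = 0")
      case False
      have "(\<Prod>i\<in>UNIV. v i (j i) (A' i)) = (\<Prod>i\<in>UNIV. if i = k then v k (j k) A else 1)"
        using vX[OF j False] by (intro prod.cong) (auto simp: A'_def)
      then show ?thesis by simp
    qed simp
    have "emeasure \<gamma> ?T = (\<integral>\<^sup>+x. indicator ?T x \<partial>\<gamma>)" using T by (simp add: \<gamma>_def sets_ref)
    also have "\<dots> = (\<Sum>j\<in>?J. ennreal (\<pi> j) * ennreal (\<Prod>i\<in>UNIV. v i (j i) (A' i)))"
      using T by (subst \<gamma>_int) (simp_all add: 1)
    also have "\<dots> = (\<Sum>j\<in>?J. ennreal (\<pi> j * v k (j k) A))"
      using \<pi> v0 by (intro sum.cong refl) (simp add: ennreal_mult'[symmetric] prod_nonneg 2)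
    also have "\<dots> = ennreal (\<Sum>j\<in>?J. \<pi> j * v k (j k) A)" using \<pi> v0 by (simp add: sum_ennreal)
    also have "(\<Sum>j\<in>?J. \<pi> j * v k (j k) A) = measure (\<mu> k) A"
    proof -
      have "(\<Sum>j\<in>?J. \<pi> j * v k (j k) A) = (\<Sum>a\<in>L k. \<Sum>j | j \<in> ?J \<and> j k = a. \<pi> j * v k (j k) A)"
        using fin finJ by (intro sum.group[symmetric]) (auto simp: Pi_iff)
      also have "\<dots> = (\<Sum>a\<in>L k. (\<Sum>j | j \<in> ?J \<and> j k = a. \<pi> j) * v k a A)"
        by (intro sum.cong refl) (auto simp: sum_distrib_right)
      also have "\<dots> = (\<Sum>a\<in>L k. m k a * v k a A)" using marg by (intro sum.cong refl) (simp add: m_def)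
      also have "\<dots> = (\<Sum>a\<in>L k. measure (\<mu> k) (D k a \<inter> A))"
      proof (intro sum.cong refl)
        fix a
        have "measure (\<mu> k) (D k a \<inter> A) \<le> m k a" unfolding m_def using D A by (intro M.finite_measure_mono) auto
        then show "m k a * v k a A = measure (\<mu> k) (D k a \<inter> A)"
          using measure_nonneg[of "\<mu> k" "D k a \<inter> A"] by (cases "m k a = 0") (auto simp: v_def)
      qed
      also have "\<dots> = measure (\<mu> k) (\<Union>a\<in>L k. D k a \<inter> A)"
      proof (rule M.finite_measure_finite_Union[symmetric])
        show "disjoint_family_on (\<lambda>a. D k a \<inter> A) (L k)"
          using disj[of k] unfolding disjoint_family_on_def by blast
      qed (use fin D A in auto)
      also have "\<dots> = measure (\<mu> k) A"
      proof (rule M.finite_measure_eq_AE)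
        show "AE x in \<mu> k. x \<in> (\<Union>a\<in>L k. D k a \<inter> A) \<longleftrightarrow> x \<in> A" using full[of k] by eventually_elim auto
      qed (intro sets.finite_UN sets.Int fin D A)+
      finally show ?thesis .
    qed
    finally show "emeasure \<gamma> ?T = emeasure (\<mu> k) A" by (simp add: M.emeasure_eq_measure)
  qed
  have bound: "(\<integral>\<^sup>+x. f x \<partial>\<gamma>) \<le> ennreal (\<Sum>j\<in>?J. \<pi> j * b j)"
    if f: "f \<in> borel_measurable borel_prod" and b: "\<And>j. j \<in> ?J \<Longrightarrow> 0 \<le> b j"
      and le: "\<And>j x. j \<in> ?J \<Longrightarrow> x \<in> prod_set X \<Longrightarrow> (\<And>i. x $ i \<in> D i (j i)) \<Longrightarrow> f x \<le> ennreal (b j)" for f b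
  proof -
    have "ennreal (\<pi> j) * (\<integral>\<^sup>+x. W j x * f x \<partial>ref) \<le> ennreal (\<pi> j * b j)" if j: "j \<in> ?J" for j
    proof -
      have "(\<integral>\<^sup>+x. W j x * f x \<partial>ref) \<le> (\<integral>\<^sup>+x. W j x * ennreal (b j) \<partial>ref)"
      proof (rule nn_integral_mono)
        fix x assume x: "x \<in> space ref"
        show "W j x * f x \<le> W j x * ennreal (b j)"
        proof (cases "\<forall>i. x $ i \<in> D i (j i)")
          case True
          then show ?thesis using x by (intro mult_left_mono le j) (auto simp: space_ref)
        next
          case False
          then obtain i where "x $ i \<notin> D i (j i)" by blast
          then have "w i (j i) (x $ i) = 0" by (simp add: w_def)
          then have "W j x = 0" unfolding W_def by (intro prod_zero) auto
          then show ?thesis by simp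
        qed
      qed
      also have "\<dots> = (\<integral>\<^sup>+x. W j x \<partial>ref) * ennreal (b j)"
        using W_meas measurable_cong_sets[OF sets_ref refl] by (intro nn_integral_multc) blast
      finally have "ennreal (\<pi> j) * (\<integral>\<^sup>+x. W j x * f x \<partial>ref) \<le> (ennreal (\<pi> j) * (\<integral>\<^sup>+x. W j x \<partial>ref)) * ennreal (b j)"
        by (simp add: mult.assoc mult_left_mono)
      also have "\<dots> \<le> ennreal (\<pi> j) * ennreal (b j)" using W_int[OF j] by (rule mult_right_mono) simp
      also have "\<dots> = ennreal (\<pi> j * b j)" using \<pi>[OF j] b[OF j] by (simp add: ennreal_mult)
      finally show ?thesis .
    qed
    then have "(\<integral>\<^sup>+x. f x \<partial>\<gamma>) \<le> (\<Sum>j\<in>?J. ennreal (\<pi> j * b j))"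
      unfolding \<gamma>_int[OF f] by (intro sum_mono)
    also have "\<dots> = ennreal (\<Sum>j\<in>?J. \<pi> j * b j)" using \<pi> b by (intro sum_ennreal) auto
    finally show ?thesis .
  qed
  show thesis by (rule that[OF coupling]) (fact bound)
qed

text \<open>The discrete cost of a product of cells is the cost at a representative; it differs from \<open>c\<close> by less than
  \<open>\<delta>\<close> on these cells. One \<open>\<delta>\<close> is lost in the finite duality, one in the cost of the coupling and one in
  lowering the potentials to make them admissible for \<open>c\<close>.\<close>

lemma approximate_duality:
  assumes K: "\<And>i. compact (K i)" "\<And>i. K i \<subseteq> X i" "\<And>i. AE x in \<mu> i. x \<in> K i"
    and c: "continuous_on (prod_set X) c" "\<And>x. x \<in> prod_set X \<Longrightarrow> 0 \<le> c x" and "\<delta> > 0"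
  obtains \<phi> M where "\<And>i. \<phi> i \<in> borel_measurable (\<mu> i)" "\<And>i x. \<bar>\<phi> i x\<bar> \<le> M"
    "\<And>x. x \<in> prod_set K \<Longrightarrow> (\<Sum>i\<in>UNIV. \<phi> i (x $ i)) \<le> c x"
    "MOT0 X \<mu> c \<le> ereal ((\<Sum>i\<in>UNIV. \<integral>x. \<phi> i x \<partial>\<mu> i) + 3 * \<delta>)"
proof -
  have KX: "prod_set K \<subseteq> prod_set X" using K(2) by (auto simp: prod_set_def)
  have "uniformly_continuous_on (prod_set K) c"
    by (rule compact_uniformly_continuous[OF continuous_on_subset[OF c(1) KX] compact_prod_set[OF K(1)]])
  then obtain \<rho> where \<rho>: "\<rho> > 0"
    and unif: "\<And>x x'. x \<in> prod_set K \<Longrightarrow> x' \<in> prod_set K \<Longrightarrow> dist x' x < \<rho> \<Longrightarrow> dist (c x') (c x) < \<delta>"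
    unfolding uniformly_continuous_on_def using \<open>\<delta> > 0\<close> by meson
  \<comment> \<open>A mesh for which points in the same product of cells are at distance less than \<open>\<rho>\<close>.\<close>
  define s where "s = \<rho> / (real CARD('m) * (real DIM('a) + 1))"
  have s: "s > 0" using \<rho> by (simp add: s_def)
  define l where "l = grid_index s (Basis :: 'a set)"
  have l_dist: "dist x y < \<rho> / real CARD('m)" if "l x = l y" for x y
  proof -
    have "dist x y \<le> real DIM('a) * s"
      using s that unfolding l_def
      by (intro grid_index_dist) (auto simp: pairwise_def orthogonal_def inner_not_same_Basis)
    also have "\<dots> < (real DIM('a) + 1) * s" using s by simp
    also have "\<dots> = \<rho> / real CARD('m)"
    proof -
      have "t * (\<rho> / (n * t)) = \<rho> / n" if "t > 0" for t n :: real using that by simp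
      from this[of "real DIM('a) + 1"] show ?thesis by (simp add: s_def)
    qed
    finally show ?thesis .
  qed
  define L where "L i = l ` K i" for i
  define D where "D i a = K i \<inter> {x. l x = a}" for i a
  define m where "m i a = measure (\<mu> i) (D i a)" for i a
  have fin: "finite (L i)" for i
  proof -
    obtain b where b: "\<And>x. x \<in> K i \<Longrightarrow> norm x \<le> b" "b > 0"
      using compact_imp_bounded[OF K(1)[of i]] by (auto simp: bounded_pos)
    have "\<bar>(x - 0) \<bullet> e\<bar> \<le> b" if "x \<in> K i" "e \<in> Basis" for x e
      using b(1)[OF that(1)] Basis_le_norm[OF that(2), of x] by simp
    then show ?thesis unfolding L_def l_def using s b(2) by (intro grid_index_image(1)[where y = 0 and \<delta> = b]) auto
  qed
  have D_sets: "D i a \<in> sets (\<mu> i)" for i a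
  proof -
    have "D i a \<in> sets borel"
      unfolding D_def l_def using compact_imp_closed[OF K(1)] by (intro sets.Int grid_index_vimage_borel borel_closed) auto
    then have "X i \<inter> D i a \<in> sets (\<mu> i)" unfolding sets_marginal sets_restrict_space by (rule imageI)
    moreover have "X i \<inter> D i a = D i a" using K(2) by (auto simp: D_def)
    ultimately show ?thesis by simp
  qed
  have disj: "disjoint_family_on (D i) (L i)" for i by (auto simp: disjoint_family_on_def D_def)
  have Un: "(\<Union>a\<in>L i. D i a) = K i" for i by (auto simp: L_def D_def)
  have msum: "(\<Sum>a\<in>L i. m i a) = 1" for i
  proof -
    have "(\<Sum>a\<in>L i. m i a) = measure (\<mu> i) (\<Union>a\<in>L i. D i a)"
      unfolding m_def using fin D_sets disj by (intro M.finite_measure_finite_Union[symmetric]) auto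
    also have "\<dots> = 1"
    proof -
      have "(\<Union>a\<in>L i. D i a) \<in> sets (\<mu> i)" using fin D_sets by (intro sets.finite_UN) auto
      then show ?thesis using K(3)[of i] by (simp add: M.prob_eq_1 Un)
    qed
    finally show ?thesis .
  qed
  define rep where "rep j = (\<chi> i. SOME x. x \<in> K i \<and> l x = j i)" for j
  have rep: "rep j $ i \<in> K i \<and> l (rep j $ i) = j i" if j: "j \<in> Pi UNIV L" for j i
  proof -
    have "\<exists>x. x \<in> K i \<and> l x = j i" using j by (auto simp: Pi_iff L_def image_iff) metis
    from someI_ex[OF this] show ?thesis by (simp add: rep_def)
  qed
  have repK: "rep j \<in> prod_set K" if "j \<in> Pi UNIV L" for j using rep[OF that] by (simp add: prod_set_def)
  have close: "\<bar>c x - c (rep j)\<bar> < \<delta>" if j: "j \<in> Pi UNIV L" and x: "\<And>i. x $ i \<in> D i (j i)" for j x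
  proof -
    have "dist x (rep j) < real CARD('m) * (\<rho> / real CARD('m))"
      using x rep[OF j] by (intro dist_vec_less l_dist) (simp add: D_def)
    then have "dist x (rep j) < \<rho>" by simp
    moreover have "x \<in> prod_set K" using x by (auto simp: prod_set_def D_def)
    ultimately show ?thesis using unif[OF repK[OF j], of x] by (simp add: dist_real_def)
  qed
  have c0: "0 \<le> c (rep j)" if "j \<in> Pi UNIV L" for j using repK[OF that] KX by (intro c(2)) auto
  obtain \<pi> \<psi> where \<pi>: "\<And>j. j \<in> Pi UNIV L \<Longrightarrow> 0 \<le> \<pi> j"
    and \<pi>m: "\<And>i a. a \<in> L i \<Longrightarrow> (\<Sum>j | j \<in> Pi UNIV L \<and> j i = a. \<pi> j) = m i a"
    and \<psi>: "\<And>j. j \<in> Pi UNIV L \<Longrightarrow> (\<Sum>i\<in>UNIV. \<psi> i (j i)) \<le> c (rep j)"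
    and dual: "(\<Sum>j\<in>Pi UNIV L. \<pi> j * c (rep j)) \<le> (\<Sum>i\<in>UNIV. \<Sum>a\<in>L i. \<psi> i a * m i a) + \<delta>"
  proof (rule finite_transport_duality[of L m "\<lambda>j. c (rep j)" \<delta>])
    show "0 \<le> m i a" for i a by (simp add: m_def)
  qed (use fin msum c0 \<open>\<delta> > 0\<close> in auto)
  have \<pi>1: "(\<Sum>j\<in>Pi UNIV L. \<pi> j) = 1"
  proof -
    fix i :: 'm
    have "Pi UNIV L = PiE UNIV L" by (simp add: PiE_def)
    then have finJ: "finite (Pi UNIV L)" using fin by (simp add: finite_PiE)
    have "(\<Sum>j\<in>Pi UNIV L. \<pi> j) = (\<Sum>a\<in>L i. \<Sum>j | j \<in> Pi UNIV L \<and> j i = a. \<pi> j)"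
      using fin finJ by (intro sum.group[symmetric]) (auto simp: Pi_iff)
    also have "\<dots> = 1" using \<pi>m msum by simp
    finally show ?thesis .
  qed
  obtain \<gamma> where \<gamma>: "\<gamma> \<in> couplings X \<mu>"
    and \<gamma>_le: "(\<integral>\<^sup>+x. ennreal (c x) \<partial>\<gamma>) \<le> ennreal (\<Sum>j\<in>Pi UNIV L. \<pi> j * (c (rep j) + \<delta>))"
  proof (rule step_coupling[of L D \<pi>])
    show "AE x in \<mu> i. x \<in> (\<Union>a\<in>L i. D i a)" for i unfolding Un by (rule K(3))
    fix \<gamma> assume g: "\<gamma> \<in> couplings X \<mu>"
      and *: "\<And>f b. f \<in> borel_measurable borel_prod \<Longrightarrow> (\<And>j. j \<in> Pi UNIV L \<Longrightarrow> 0 \<le> b j) \<Longrightarrow>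
      (\<And>j x. j \<in> Pi UNIV L \<Longrightarrow> x \<in> prod_set X \<Longrightarrow> (\<And>i. x $ i \<in> D i (j i)) \<Longrightarrow> f x \<le> ennreal (b j)) \<Longrightarrow>
      (\<integral>\<^sup>+x. f x \<partial>\<gamma>) \<le> ennreal (\<Sum>j\<in>Pi UNIV L. \<pi> j * b j)"
    have "(\<integral>\<^sup>+x. ennreal (c x) \<partial>\<gamma>) \<le> ennreal (\<Sum>j\<in>Pi UNIV L. \<pi> j * (c (rep j) + \<delta>))"
    proof (rule *)
      show "(\<lambda>x. ennreal (c x)) \<in> borel_measurable borel_prod"
        using borel_measurable_continuous_on_restrict[OF c(1)] by measurable
      show "0 \<le> c (rep j) + \<delta>" if "j \<in> Pi UNIV L" for j using c0[OF that] \<open>\<delta> > 0\<close> by simp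
      fix j x assume j: "j \<in> Pi UNIV L" and x: "\<And>i. x $ i \<in> D i (j i)"
      have "c x \<le> c (rep j) + \<delta>" using close[OF j x] by (simp add: abs_less_iff)
      then show "ennreal (c x) \<le> ennreal (c (rep j) + \<delta>)" by (rule ennreal_leI)
    qed
    with g show thesis by (rule that)
  qed (use fin D_sets disj \<pi> \<pi>m in \<open>auto simp: m_def\<close>)
  \<comment> \<open>The optimal step potentials of the finite problem, lowered by \<open>\<delta>\<close> in total.\<close>
  define \<phi> where "\<phi> i x = (\<Sum>a\<in>L i. \<psi> i a * indicator (D i a) x) - \<delta> / real CARD('m)" for i x
  show thesis
  proof (rule that[of \<phi> "(\<Sum>i\<in>UNIV. \<Sum>a\<in>L i. \<bar>\<psi> i a\<bar>) + \<delta>"])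
    show "\<phi> i \<in> borel_measurable (\<mu> i)" for i
      unfolding \<phi>_def using D_sets by measurable
    show "\<bar>\<phi> i x\<bar> \<le> (\<Sum>i\<in>UNIV. \<Sum>a\<in>L i. \<bar>\<psi> i a\<bar>) + \<delta>" for i x
    proof -
      have "\<bar>\<Sum>a\<in>L i. \<psi> i a * indicator (D i a) x\<bar> \<le> (\<Sum>a\<in>L i. \<bar>\<psi> i a * indicator (D i a) x\<bar>)" by (rule sum_abs)
      also have "\<dots> \<le> (\<Sum>a\<in>L i. \<bar>\<psi> i a\<bar>)" by (intro sum_mono) (auto simp: indicator_def)
      also have "\<dots> \<le> (\<Sum>i\<in>UNIV. \<Sum>a\<in>L i. \<bar>\<psi> i a\<bar>)"
        by (rule member_le_sum) (auto intro: sum_nonneg)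
      finally have "\<bar>\<Sum>a\<in>L i. \<psi> i a * indicator (D i a) x\<bar> \<le> (\<Sum>i\<in>UNIV. \<Sum>a\<in>L i. \<bar>\<psi> i a\<bar>)" .
      moreover have "0 \<le> \<delta> / real CARD('m)" "\<delta> / real CARD('m) \<le> \<delta>"
        using \<open>\<delta> > 0\<close> by (auto simp: divide_le_eq Suc_le_eq)
      ultimately show ?thesis unfolding \<phi>_def by linarith
    qed
    show "(\<Sum>i\<in>UNIV. \<phi> i (x $ i)) \<le> c x" if x: "x \<in> prod_set K" for x
    proof -
      define j where "j i = l (x $ i)" for i
      have xK: "x $ i \<in> K i" for i using x by (simp add: prod_set_def)
      have j: "j \<in> Pi UNIV L" using xK by (auto simp: j_def L_def)
      have xD: "x $ i \<in> D i (j i)" for i using xK by (simp add: D_def j_def)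
      have "(\<Sum>a\<in>L i. \<psi> i a * indicator (D i a) (x $ i)) = \<psi> i (j i)" for i
      proof -
        have "(\<Sum>a\<in>L i. \<psi> i a * indicator (D i a) (x $ i)) = (\<Sum>a\<in>L i. if a = j i then \<psi> i a else 0)"
          using xK by (intro sum.cong refl) (auto simp: D_def j_def indicator_def)
        also have "\<dots> = \<psi> i (j i)" using fin j by (auto simp: Pi_iff)
        finally show ?thesis .
      qed
      then have "(\<Sum>i\<in>UNIV. \<phi> i (x $ i)) = (\<Sum>i\<in>UNIV. \<psi> i (j i)) - \<delta>"
        by (simp add: \<phi>_def sum_subtractf)
      also have "\<dots> \<le> c (rep j) - \<delta>" using \<psi>[OF j] by simp
      also have "\<dots> \<le> c x" using close[OF j xD] by (simp add: abs_less_iff)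
      finally show ?thesis .
    qed
    have int: "(\<integral>x. \<phi> i x \<partial>\<mu> i) = (\<Sum>a\<in>L i. \<psi> i a * m i a) - \<delta> / real CARD('m)" for i
    proof -
      have I: "integrable (\<mu> i) (\<lambda>x. \<psi> i a * indicator (D i a) x)" for a
        using D_sets by (intro integrable_mult_right M.integrable_const_bound[where B = 1]) auto
      have "(\<integral>x. \<phi> i x \<partial>\<mu> i) = (\<integral>x. (\<Sum>a\<in>L i. \<psi> i a * indicator (D i a) x) \<partial>\<mu> i) - (\<integral>x. \<delta> / real CARD('m) \<partial>\<mu> i)"
        unfolding \<phi>_def using I by (intro Bochner_Integration.integral_diff Bochner_Integration.integrable_sum) auto
      also have "(\<integral>x. (\<Sum>a\<in>L i. \<psi> i a * indicator (D i a) x) \<partial>\<mu> i) = (\<Sum>a\<in>L i. \<integral>x. \<psi> i a * indicator (D i a) x \<partial>\<mu> i)"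
        using I by (intro Bochner_Integration.integral_sum) auto
      also have "\<dots> = (\<Sum>a\<in>L i. \<psi> i a * m i a)"
        using sets.sets_into_space[OF D_sets] by (simp add: m_def Int_absorb2)
      finally show ?thesis by (simp add: M.prob_space)
    qed
    have "(\<Sum>j\<in>Pi UNIV L. \<pi> j * (c (rep j) + \<delta>)) = (\<Sum>j\<in>Pi UNIV L. \<pi> j * c (rep j)) + \<delta>"
      using \<pi>1 by (simp add: algebra_simps sum.distrib sum_distrib_left[symmetric])
    also have "\<dots> \<le> (\<Sum>i\<in>UNIV. \<Sum>a\<in>L i. \<psi> i a * m i a) + 2 * \<delta>" using dual by simp
    also have "\<dots> = (\<Sum>i\<in>UNIV. \<integral>x. \<phi> i x \<partial>\<mu> i) + 3 * \<delta>" by (simp add: int sum_subtractf)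
    finally have le: "(\<Sum>j\<in>Pi UNIV L. \<pi> j * (c (rep j) + \<delta>)) \<le> (\<Sum>i\<in>UNIV. \<integral>x. \<phi> i x \<partial>\<mu> i) + 3 * \<delta>" .
    have nn: "0 \<le> (\<Sum>j\<in>Pi UNIV L. \<pi> j * (c (rep j) + \<delta>))"
      using \<pi> c0 \<open>\<delta> > 0\<close> by (intro sum_nonneg mult_nonneg_nonneg add_nonneg_nonneg) auto
    have "MOT0 X \<mu> c \<le> enn2ereal (\<integral>\<^sup>+x. ennreal (c x) \<partial>\<gamma>)"
      unfolding MOT0_def using \<gamma> by (rule INF_lower)
    also have "\<dots> \<le> enn2ereal (ennreal (\<Sum>j\<in>Pi UNIV L. \<pi> j * (c (rep j) + \<delta>)))"
      using \<gamma>_le by (simp add: less_eq_ennreal.rep_eq)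
    also have "\<dots> = ereal (\<Sum>j\<in>Pi UNIV L. \<pi> j * (c (rep j) + \<delta>))" using nn by (rule enn2ereal_ennreal)
    also have "\<dots> \<le> ereal ((\<Sum>i\<in>UNIV. \<integral>x. \<phi> i x \<partial>\<mu> i) + 3 * \<delta>)" using le by simp
    finally show "MOT0 X \<mu> c \<le> ereal ((\<Sum>i\<in>UNIV. \<integral>x. \<phi> i x \<partial>\<mu> i) + 3 * \<delta>)" .
  qed
qed

end

section \<open>The entropic lower bound\<close>

lemma exp_power_bound: "exp (- real n) * (real n + 1) ^ k \<le> (2 * real (Suc k)) ^ k * exp (- (1 / 2)) ^ n"
proof -
  define t where "t = 2 * real (Suc k)"
  have t: "t \<ge> 1" by (simp add: t_def)
  \<comment> \<open>The constant \<open>t = 2 (k + 1)\<close> leaves half of the decay of \<open>exp (- n)\<close> after \<open>1 + n / t \<le> exp (n / t)\<close>.\<close>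
  have "real n + 1 \<le> t * (1 + real n / t)" using t by (simp add: field_simps)
  also have "\<dots> \<le> t * exp (real n / t)" using t by (intro mult_left_mono exp_ge_add_one_self) auto
  finally have "(real n + 1) ^ k \<le> (t * exp (real n / t)) ^ k" by (intro power_mono) auto
  also have "\<dots> = t ^ k * exp (real k * (real n / t))"
    by (simp only: power_mult_distrib exp_of_nat_mult)
  also have "\<dots> \<le> t ^ k * exp (real n / 2)"
  proof -
    have "real k * (real n / t) \<le> real n / 2"
      unfolding t_def by (simp add: field_simps)
    then show ?thesis using t by (intro mult_left_mono) auto
  qed
  finally have "exp (- real n) * (real n + 1) ^ k \<le> exp (- real n) * (t ^ k * exp (real n / 2))"
    by (rule mult_left_mono) simp
  also have "\<dots> = t ^ k * (exp (- real n) * exp (real n / 2))" by simp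
  also have "exp (- real n) * exp (real n / 2) = exp (- (1 / 2)) ^ n"
    by (simp add: exp_add[symmetric] exp_of_nat_mult[symmetric])
  finally show ?thesis by (simp add: t_def)
qed

text \<open>Sum over the layers \<open>n \<epsilon> \<le> E < (n + 1) \<epsilon>\<close>; the measure of \<open>{E \<le> (n + 1) \<epsilon>}\<close> is bounded with
  \<open>s = sqrt ((n + 1) \<epsilon>)\<close>, trivially when \<open>s > 1\<close> because \<open>C \<ge> 1\<close>.\<close>

lemma nn_integral_exp_le:
  fixes E :: "'a \<Rightarrow> real"
  assumes "prob_space Q" "E \<in> borel_measurable Q" "AE x in Q. x \<in> K \<and> 0 \<le> E x" and "C \<ge> 1"
    and sub: "\<And>s. 0 < s \<Longrightarrow> s \<le> 1 \<Longrightarrow>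
      \<exists>T\<in>sets Q. {x\<in>space Q. x \<in> K \<and> E x \<le> s\<^sup>2} \<subseteq> T \<and> emeasure Q T \<le> ennreal (C * s ^ k)"
    and "\<epsilon> > 0"
  shows "(\<integral>\<^sup>+x. ennreal (exp (- E x / \<epsilon>)) \<partial>Q) \<le>
    ennreal (C * ((2 * real (Suc k)) ^ k / (1 - exp (- (1 / 2)))) * sqrt \<epsilon> ^ k)"
proof -
  interpret Q: prob_space Q by fact
  define S where "S n = {x\<in>space Q. E x \<le> (real n + 1) * \<epsilon>}" for n :: nat
  have S: "S n \<in> sets Q" for n unfolding S_def using assms(2) by measurable
  have S_em: "emeasure Q (S n) \<le> ennreal (C * ((real n + 1) ^ k * sqrt \<epsilon> ^ k))" for n
  proof -
    define s where "s = sqrt ((real n + 1) * \<epsilon>)"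
    have s: "s > 0" "s\<^sup>2 = (real n + 1) * \<epsilon>" using \<open>\<epsilon> > 0\<close> by (auto simp: s_def)
    have "emeasure Q (S n) \<le> ennreal (C * s ^ k)"
    proof (cases "s \<le> 1")
      case True
      then obtain T where T: "T \<in> sets Q" "{x\<in>space Q. x \<in> K \<and> E x \<le> s\<^sup>2} \<subseteq> T" "emeasure Q T \<le> ennreal (C * s ^ k)"
        using sub[OF s(1)] by blast
      have "AE x in Q. x \<in> S n \<longrightarrow> x \<in> T"
        by (rule AE_mp[OF assms(3)], intro AE_I2) (use T(2) s(2) in \<open>auto simp: S_def\<close>)
      then have "emeasure Q (S n) \<le> emeasure Q T" using T(1) by (intro emeasure_mono_AE)
      then show ?thesis using T(3) by (rule order_trans)
    next
      case False
      then have "1 \<le> s ^ k" by (intro one_le_power) simp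
      then have "1 \<le> C * s ^ k" using \<open>C \<ge> 1\<close> mult_mono[of 1 C 1 "s ^ k"] by simp
      then have "ennreal 1 \<le> ennreal (C * s ^ k)" by (rule ennreal_leI)
      then show ?thesis using Q.emeasure_le_1[of "S n"] by (metis ennreal_1 order_trans)
    qed
    also have "s ^ k \<le> ((real n + 1) * sqrt \<epsilon>) ^ k"
    proof (rule power_mono)
      have "sqrt (real n + 1) \<le> real n + 1"
        by (rule real_le_lsqrt) (auto simp: power2_eq_square algebra_simps)
      then show "s \<le> (real n + 1) * sqrt \<epsilon>"
        using \<open>\<epsilon> > 0\<close> by (simp add: s_def real_sqrt_mult mult_right_mono)
    qed (use s in simp)
    finally show ?thesis using \<open>C \<ge> 1\<close> by (simp add: power_mult_distrib mult_left_mono ennreal_leI)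
  qed
  have "(\<integral>\<^sup>+x. ennreal (exp (- E x / \<epsilon>)) \<partial>Q) \<le> (\<integral>\<^sup>+x. (\<Sum>n. ennreal (exp (- real n)) * indicator (S n) x) \<partial>Q)"
  proof (rule nn_integral_mono_AE)
    show "AE x in Q. ennreal (exp (- E x / \<epsilon>)) \<le> (\<Sum>n. ennreal (exp (- real n)) * indicator (S n) x)"
      using assms(3) AE_space
    proof eventually_elim
      case (elim x)
      define n where "n = nat \<lfloor>E x / \<epsilon>\<rfloor>"
      have n: "real n \<le> E x / \<epsilon>" "E x / \<epsilon> < real n + 1"
      proof -
        have "0 \<le> E x / \<epsilon>" using elim \<open>\<epsilon> > 0\<close> by simp
        then have "real n = of_int \<lfloor>E x / \<epsilon>\<rfloor>" by (simp add: n_def)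
        then show "real n \<le> E x / \<epsilon>" "E x / \<epsilon> < real n + 1" by linarith+
      qed
      have "x \<in> S n" using n(2) elim \<open>\<epsilon> > 0\<close> by (simp add: S_def pos_divide_less_eq less_imp_le)
      then have "ennreal (exp (- E x / \<epsilon>)) \<le> ennreal (exp (- real n)) * indicator (S n) x"
        using n(1) by (simp add: ennreal_leI)
      also have "\<dots> = (\<Sum>l\<in>{n}. ennreal (exp (- real l)) * indicator (S l) x)"
        by (simp only: sum.insert[OF finite.emptyI] sum.empty empty_iff not_False_eq_True add_0_right)
      also have "\<dots> \<le> (\<Sum>l. ennreal (exp (- real l)) * indicator (S l) x)"
        by (rule sum_le_suminf) auto
      finally show ?case .
    qed
  qed
  also have "\<dots> = (\<Sum>n. \<integral>\<^sup>+x. ennreal (exp (- real n)) * indicator (S n) x \<partial>Q)"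
    by (intro nn_integral_suminf borel_measurable_times_ennreal borel_measurable_indicator borel_measurable_const S)
  also have "\<dots> = (\<Sum>n. ennreal (exp (- real n)) * emeasure Q (S n))"
    using S by (simp add: nn_integral_cmult_indicator)
  also have "\<dots> \<le> (\<Sum>n. ennreal (C * sqrt \<epsilon> ^ k * (2 * real (Suc k)) ^ k * exp (- (1 / 2)) ^ n))"
  proof (intro suminf_le summableI)
    fix n
    have "ennreal (exp (- real n)) * emeasure Q (S n) \<le> ennreal (exp (- real n)) * ennreal (C * ((real n + 1) ^ k * sqrt \<epsilon> ^ k))"
      by (rule mult_left_mono[OF S_em]) simp
    also have "\<dots> = ennreal (C * sqrt \<epsilon> ^ k * (exp (- real n) * (real n + 1) ^ k))"
      by (simp add: ennreal_mult'[symmetric] mult_ac)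
    also have "\<dots> \<le> ennreal (C * sqrt \<epsilon> ^ k * ((2 * real (Suc k)) ^ k * exp (- (1 / 2)) ^ n))"
      using \<open>C \<ge> 1\<close> \<open>\<epsilon> > 0\<close> by (intro ennreal_leI mult_left_mono[OF exp_power_bound]) simp
    finally show "ennreal (exp (- real n)) * emeasure Q (S n) \<le> ennreal (C * sqrt \<epsilon> ^ k * (2 * real (Suc k)) ^ k * exp (- (1 / 2)) ^ n)"
      by (simp add: mult.assoc)
  qed
  also have "\<dots> = ennreal (\<Sum>n. C * sqrt \<epsilon> ^ k * (2 * real (Suc k)) ^ k * exp (- (1 / 2)) ^ n)"
    using \<open>C \<ge> 1\<close> \<open>\<epsilon> > 0\<close> by (intro suminf_ennreal2 summable_mult summable_geometric) auto
  also have "(\<Sum>n. C * sqrt \<epsilon> ^ k * (2 * real (Suc k)) ^ k * exp (- (1 / 2)) ^ n) =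
      C * sqrt \<epsilon> ^ k * (2 * real (Suc k)) ^ k * (1 / (1 - exp (- (1 / 2))))"
    by (subst suminf_mult) (auto simp: summable_geometric suminf_geometric)
  finally show ?thesis by (simp add: mult_ac)
qed

text \<open>With \<open>b = exp (- E / \<epsilon>) / Z\<close> this is \<open>r ln b + r - b \<le> r ln r\<close>, that is \<open>ln u \<le> u - 1\<close> at \<open>u = b / r\<close>.\<close>

lemma gibbs_pointwise:
  fixes r E Z \<epsilon> :: real
  assumes "r \<ge> 0" "Z > 0"
  shows "- (r * E / \<epsilon>) - r * ln Z + r - exp (- E / \<epsilon>) / Z \<le> r * ln r"
proof (cases "r = 0")
  case True
  then show ?thesis using assms(2) by simp
next
  case False
  then have r: "r > 0" using assms(1) by simp
  define b where "b = exp (- E / \<epsilon>) / Z"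
  have b: "b > 0" using assms(2) by (simp add: b_def)
  have lb: "ln b = - E / \<epsilon> - ln Z" using assms(2) by (simp add: b_def ln_div)
  have "ln (b / r) \<le> b / r - 1" using b r by (intro ln_le_minus_one) simp
  then have "r * ln (b / r) \<le> r * (b / r - 1)" using r by (intro mult_left_mono) auto
  then have "r * (ln b - ln r) \<le> b - r" using b r by (simp add: ln_div algebra_simps)
  then show ?thesis unfolding lb b_def[symmetric] by (simp add: algebra_simps)
qed

context marginals
begin

text \<open>The Gibbs inequality in integrated form, with \<open>Z\<close> an upper bound for the partition function of
  the excess \<open>c x - \<Sum>\<^sub>i \<phi>\<^sub>i (x\<^sub>i)\<close>.\<close>

lemma entropic_lower_bound:
  assumes \<gamma>: "\<gamma> \<in> couplings X \<mu>"
    and K: "\<And>i. compact (K i)" "\<And>i. K i \<subseteq> X i" "\<And>i. AE x in \<mu> i. x \<in> K i"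
    and c: "continuous_on (prod_set X) c" "\<And>x. x \<in> prod_set X \<Longrightarrow> 0 \<le> c x"
    and \<phi>: "\<And>i. \<phi> i \<in> borel_measurable (\<mu> i)" "\<And>i x. \<bar>\<phi> i x\<bar> \<le> M"
    and Z: "Z > 0" "(\<integral>\<^sup>+x. ennreal (exp (- (c x - (\<Sum>i\<in>UNIV. \<phi> i (x $ i))) / \<epsilon>)) \<partial>ref) \<le> ennreal Z"
    and "\<epsilon> > 0"
  shows "ereal ((\<Sum>i\<in>UNIV. \<integral>x. \<phi> i x \<partial>\<mu> i) - \<epsilon> * ln Z) \<le>
    enn2ereal (\<integral>\<^sup>+x. ennreal (c x) \<partial>\<gamma>) + ereal \<epsilon> * Ent \<gamma> ref"
proof -
  interpret g: prob_space \<gamma> by (rule couplingsD(1)[OF \<gamma>])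
  interpret R: prob_space ref by (rule prob_space_ref)
  define \<rho> where "\<rho> x = enn2real (RN_deriv ref \<gamma> x)" for x
  define E where "E x = c x - (\<Sum>i\<in>UNIV. \<phi> i (x $ i))" for x
  show ?thesis
  proof (cases "absolutely_continuous ref \<gamma> \<and> integrable ref (\<lambda>x. \<rho> x * ln (\<rho> x))")
    case False
    then have "Ent \<gamma> ref = \<infinity>" by (auto simp: Ent_def Let_def \<rho>_def)
    moreover have "enn2ereal (\<integral>\<^sup>+x. ennreal (c x) \<partial>\<gamma>) \<noteq> - \<infinity>"
      using enn2ereal_nonneg[of "\<integral>\<^sup>+x. ennreal (c x) \<partial>\<gamma>"] by auto
    ultimately show ?thesis using \<open>\<epsilon> > 0\<close> by (simp add: ereal_mult_infty)
  next
    case True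
    then have Ent: "Ent \<gamma> ref = ereal (\<integral>x. \<rho> x * ln (\<rho> x) \<partial>ref)" and ac: "absolutely_continuous ref \<gamma>"
      and int_ent: "integrable ref (\<lambda>x. \<rho> x * ln (\<rho> x))"
      by (auto simp: Ent_def Let_def \<rho>_def)
    have sets: "sets \<gamma> = sets ref" using couplingsD(2)[OF \<gamma>] sets_ref by simp
    have m_eq: "borel_measurable \<gamma> = borel_measurable ref" by (rule measurable_cong_sets[OF sets refl])
    have \<rho>_meas: "\<rho> \<in> borel_measurable ref" unfolding \<rho>_def by measurable
    have \<rho>0: "\<rho> x \<ge> 0" for x by (simp add: \<rho>_def)
    have "AE x in ref. RN_deriv ref \<gamma> x \<noteq> \<infinity>"
      by (rule R.RN_deriv_finite) (use ac sets g.sigma_finite_measure_axioms in auto)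
    then have "AE x in ref. ennreal (\<rho> x) = RN_deriv ref \<gamma> x"
      by eventually_elim (simp add: \<rho>_def less_top)
    then have "density ref (\<lambda>x. ennreal (\<rho> x)) = density ref (RN_deriv ref \<gamma>)"
      using \<rho>_meas by (intro density_cong) auto
    also have "\<dots> = \<gamma>" using ac sets by (intro R.density_RN_deriv) auto
    finally have dens: "\<gamma> = density ref (\<lambda>x. ennreal (\<rho> x))" by simp
    have c_meas: "c \<in> borel_measurable \<gamma>"
      using borel_measurable_continuous_on_restrict[OF c(1)] measurable_cong_sets[OF couplingsD(2)[OF \<gamma>] refl] by blast
    have KX: "prod_set K \<subseteq> prod_set X" using K(2) by (auto simp: prod_set_def)
    \<comment> \<open>Only the values on the product of the compact sets matter, and there \<open>c\<close> is bounded.\<close>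
    have "bounded (c ` prod_set K)"
      by (rule compact_imp_bounded[OF compact_continuous_image[OF continuous_on_subset[OF c(1) KX] compact_prod_set[OF K(1)]]])
    then obtain Mc where "\<forall>y\<in>c ` prod_set K. norm y \<le> Mc" unfolding bounded_iff by blast
    then have Mc: "norm (c x) \<le> Mc" if "x \<in> prod_set K" for x using that by blast
    have "AE x in \<gamma>. \<forall>i. x $ i \<in> K i" using \<gamma> K(3) by (rule AE_coupling)
    then have "AE x in \<gamma>. norm (c x) \<le> Mc"
    proof eventually_elim
      case (elim x)
      then have "x \<in> prod_set K" by (simp add: prod_set_def)
      then show ?case by (rule Mc)
    qed
    then have c_int: "integrable \<gamma> c" using c_meas by (intro g.integrable_const_bound)
    note \<phi>_int = integral_coupling[OF \<gamma> \<phi>(1) \<phi>(2)]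
    have E_int: "integrable \<gamma> E" unfolding E_def using c_int \<phi>_int(1) by auto
    have E_eq: "(\<integral>x. E x \<partial>\<gamma>) = (\<integral>x. c x \<partial>\<gamma>) - (\<Sum>i\<in>UNIV. \<integral>x. \<phi> i x \<partial>\<mu> i)"
      unfolding E_def using c_int \<phi>_int by (simp add: Bochner_Integration.integral_diff Bochner_Integration.integral_sum)
    have c_nn: "(\<integral>\<^sup>+x. ennreal (c x) \<partial>\<gamma>) = ennreal (\<integral>x. c x \<partial>\<gamma>)" and c_nonneg: "0 \<le> (\<integral>x. c x \<partial>\<gamma>)"
    proof -
      have "AE x in \<gamma>. 0 \<le> c x" using couplingsD(3)[OF \<gamma>] c(2) by (intro AE_I2) auto
      then show "(\<integral>\<^sup>+x. ennreal (c x) \<partial>\<gamma>) = ennreal (\<integral>x. c x \<partial>\<gamma>)" "0 \<le> (\<integral>x. c x \<partial>\<gamma>)"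
        using c_int by (auto intro: nn_integral_eq_integral integral_nonneg_AE)
    qed
    have E_meas: "E \<in> borel_measurable ref" using borel_measurable_integrable[OF E_int] unfolding m_eq .
    have AE0: "AE x in ref. 0 \<le> \<rho> x" using \<rho>0 by simp
    have change: "integrable ref (\<lambda>x. \<rho> x * f x)" "(\<integral>x. \<rho> x * f x \<partial>ref) = (\<integral>x. f x \<partial>\<gamma>)"
      if f: "integrable \<gamma> f" for f :: "'a ^ 'm \<Rightarrow> real"
    proof -
      have fm: "f \<in> borel_measurable ref" using borel_measurable_integrable[OF f] unfolding m_eq .
      have "integrable (density ref (\<lambda>x. ennreal (\<rho> x))) f" using f by (simp only: dens[symmetric])
      then show "integrable ref (\<lambda>x. \<rho> x * f x)"
        by (simp only: integrable_density[OF fm \<rho>_meas AE0] real_scaleR_def)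
      show "(\<integral>x. \<rho> x * f x \<partial>ref) = (\<integral>x. f x \<partial>\<gamma>)"
        using integral_density[OF fm \<rho>_meas AE0] by (simp only: dens[symmetric] real_scaleR_def)
    qed
    note \<rho>E = change[OF E_int]
    have \<rho>1: "integrable ref \<rho>" "(\<integral>x. \<rho> x \<partial>ref) = 1"
      using change[of "\<lambda>x. 1"] g.prob_space by simp_all
    define e where "e x = exp (- E x / \<epsilon>)" for x
    have e0: "0 \<le> e x" for x by (simp add: e_def)
    have e_meas: "e \<in> borel_measurable ref" unfolding e_def using E_meas by measurable
    have e_nn: "(\<integral>\<^sup>+x. ennreal (e x) \<partial>ref) \<le> ennreal Z" using Z(2) by (simp add: e_def E_def)
    have e_int: "integrable ref e"
      using e_meas order.strict_trans1[OF e_nn ennreal_less_top]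
      by (intro integrableI_nonneg) (auto simp: e0)
    have e_le: "(\<integral>x. e x \<partial>ref) \<le> Z"
    proof -
      have "(\<integral>\<^sup>+x. ennreal (e x) \<partial>ref) = ennreal (\<integral>x. e x \<partial>ref)"
        using e_int by (intro nn_integral_eq_integral) (auto simp: e0)
      then show ?thesis using e_nn Z(1) by simp
    qed
    have "(\<integral>x. - (\<rho> x * E x / \<epsilon>) - \<rho> x * ln Z + \<rho> x - e x / Z \<partial>ref) \<le> (\<integral>x. \<rho> x * ln (\<rho> x) \<partial>ref)"
    proof (rule integral_mono)
      show "- (\<rho> x * E x / \<epsilon>) - \<rho> x * ln Z + \<rho> x - e x / Z \<le> \<rho> x * ln (\<rho> x)" for x
        unfolding e_def using \<rho>0 Z(1) by (rule gibbs_pointwise)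
    qed (use \<rho>E(1) \<rho>1(1) e_int int_ent in auto)
    moreover have "(\<integral>x. - (\<rho> x * E x / \<epsilon>) - \<rho> x * ln Z + \<rho> x - e x / Z \<partial>ref) =
        - ((\<integral>x. E x \<partial>\<gamma>) / \<epsilon>) - ln Z + 1 - (\<integral>x. e x \<partial>ref) / Z"
      using \<rho>E \<rho>1 e_int by simp
    moreover have "(\<integral>x. e x \<partial>ref) / Z \<le> 1" using e_le Z(1) by simp
    ultimately have "- ((\<integral>x. E x \<partial>\<gamma>) / \<epsilon>) - ln Z \<le> (\<integral>x. \<rho> x * ln (\<rho> x) \<partial>ref)" by linarith
    then have "\<epsilon> * (- ((\<integral>x. E x \<partial>\<gamma>) / \<epsilon>) - ln Z) \<le> \<epsilon> * (\<integral>x. \<rho> x * ln (\<rho> x) \<partial>ref)"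
      using \<open>\<epsilon> > 0\<close> by (intro mult_left_mono) auto
    then have "- (\<integral>x. E x \<partial>\<gamma>) - \<epsilon> * ln Z \<le> \<epsilon> * (\<integral>x. \<rho> x * ln (\<rho> x) \<partial>ref)"
      using \<open>\<epsilon> > 0\<close> by (simp add: algebra_simps)
    then have "(\<Sum>i\<in>UNIV. \<integral>x. \<phi> i x \<partial>\<mu> i) - \<epsilon> * ln Z \<le> (\<integral>x. c x \<partial>\<gamma>) + \<epsilon> * (\<integral>x. \<rho> x * ln (\<rho> x) \<partial>ref)"
      unfolding E_eq by linarith
    then show ?thesis using c_nonneg by (simp add: Ent c_nn enn2ereal_ennreal)
  qed
qed

lemma sublevel_bound_compact:
  assumes "compact A" and loc: "\<And>x. x \<in> A \<Longrightarrow> \<exists>N C. open N \<and> x \<in> N \<and> sublevel_bound ref c k (N \<inter> A) C"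
  obtains C where "C \<ge> 1" "sublevel_bound ref c k A C"
proof -
  obtain N C where NC: "\<And>x. x \<in> A \<Longrightarrow> open (N x) \<and> x \<in> N x \<and> sublevel_bound ref c k (N x \<inter> A) (C x)"
    using loc by metis
  obtain F where F: "F \<subseteq> A" "finite F" "A \<subseteq> (\<Union>x\<in>F. N x)"
    using compactE_image[OF assms(1), of A N] NC by blast
  have C0: "C z \<ge> 0" if "z \<in> F" for z using NC F(1) that by (auto simp: sublevel_bound_def)
  have "sublevel_bound ref c k A ((\<Sum>z\<in>F. C z) + 1)"
    unfolding sublevel_bound_def
  proof (intro conjI allI impI)
    show "0 \<le> (\<Sum>z\<in>F. C z) + 1" using C0 by (simp add: sum_nonneg add_nonneg_nonneg)
    fix s :: real and S
    assume s: "0 < s" "s \<le> 1" and SA: "S \<subseteq> A"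
      and S: "\<forall>x\<in>S. \<forall>x'\<in>S. \<forall>q. cost_gap c q x x' \<le> 2 * s\<^sup>2"
    have "\<exists>T. T \<in> sets ref \<and> S \<inter> N z \<subseteq> T \<and> emeasure ref T \<le> ennreal (C z * s ^ k)" if z: "z \<in> F" for z
    proof -
      have "sublevel_bound ref c k (N z \<inter> A) (C z)" using NC F(1) z by blast
      moreover have "S \<inter> N z \<subseteq> N z \<inter> A" using SA by blast
      moreover have "\<forall>x\<in>S \<inter> N z. \<forall>x'\<in>S \<inter> N z. \<forall>q. cost_gap c q x x' \<le> 2 * s\<^sup>2" using S by blast
      ultimately show ?thesis using s unfolding sublevel_bound_def by blast
    qed
    then have "\<forall>z\<in>F. \<exists>T. T \<in> sets ref \<and> S \<inter> N z \<subseteq> T \<and> emeasure ref T \<le> ennreal (C z * s ^ k)"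
      by (rule ballI)
    from bchoice[OF this] obtain T where
      T': "\<forall>z\<in>F. T z \<in> sets ref \<and> S \<inter> N z \<subseteq> T z \<and> emeasure ref (T z) \<le> ennreal (C z * s ^ k)"
      by (elim exE)
    note T = bspec[OF T']
    show "\<exists>T\<in>sets ref. S \<subseteq> T \<and> emeasure ref T \<le> ennreal (((\<Sum>z\<in>F. C z) + 1) * s ^ k)"
    proof (intro bexI[of _ "\<Union>z\<in>F. T z"] conjI)
      show "(\<Union>z\<in>F. T z) \<in> sets ref" using F(2) T by (intro sets.finite_UN) auto
      show "S \<subseteq> (\<Union>z\<in>F. T z)"
      proof
        fix x assume x: "x \<in> S"
        then obtain z where z: "z \<in> F" "x \<in> N z" using F(3) SA by blast
        then have "x \<in> T z" using T[OF z(1)] x by blast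
        then show "x \<in> (\<Union>z\<in>F. T z)" using z(1) by blast
      qed
      have "emeasure ref (\<Union>z\<in>F. T z) \<le> (\<Sum>z\<in>F. emeasure ref (T z))"
        using F(2) T by (intro emeasure_subadditive_finite) auto
      also have "\<dots> \<le> (\<Sum>z\<in>F. ennreal (C z * s ^ k))" using T by (intro sum_mono) auto
      also have "\<dots> = ennreal ((\<Sum>z\<in>F. C z) * s ^ k)"
        using C0 s by (subst sum_ennreal) (auto simp: sum_distrib_right)
      also have "\<dots> \<le> ennreal (((\<Sum>z\<in>F. C z) + 1) * s ^ k)"
        using s by (intro ennreal_leI mult_right_mono) auto
      finally show "emeasure ref (\<Union>z\<in>F. T z) \<le> ennreal (((\<Sum>z\<in>F. C z) + 1) * s ^ k)" .
    qed
  qed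
  moreover have "1 \<le> (\<Sum>z\<in>F. C z) + 1" using C0 by (simp add: sum_nonneg)
  ultimately show thesis using that by blast
qed

end

text \<open>Exchanging blocks does not change the total of the potentials at the two points, and the excess
  is nonnegative at the two exchanged points.\<close>

lemma excess_inequality:
  fixes \<phi> :: "'m::finite \<Rightarrow> 'a \<Rightarrow> real" and c :: "'a ^ 'm \<Rightarrow> real"
  assumes "\<And>x. x \<in> prod_set K \<Longrightarrow> (\<Sum>i\<in>UNIV. \<phi> i (x $ i)) \<le> c x" and x: "x \<in> prod_set K" "x' \<in> prod_set K"
  shows "cost_gap c q x x' \<le>
    (c x - (\<Sum>i\<in>UNIV. \<phi> i (x $ i))) + (c x' - (\<Sum>i\<in>UNIV. \<phi> i (x' $ i)))"
proof -
  have s: "swap_coords q x x' \<in> prod_set K" for q using x by (rule swap_coords_in_prod_set)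
  have "(\<Sum>i\<in>UNIV. \<phi> i (swap_coords q x x' $ i)) + (\<Sum>i\<in>UNIV. \<phi> i (swap_coords (- q) x x' $ i)) =
      (\<Sum>i\<in>UNIV. \<phi> i (x $ i)) + (\<Sum>i\<in>UNIV. \<phi> i (x' $ i))"
    unfolding sum.distrib[symmetric] by (intro sum.cong) (auto simp: swap_coords_def)
  then show ?thesis using assms(1)[OF s, of q] assms(1)[OF s, of "- q"]
    unfolding cost_gap_def by linarith
qed

lemma slice_chart_some_chart:
  assumes "C2_submanifold d X" "p \<in> X" "some_chart X d p = (B, \<phi>, \<psi>)"
  shows "slice_chart X d p B \<phi> \<psi>"
proof -
  obtain B' \<phi>' \<psi>' where "slice_chart X d p B' \<phi>' \<psi>'"
    using assms(1,2) unfolding C2_submanifold_def by blast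
  then have "(\<lambda>(B, \<phi>, \<psi>). slice_chart X d p B \<phi> \<psi>) (B', \<phi>', \<psi>')" by simp
  then have "(\<lambda>(B, \<phi>, \<psi>). slice_chart X d p B \<phi> \<psi>) (SOME (B, \<phi>, \<psi>). slice_chart X d p B \<phi> \<psi>)"
    by (rule someI)
  then have "(\<lambda>(B, \<phi>, \<psi>). slice_chart X d p B \<phi> \<psi>) (some_chart X d p)"
    by (simp only: some_chart_def)
  then show ?thesis unfolding assms(3) by simp
qed

lemma C2_on_submanifold_imp_continuous_on:
  assumes "C2_on_submanifold S f"
  shows "continuous_on S f"
  unfolding continuous_on_eq_continuous_within
proof
  fix p assume p: "p \<in> S"
  then obtain U F where U: "open U" "p \<in> U" "C2_on U F" "\<forall>y\<in>U \<inter> S. F y = f y"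
    using assms unfolding C2_on_submanifold_def by blast
  obtain r where r: "r > 0" "ball p r \<subseteq> U" using U(1,2) openE by blast
  have "continuous_on U F" by (intro C1_on_continuous_on C2_on_imp_C1_on U(3))
  then have "isCont F p" using U(1,2) by (simp add: continuous_on_eq_continuous_at)
  then have "continuous (at p within S) F" by (rule continuous_at_imp_continuous_at_within)
  then show "continuous (at p within S) f"
  proof (rule continuous_transform_within[OF _ r(1) p])
    fix y assume "y \<in> S" "dist y p < r"
    then have "y \<in> U \<inter> S" using r(2) by (auto simp: dist_commute)
    then show "F y = f y" using U(4) by blast
  qed
qed

lemma sets_bounded_density:
  assumes "bounded_density_wrt_hausdorff d X \<mu>"
  shows "sets \<mu> = sets (restrict_space borel X)"
proof -
  obtain \<rho> where "\<mu> = density (restrict_space (hausdorff_measure d) X) \<rho>"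
    using assms unfolding bounded_density_wrt_hausdorff_def Let_def by blast
  moreover have "sets (hausdorff_measure d :: 'a measure) = sets borel"
    unfolding hausdorff_measure_def using sets.sigma_sets_eq[of "borel :: 'a measure"] by (simp add: sets_measure_of)
  ultimately show ?thesis by (simp add: sets_restrict_space)
qed

text \<open>The charts are the ones selected by \<open>some_chart\<close>, through which the forms are defined.\<close>

lemma (in marginals) exists_local_sublevel_estimate:
  assumes "\<And>i. C2_submanifold (d i) (X i)" "\<And>i. bounded_density_wrt_hausdorff (d i) (X i) (\<mu> i)"
    and "CARD('m) \<ge> 2" "C2_on_submanifold (prod_set X) c" "x0 \<in> prod_set X" "\<kappa> \<le> d_plus X d c x0"
  shows "\<exists>N C. open N \<and> x0 \<in> N \<and> sublevel_bound ref c \<kappa> (N \<inter> prod_set X) C"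
proof -
  define B where "B i = fst (some_chart (X i) (d i) (x0 $ i))" for i
  define \<phi> where "\<phi> i = fst (snd (some_chart (X i) (d i) (x0 $ i)))" for i
  define \<psi> where "\<psi> i = snd (snd (some_chart (X i) (d i) (x0 $ i)))" for i
  have sc: "some_chart (X i) (d i) (x0 $ i) = (B i, \<phi> i, \<psi> i)" for i by (simp add: B_def \<phi>_def \<psi>_def)
  have chart: "slice_chart (X i) (d i) (x0 $ i) (B i) (\<phi> i) (\<psi> i)" for i
    by (rule slice_chart_some_chart[OF assms(1) _ sc]) (use assms(5) in \<open>simp add: prod_set_def\<close>)
  then have B_Basis: "B i \<subseteq> Basis" and B_card: "card (B i) = d i" for i by (auto simp: slice_chart_def)
  define P where "P i U V \<longleftrightarrow> open U \<and> x0 $ i \<in> U \<and> open V \<and> homeomorphism U V (\<phi> i) (\<psi> i) \<and>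
    C2_on U (\<phi> i) \<and> C2_on V (\<psi> i) \<and> \<phi> i ` (U \<inter> X i) = V \<inter> span (B i)" for i U V
  have "\<exists>U V. P i U V" for i using chart[of i] unfolding slice_chart_def P_def by (elim conjE)
  then obtain U V where P: "\<And>i. P i (U i) (V i)" by metis
  interpret product_chart X x0 B U V \<phi> \<psi>
    by unfold_locales (use assms(5) B_Basis P in \<open>simp_all add: P_def\<close>)
  obtain W F where F: "open W" "x0 \<in> W" "C2_on W F" "\<forall>y\<in>W \<inter> prod_set X. F y = c y"
    using assms(4,5) unfolding C2_on_submanifold_def by blast
  have dens: "bounded_density_wrt_hausdorff (card (B i)) (X i) (\<mu> i)" for i unfolding B_card by (rule assms(2))
  show ?thesis
    using local_sublevel_estimate[OF marginals_axioms dens assms(3) sc F(1-3) bspec[OF F(4)] assms(6)] by blast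
qed

lemma (in marginals) MOT_lower_bound:
  assumes K: "\<And>i. compact (K i)" "\<And>i. K i \<subseteq> X i" "\<And>i. AE x in \<mu> i. x \<in> K i"
    and c: "continuous_on (prod_set X) c" "\<And>x. x \<in> prod_set X \<Longrightarrow> 0 \<le> c x"
    and C: "C \<ge> 1" "sublevel_bound ref c \<kappa> (prod_set K) C"
    and A: "A = C * ((2 * real (Suc \<kappa>)) ^ \<kappa> / (1 - exp (- (1 / 2))))" and "\<epsilon> > 0"
  shows "MOT0 X \<mu> c + ereal (real \<kappa> / 2 * \<epsilon> * ln (1 / \<epsilon>) - ln A * \<epsilon>) \<le> MOT X \<mu> c \<epsilon>"
  unfolding MOT_def
proof (rule INF_greatest)
  fix \<gamma> assume \<gamma>: "\<gamma> \<in> couplings X \<mu>"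
  define Z where "Z = A * sqrt \<epsilon> ^ \<kappa>"
  have A0: "A > 0" using C(1) by (auto simp: A intro!: mult_pos_pos divide_pos_pos)
  have Z0: "Z > 0" using A0 \<open>\<epsilon> > 0\<close> by (simp add: Z_def)
  have lnZ: "ln Z = ln A + real \<kappa> / 2 * ln \<epsilon>"
    using A0 \<open>\<epsilon> > 0\<close> by (simp add: Z_def ln_mult ln_realpow ln_sqrt)
  show "MOT0 X \<mu> c + ereal (real \<kappa> / 2 * \<epsilon> * ln (1 / \<epsilon>) - ln A * \<epsilon>) \<le>
      enn2ereal (\<integral>\<^sup>+x. ennreal (c x) \<partial>\<gamma>) + ereal \<epsilon> * Ent \<gamma> ref"
  proof (rule ereal_le_epsilon2)
    fix \<delta> :: real assume "\<delta> > 0"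
    then have d3: "\<delta> / 3 > 0" by simp
    obtain \<phi> M where \<phi>: "\<And>i. \<phi> i \<in> borel_measurable (\<mu> i)" "\<And>i x. \<bar>\<phi> i x\<bar> \<le> M"
      and dual: "\<And>x. x \<in> prod_set K \<Longrightarrow> (\<Sum>i\<in>UNIV. \<phi> i (x $ i)) \<le> c x"
      and M0: "MOT0 X \<mu> c \<le> ereal ((\<Sum>i\<in>UNIV. \<integral>x. \<phi> i x \<partial>\<mu> i) + 3 * (\<delta> / 3))"
      using approximate_duality[OF K c d3] by blast
    define E where "E x = c x - (\<Sum>i\<in>UNIV. \<phi> i (x $ i))" for x
    have "c \<in> borel_measurable ref"
      using borel_measurable_continuous_on_restrict[OF c(1)] measurable_cong_sets[OF sets_ref refl] by blast
    moreover have "(\<lambda>x. \<phi> i (x $ i)) \<in> borel_measurable ref" for i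
      by (rule measurable_compose[OF couplingsD(4)[OF ref_coupling] \<phi>(1)])
    ultimately have E_meas: "E \<in> borel_measurable ref"
      unfolding E_def by (intro borel_measurable_diff borel_measurable_sum)
    have "AE x in ref. \<forall>i. x $ i \<in> K i" using ref_coupling K(3) by (rule AE_coupling)
    then have AE: "AE x in ref. x \<in> prod_set K \<and> 0 \<le> E x"
    proof eventually_elim
      case (elim x)
      then have "x \<in> prod_set K" by (simp add: prod_set_def)
      then show ?case using dual[of x] by (simp add: E_def)
    qed
    have "(\<integral>\<^sup>+x. ennreal (exp (- E x / \<epsilon>)) \<partial>ref) \<le> ennreal Z"
      unfolding Z_def A
    proof (rule nn_integral_exp_le[OF prob_space_ref E_meas AE C(1) _ \<open>\<epsilon> > 0\<close>])
      fix s :: real assume s: "0 < s" "s \<le> 1"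
      let ?S = "{x\<in>space ref. x \<in> prod_set K \<and> E x \<le> s\<^sup>2}"
      have "cost_gap c q x x' \<le> 2 * s\<^sup>2" if x: "x \<in> ?S" "x' \<in> ?S" for x x' q
      proof -
        have "cost_gap c q x x' \<le> E x + E x'"
          unfolding E_def
          by (rule excess_inequality[where K = K and \<phi> = \<phi> and c = c], erule dual) (use x in auto)
        then show ?thesis using x by simp
      qed
      moreover have "?S \<subseteq> prod_set K" by blast
      ultimately show "\<exists>T\<in>sets ref. ?S \<subseteq> T \<and> emeasure ref T \<le> ennreal (C * s ^ \<kappa>)"
        using C(2) s unfolding sublevel_bound_def by blast
    qed
    then have "(\<integral>\<^sup>+x. ennreal (exp (- (c x - (\<Sum>i\<in>UNIV. \<phi> i (x $ i))) / \<epsilon>)) \<partial>ref) \<le> ennreal Z"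
      by (simp only: E_def)
    from entropic_lower_bound[OF \<gamma> K c \<phi> Z0 this \<open>\<epsilon> > 0\<close>]
    have low: "ereal ((\<Sum>i\<in>UNIV. \<integral>x. \<phi> i x \<partial>\<mu> i) - \<epsilon> * ln Z) \<le>
      enn2ereal (\<integral>\<^sup>+x. ennreal (c x) \<partial>\<gamma>) + ereal \<epsilon> * Ent \<gamma> ref" .
    have "MOT0 X \<mu> c + ereal (real \<kappa> / 2 * \<epsilon> * ln (1 / \<epsilon>) - ln A * \<epsilon>) \<le>
        ereal ((\<Sum>i\<in>UNIV. \<integral>x. \<phi> i x \<partial>\<mu> i) + 3 * (\<delta> / 3)) + ereal (real \<kappa> / 2 * \<epsilon> * ln (1 / \<epsilon>) - ln A * \<epsilon>)"
      using M0 by (rule add_right_mono)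
    also have "\<dots> = ereal ((\<Sum>i\<in>UNIV. \<integral>x. \<phi> i x \<partial>\<mu> i) - \<epsilon> * ln Z) + ereal \<delta>"
      using \<open>\<epsilon> > 0\<close> by (simp add: lnZ ln_div algebra_simps)
    also have "\<dots> \<le> (enn2ereal (\<integral>\<^sup>+x. ennreal (c x) \<partial>\<gamma>) + ereal \<epsilon> * Ent \<gamma> ref) + ereal \<delta>"
      using low by (rule add_right_mono)
    finally show "MOT0 X \<mu> c + ereal (real \<kappa> / 2 * \<epsilon> * ln (1 / \<epsilon>) - ln A * \<epsilon>) \<le>
      (enn2ereal (\<integral>\<^sup>+x. ennreal (c x) \<partial>\<gamma>) + ereal \<epsilon> * Ent \<gamma> ref) + ereal \<delta>" .
  qed
qed

theorem proposition4p2: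
  fixes X :: "'m::finite \<Rightarrow> (real ^ 'n::finite) set"
    and d :: "'m \<Rightarrow> nat"
    and \<mu> :: "'m \<Rightarrow> (real ^ 'n) measure"
    and c :: "(real ^ 'n) ^ 'm \<Rightarrow> real"
    and \<kappa> :: nat
  assumes "CARD('m) \<ge> 2"
    and "\<And>i. C2_submanifold (d i) (X i)"
    and "\<And>i. prob_space (\<mu> i)"
    and "\<And>i. \<exists>K. compact K \<and> K \<subseteq> X i \<and> emeasure (\<mu> i) (X i - K) = 0"
    and "\<And>i. bounded_density_wrt_hausdorff (d i) (X i) (\<mu> i)"
    and "\<And>x. x \<in> prod_set X \<Longrightarrow> 0 \<le> c x"
    and "C2_on_submanifold (prod_set X) c"
    and "\<And>x. x \<in> prod_set X \<Longrightarrow> \<kappa> \<le> d_plus X d c x"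
  shows "\<exists>C::real. 0 \<le> C \<and> (\<forall>\<epsilon>>0.
           MOT X \<mu> c \<epsilon> \<ge> MOT0 X \<mu> c + ereal (real \<kappa> / 2 * \<epsilon> * ln (1 / \<epsilon>) - C * \<epsilon>))"
proof -
  interpret marginals X \<mu>
    by (rule marginals.intro, rule assms(3), rule sets_bounded_density[OF assms(5)])
  obtain K where K: "\<And>i. compact (K i)" "\<And>i. K i \<subseteq> X i" "\<And>i. emeasure (\<mu> i) (X i - K i) = 0"
    using assms(4) by metis
  have K_AE: "AE x in \<mu> i. x \<in> K i" for i
  proof (rule AE_I)
    show "{x\<in>space (\<mu> i). x \<notin> K i} \<subseteq> X i - K i" by (auto simp: space_marginal)
    show "emeasure (\<mu> i) (X i - K i) = 0" by (rule K(3))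
    have "X i \<inter> - K i \<in> sets (\<mu> i)"
      unfolding sets_marginal sets_restrict_space
      using compact_imp_closed[OF K(1)[of i]] by (intro imageI borel_open) (simp add: open_Compl)
    then show "X i - K i \<in> sets (\<mu> i)" by (simp add: Diff_eq)
  qed
  have c: "continuous_on (prod_set X) c" using assms(7) by (rule C2_on_submanifold_imp_continuous_on)
  have KX: "prod_set K \<subseteq> prod_set X" using K(2) by (auto simp: prod_set_def)
  have "\<exists>N C. open N \<and> x0 \<in> N \<and> sublevel_bound ref c \<kappa> (N \<inter> prod_set K) C" if "x0 \<in> prod_set K" for x0
  proof -
    have "x0 \<in> prod_set X" using that KX by blast
    then obtain N C where "open N" "x0 \<in> N" "sublevel_bound ref c \<kappa> (N \<inter> prod_set X) C"
      using exists_local_sublevel_estimate[OF assms(2,5,1,7) _ assms(8)] by blast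
    moreover have "N \<inter> prod_set K \<subseteq> N \<inter> prod_set X" using KX by blast
    ultimately show ?thesis by (meson sublevel_bound_subset)
  qed
  then show ?thesis
  proof (rule sublevel_bound_compact[OF compact_prod_set[OF K(1)]])
    fix C assume C: "1 \<le> C" "sublevel_bound ref c \<kappa> (prod_set K) C"
    define A where "A = C * ((2 * real (Suc \<kappa>)) ^ \<kappa> / (1 - exp (- (1 / 2))))"
    show ?thesis
    proof (intro exI[of _ "max 0 (ln A)"] conjI allI impI)
      show "0 \<le> max 0 (ln A)" by simp
      fix \<epsilon> :: real assume \<epsilon>: "\<epsilon> > 0"
      have "MOT0 X \<mu> c + ereal (real \<kappa> / 2 * \<epsilon> * ln (1 / \<epsilon>) - max 0 (ln A) * \<epsilon>) \<le>
          MOT0 X \<mu> c + ereal (real \<kappa> / 2 * \<epsilon> * ln (1 / \<epsilon>) - ln A * \<epsilon>)"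
        using \<epsilon> by (intro add_left_mono) (simp add: mult_right_mono)
      also have "\<dots> \<le> MOT X \<mu> c \<epsilon>"
        by (rule MOT_lower_bound[OF K(1,2) K_AE c assms(6) C A_def \<epsilon>])
      finally show "MOT0 X \<mu> c + ereal (real \<kappa> / 2 * \<epsilon> * ln (1 / \<epsilon>) - max 0 (ln A) * \<epsilon>) \<le> MOT X \<mu> c \<epsilon>" .
    qed
  qed
qed

end
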